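(* Let $p$ be a prime number and let $\alpha=(\alpha_n)_{n\in\mathbb{N}}\in\Xi_p$ with $\alpha_0\notin\mathbb{Q}$. Let $\gamma=z+q\alpha_N$ for some $z,q\in\mathbb{Z}$ and $N\in\mathbb{N}$, with $\gamma>0$. Then there is a (finitely generated) left projective module over $\mathscr{A}^{\mathscr{S}}_\alpha$ whose $K_0$ class has trace $\gamma$, i.e. whose class is mapped to $\gamma$ by $\tau:K_0(\mathscr{A}^{\mathscr{S}}_\alpha)\to\mathbb{R}$; or equivalently (when the fraction $q/p^N$ is in reduced form), whose $K_0$ class is given by $\left(z,\frac{q}{p^N}\right)\in\mathbb{Z}\times\mathbb{Z}[\frac1p]$ under the identification $K_0(\mathscr{A}^{\mathscr{S}}_\alpha)=\mathscr{Q}_J$.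
   Context: $\mathbb{N}=\{0,1,2,\dots\}$. $\mathbb{Z}[\frac1p]=\{z/p^k: z\in\mathbb{Z},k\in\mathbb{N}\}\subset\mathbb{Q}$ is a discrete additive group. $\Xi_p$ is the set of real sequences $(\alpha_n)_{n\in\mathbb{N}}$ such that $\alpha_0\in[0,1)$ and for every $n\in\mathbb{N}$ there is $k\in\{0,\dots,p-1\}$ with $p\alpha_{n+1}=\alpha_n+k$. For $\alpha\in\Xi_p$, $\Psi_\alpha$ is the multiplier (circle-valued 2-cocycle) of $\mathbb{Z}[\frac1p]\times\mathbb{Z}[\frac1p]$ given by $$\Psi_\alpha\left(\left(\tfrac{q_1}{p^{k_1}},\tfrac{q_2}{p^{k_2}}\right),\left(\tfrac{q_3}{p^{k_3}},\tfrac{q_4}{p^{k_4}}\right)\right)=\exp\left(2i\pi\alpha_{k_1+k_4}q_1q_4\right),$$ and $\mathscr{A}^{\mathscr{S}}_\alpha=C^*\left(\mathbb{Z}[\frac1p]\times\mathbb{Z}[\frac1p],\Psi_\alpha\right)$ is the twisted group C*-algebra: the universal C*-algebra generated by unitaries $(W_g)_{g\in\mathbb{Z}[\frac1p]^2}$ with $W_gW_h=\Psi_\alpha(g,h)W_{g+h}$. Known description of $K_0$. All tracial states of $\mathscr{A}^{\mathscr{S}}_\alpha$ induce one and the same homomorphism $\tau:K_0(\mathscr{A}^{\mathscr{S}}_\alpha)\to\mathbb{R}$, called the trace on $K_0$. Put $J_k=p^k\alpha_k-\alpha_0\in\mathbb{Z}$ for $k\in\mathbb{N}$. Let $\mathscr{Q}_J$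 be the abelian group with underlying set $\mathbb{Z}\times\mathbb{Z}[\frac1p]$ and operation $(z_1,r_1)\boxplus(z_2,r_2)=(z_1+z_2+\xi_J(r_1,r_2),r_1+r_2)$ where, all fractions being written in reduced form (the exponent of $p$ in the denominator is minimal), $$\xi_J\left(\tfrac{q_1}{p^{k_1}},\tfrac{q_2}{p^{k_2}}\right)=\begin{cases}-\frac{q_1}{p^{k_1}}(J_{k_2}-J_{k_1})& k_2>k_1,\\ -\frac{q_2}{p^{k_2}}(J_{k_1}-J_{k_2})& k_1>k_2,\\ \frac{q}{p^r}(J_{k_1}-J_r)& k_1=k_2,\ \frac{q}{p^r}=\frac{q_1}{p^{k_1}}+\frac{q_2}{p^{k_2}}.\end{cases}$$ Then $K_0(\mathscr{A}^{\mathscr{S}}_\alpha)$ is identified with $\mathscr{Q}_J$ in such a way that $\tau(1,0)=1$ and $\tau\left(0,\frac{1}{p^k}\right)=\alpha_k$ for all $k\in\mathbb{N}$. *)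

theory Defs
  imports Complex_Main "HOL-Algebra.Module" "HOL-Library.Product_Plus"
    "HOL-Computational_Algebra.Primes"
begin

section \<open>Unital C*-algebras\<close>

record 'a cstar_alg = "(complex, 'a) module" +
  adj :: "'a \<Rightarrow> 'a"
  cnorm :: "'a \<Rightarrow> real"

locale cstar_algebra = ring A for A :: "'a cstar_alg" (structure) +
  assumes scale_closed: "x \<in> carrier A \<Longrightarrow> c \<odot> x \<in> carrier A"
    and scale_add_left: "x \<in> carrier A \<Longrightarrow> (c + d) \<odot> x = c \<odot> x \<oplus> d \<odot> x"
    and scale_add_right: "\<lbrakk>x \<in> carrier A; y \<in> carrier A\<rbrakk> \<Longrightarrow> c \<odot> (x \<oplus> y) = c \<odot> x \<oplus> c \<odot> y"
    and scale_scale: "x \<in> carrier A \<Longrightarrow> (c * d) \<odot> x = c \<odot> (d \<odot> x)"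
    and scale_one: "x \<in> carrier A \<Longrightarrow> 1 \<odot> x = x"
    and scale_mult_left: "\<lbrakk>x \<in> carrier A; y \<in> carrier A\<rbrakk> \<Longrightarrow> (c \<odot> x) \<otimes> y = c \<odot> (x \<otimes> y)"
    and scale_mult_right: "\<lbrakk>x \<in> carrier A; y \<in> carrier A\<rbrakk> \<Longrightarrow> x \<otimes> (c \<odot> y) = c \<odot> (x \<otimes> y)"
    and adj_closed: "x \<in> carrier A \<Longrightarrow> adj A x \<in> carrier A"
    and adj_adj: "x \<in> carrier A \<Longrightarrow> adj A (adj A x) = x"
    and adj_add: "\<lbrakk>x \<in> carrier A; y \<in> carrier A\<rbrakk> \<Longrightarrow> adj A (x \<oplus> y) = adj A x \<oplus> adj A y"
    and adj_scale: "x \<in> carrier A \<Longrightarrow> adj A (c \<odot> x) = cnj c \<odot> adj A x"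
    and adj_mult: "\<lbrakk>x \<in> carrier A; y \<in> carrier A\<rbrakk> \<Longrightarrow> adj A (x \<otimes> y) = adj A y \<otimes> adj A x"
    and norm_nonneg: "x \<in> carrier A \<Longrightarrow> 0 \<le> cnorm A x"
    and norm_eq_0: "x \<in> carrier A \<Longrightarrow> cnorm A x = 0 \<longleftrightarrow> x = \<zero>"
    and norm_add: "\<lbrakk>x \<in> carrier A; y \<in> carrier A\<rbrakk> \<Longrightarrow> cnorm A (x \<oplus> y) \<le> cnorm A x + cnorm A y"
    and norm_scale: "x \<in> carrier A \<Longrightarrow> cnorm A (c \<odot> x) = cmod c * cnorm A x"
    and norm_mult: "\<lbrakk>x \<in> carrier A; y \<in> carrier A\<rbrakk> \<Longrightarrow> cnorm A (x \<otimes> y) \<le> cnorm A x * cnorm A y"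
    and cstar_identity: "x \<in> carrier A \<Longrightarrow> cnorm A (adj A x \<otimes> x) = (cnorm A x)\<^sup>2"
    and complete: "\<lbrakk>\<And>n. X n \<in> carrier A;
        \<forall>\<epsilon>>0. \<exists>K. \<forall>m\<ge>K. \<forall>n\<ge>K. cnorm A (X m \<ominus> X n) < \<epsilon>\<rbrakk>
      \<Longrightarrow> \<exists>x\<in>carrier A. (\<lambda>n. cnorm A (X n \<ominus> x)) \<longlonglongrightarrow> 0"

definition star_hom :: "'a cstar_alg \<Rightarrow> 'b cstar_alg \<Rightarrow> ('a \<Rightarrow> 'b) \<Rightarrow> bool" where
  "star_hom A B h \<longleftrightarrow> h \<in> ring_hom A B \<and>
     (\<forall>x\<in>carrier A. \<forall>c. h (c \<odot>\<^bsub>A\<^esub> x) = c \<odot>\<^bsub>B\<^esub> h x) \<and>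
     (\<forall>x\<in>carrier A. h (adj A x) = adj B (h x))"

definition unitary_elt :: "'a cstar_alg \<Rightarrow> 'a \<Rightarrow> bool" where
  "unitary_elt A u \<longleftrightarrow> u \<in> carrier A \<and> adj A u \<otimes>\<^bsub>A\<^esub> u = \<one>\<^bsub>A\<^esub> \<and> u \<otimes>\<^bsub>A\<^esub> adj A u = \<one>\<^bsub>A\<^esub>"

definition tracial_state :: "'a cstar_alg \<Rightarrow> ('a \<Rightarrow> complex) \<Rightarrow> bool" where
  "tracial_state A \<phi> \<longleftrightarrow>
     (\<forall>x\<in>carrier A. \<forall>y\<in>carrier A. \<phi> (x \<oplus>\<^bsub>A\<^esub> y) = \<phi> x + \<phi> y) \<and>
     (\<forall>x\<in>carrier A. \<forall>c. \<phi> (c \<odot>\<^bsub>A\<^esub> x) = c * \<phi> x) \<and>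
     (\<forall>x\<in>carrier A. \<phi> (adj A x \<otimes>\<^bsub>A\<^esub> x) \<in> \<real> \<and> 0 \<le> Re (\<phi> (adj A x \<otimes>\<^bsub>A\<^esub> x))) \<and>
     \<phi> \<one>\<^bsub>A\<^esub> = 1 \<and>
     (\<forall>x\<in>carrier A. \<forall>y\<in>carrier A. \<phi> (x \<otimes>\<^bsub>A\<^esub> y) = \<phi> (y \<otimes>\<^bsub>A\<^esub> x))"


section \<open>Twisted group C*-algebras\<close>

definition unitary_family ::
    "'g::ab_group_add set \<Rightarrow> ('g \<Rightarrow> 'g \<Rightarrow> complex) \<Rightarrow> 'a cstar_alg \<Rightarrow> ('g \<Rightarrow> 'a) \<Rightarrow> bool" where
  "unitary_family G \<sigma> A W \<longleftrightarrow> (\<forall>g\<in>G. unitary_elt A (W g)) \<and>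
     (\<forall>g\<in>G. \<forall>h\<in>G. W g \<otimes>\<^bsub>A\<^esub> W h = \<sigma> g h \<odot>\<^bsub>A\<^esub> W (g + h))"

text \<open>The *-algebra generated by symbols \<open>W g\<close> subject to these relations consists of the formal
  sums \<open>\<Sum>g. f g W g\<close> with finitely supported \<open>f\<close>.  Its product and involution are transported to
  coefficient functions below; for the involution note that \<open>W (-x) W x = \<sigma> (-x) x W 0\<close>
  and \<open>W 0 = 1\<close> for a normalised multiplier, so \<open>(W (-x))* = cnj (\<sigma> (-x) x) W x\<close>.\<close>

definition finsupp :: "'g set \<Rightarrow> ('g \<Rightarrow> complex) set" where
  "finsupp G = {f. finite {g. f g \<noteq> 0} \<and> {g. f g \<noteq> 0} \<subseteq> G}"

definition tconv :: "('g::ab_group_add \<Rightarrow> 'g \<Rightarrow> complex) \<Rightarrow> ('g \<Rightarrow> complex) \<Rightarrow> ('g \<Rightarrow> complex) \<Rightarrow> 'g \<Rightarrow> complex" where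
  "tconv \<sigma> f h = (\<lambda>x. \<Sum>y | f y \<noteq> 0. f y * h (x - y) * \<sigma> y (x - y))"

definition tstar :: "('g::ab_group_add \<Rightarrow> 'g \<Rightarrow> complex) \<Rightarrow> ('g \<Rightarrow> complex) \<Rightarrow> 'g \<Rightarrow> complex" where
  "tstar \<sigma> f = (\<lambda>x. cnj (f (- x) * \<sigma> (- x) x))"

definition cstar_seminorm ::
    "'g::ab_group_add set \<Rightarrow> ('g \<Rightarrow> 'g \<Rightarrow> complex) \<Rightarrow> (('g \<Rightarrow> complex) \<Rightarrow> real) \<Rightarrow> bool" where
  "cstar_seminorm G \<sigma> \<nu> \<longleftrightarrow> (\<forall>f\<in>finsupp G. 0 \<le> \<nu> f \<and>
     (\<forall>c. \<nu> (\<lambda>g. c * f g) = cmod c * \<nu> f) \<and>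
     \<nu> (tconv \<sigma> (tstar \<sigma> f) f) = (\<nu> f)\<^sup>2 \<and>
     (\<forall>h\<in>finsupp G. \<nu> (\<lambda>g. f g + h g) \<le> \<nu> f + \<nu> h \<and> \<nu> (tconv \<sigma> f h) \<le> \<nu> f * \<nu> h))"

definition lincomb :: "'a cstar_alg \<Rightarrow> ('g \<Rightarrow> 'a) \<Rightarrow> ('g \<Rightarrow> complex) \<Rightarrow> 'a" where
  "lincomb A W f = (\<Oplus>\<^bsub>A\<^esub>g\<in>{g. f g \<noteq> 0}. f g \<odot>\<^bsub>A\<^esub> W g)"

text \<open>\<open>(A, W)\<close> is (a model of) the universal C*-algebra generated by unitaries \<open>W g\<close>, \<open>g \<in> G\<close>, with
  \<open>W g W h = \<sigma> g h W (g + h)\<close>: the completion of the *-algebra above in its greatest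
  C*-seminorm.  Quantifying over C*-seminorms takes the place of quantifying over all C*-algebras
  containing such a family, which is impossible inside a definition since they live on arbitrary
  types; lemma \<open>twisted_group_cstar_universal\<close> derives the universal property with targets on
  an arbitrary type (uniqueness of the homomorphism is clear from density).\<close>

definition twisted_group_cstar ::
    "'g::ab_group_add set \<Rightarrow> ('g \<Rightarrow> 'g \<Rightarrow> complex) \<Rightarrow> 'a cstar_alg \<Rightarrow> ('g \<Rightarrow> 'a) \<Rightarrow> bool" where
  "twisted_group_cstar G \<sigma> A W \<longleftrightarrow> cstar_algebra A \<and> unitary_family G \<sigma> A W \<and>
     (\<forall>x\<in>carrier A. \<forall>\<epsilon>>0. \<exists>f\<in>finsupp G. cnorm A (x \<ominus>\<^bsub>A\<^esub> lincomb A W f) < \<epsilon>) \<and>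
     (\<forall>\<nu>. cstar_seminorm G \<sigma> \<nu> \<longrightarrow> (\<forall>f\<in>finsupp G. \<nu> f \<le> cnorm A (lincomb A W f)))"

context cstar_algebra
begin

lemma scale_zero_left: "x \<in> carrier A \<Longrightarrow> 0 \<odot> x = \<zero>"
  using scale_add_left[of x 0 0] scale_closed[of x 0]
  by (metis add.r_cancel_one' add_0)

lemma scale_zero_right: "c \<odot> \<zero> = \<zero>"
  using scale_add_right[of \<zero> \<zero> c] scale_closed[of \<zero> c]
  by (metis add.r_cancel_one' r_zero zero_closed)

lemma scale_minus_one: "x \<in> carrier A \<Longrightarrow> (- 1) \<odot> x = \<ominus> x"
  using scale_add_left[of x "- 1" 1] scale_closed[of x "- 1"]
  by (simp add: scale_zero_left scale_one minus_equality)

lemma adj_zero: "adj A \<zero> = \<zero>"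
  using adj_scale[of \<zero> 0] by (simp add: scale_zero_left adj_closed)

lemma adj_one: "adj A \<one> = \<one>"
  by (metis adj_adj adj_closed adj_mult l_one one_closed r_one)

lemma scale_one_inj:
  assumes "\<one> \<noteq> \<zero>" "c \<odot> \<one> = d \<odot> \<one>"
  shows "c = d"
proof -
  have "(c - d) \<odot> \<one> \<oplus> d \<odot> \<one> = c \<odot> \<one>"
    using scale_add_left[of \<one> "c - d" d] by simp
  then have "(c - d) \<odot> \<one> = \<zero>" using assms(2) scale_closed[OF one_closed]
    by (metis add.r_cancel_one)
  then have "cmod (c - d) * cnorm A \<one> = 0"
    using norm_scale[of \<one> "c - d"] norm_eq_0[of \<zero>] by simp
  then show ?thesis using assms(1) norm_eq_0[of \<one>] by simp
qed

lemma norm_minus: "x \<in> carrier A \<Longrightarrow> cnorm A (\<ominus> x) = cnorm A x"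
  using norm_scale[of x "- 1"] by (simp add: scale_minus_one)

lemma norm_minus_commute:
  assumes "x \<in> carrier A" "y \<in> carrier A"
  shows "cnorm A (x \<ominus> y) = cnorm A (y \<ominus> x)"
proof -
  have "\<ominus> (x \<ominus> y) = y \<ominus> x"
    using assms by (simp add: a_minus_def minus_add a_comm)
  then show ?thesis using norm_minus[of "x \<ominus> y"] assms by simp
qed

lemma norm_triangle_sub:
  assumes "x \<in> carrier A" "y \<in> carrier A" "z \<in> carrier A"
  shows "cnorm A (x \<ominus> z) \<le> cnorm A (x \<ominus> y) + cnorm A (y \<ominus> z)"
proof -
  have "x \<ominus> z = (x \<ominus> y) \<oplus> (y \<ominus> z)"
    using assms by (simp add: a_minus_def a_assoc) (simp add: a_assoc[symmetric] l_neg)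
  then show ?thesis using norm_add[of "x \<ominus> y" "y \<ominus> z"] assms by simp
qed

lemma norm_triangle_abs:
  assumes "x \<in> carrier A" "y \<in> carrier A"
  shows "cnorm A x \<le> cnorm A (x \<ominus> y) + cnorm A y"
  using norm_triangle_sub[of x y \<zero>] assms by (simp add: a_minus_def)

lemma norm_adj:
  assumes x: "x \<in> carrier A"
  shows "cnorm A (adj A x) = cnorm A x"
proof -
  have le: "cnorm A y \<le> cnorm A (adj A y)" if y: "y \<in> carrier A" for y
  proof (cases "cnorm A y = 0")
    case True
    then show ?thesis using norm_nonneg[OF adj_closed[OF y]] by simp
  next
    case False
    have "cnorm A y * cnorm A y \<le> cnorm A (adj A y) * cnorm A y"
      using cstar_identity[OF y] norm_mult[OF adj_closed[OF y] y] by (simp add: power2_eq_square)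
    then show ?thesis using False norm_nonneg[OF y] by simp
  qed
  show ?thesis using le[OF x] le[OF adj_closed[OF x]] adj_adj[OF x] by simp
qed

lemma scale_sum:
  assumes "finite S" "w \<in> carrier A"
  shows "(\<Sum>y\<in>S. c y) \<odot> w = (\<Oplus>y\<in>S. c y \<odot> w)"
  using assms(1)
proof induction
  case empty
  then show ?case using assms(2) by (simp add: scale_zero_left)
next
  case (insert y S)
  then show ?case using assms(2) by (simp add: scale_add_left scale_closed)
qed

lemma scale_finsum:
  assumes "finite S" "\<And>y. y \<in> S \<Longrightarrow> w y \<in> carrier A"
  shows "c \<odot> (\<Oplus>y\<in>S. w y) = (\<Oplus>y\<in>S. c \<odot> w y)"
  using assms
proof induction
  case empty
  then show ?case by (simp add: scale_zero_right)
next
  case (insert y S)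
  then show ?case by (simp add: scale_add_right scale_closed Pi_def)
qed

lemma adj_finsum:
  assumes "finite S" "\<And>y. y \<in> S \<Longrightarrow> w y \<in> carrier A"
  shows "adj A (\<Oplus>y\<in>S. w y) = (\<Oplus>y\<in>S. adj A (w y))"
  using assms
proof induction
  case empty
  then show ?case by (simp add: adj_zero)
next
  case (insert y S)
  then show ?case by (simp add: adj_add adj_closed Pi_def)
qed

lemma finsum_swap:
  assumes "finite S" "finite U" "\<And>x y. x \<in> U \<Longrightarrow> y \<in> S \<Longrightarrow> F x y \<in> carrier A"
  shows "(\<Oplus>x\<in>U. \<Oplus>y\<in>S. F x y) = (\<Oplus>y\<in>S. \<Oplus>x\<in>U. F x y)"
  using assms
proof (induction S)
  case empty
  then show ?case by (simp add: finsum_zero)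
next
  case (insert y S)
  have "(\<Oplus>x\<in>U. \<Oplus>y\<in>insert y S. F x y) = (\<Oplus>x\<in>U. F x y \<oplus> (\<Oplus>y\<in>S. F x y))"
    using insert.hyps insert.prems by (intro finsum_cong') (auto simp: Pi_def intro!: finsum_closed)
  also have "\<dots> = (\<Oplus>x\<in>U. F x y) \<oplus> (\<Oplus>x\<in>U. \<Oplus>y\<in>S. F x y)"
    using insert.prems by (intro finsum_addf) (auto intro!: finsum_closed)
  also have "\<dots> = (\<Oplus>y\<in>insert y S. \<Oplus>x\<in>U. F x y)"
    using insert by (simp add: Pi_def)
  finally show ?case .
qed

lemma lincomb_superset:
  assumes "finite S" "{g. f g \<noteq> 0} \<subseteq> S" "\<And>g. g \<in> S \<Longrightarrow> W g \<in> carrier A"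
  shows "lincomb A W f = (\<Oplus>g\<in>S. f g \<odot> W g)"
  unfolding lincomb_def
  using assms by (intro add.finprod_mono_neutral_cong_left) (auto simp: scale_closed scale_zero_left)

end

lemma finsupp_subsetI:
  assumes "{g. f g \<noteq> 0} \<subseteq> S" "finite S" "S \<subseteq> G"
  shows "f \<in> finsupp G"
  unfolding finsupp_def using finite_subset[OF assms(1,2)] subset_trans[OF assms(1,3)] by simp

lemma finsupp_tconv:
  fixes G :: "'g::ab_group_add set"
  assumes G: "\<And>g h. g \<in> G \<Longrightarrow> h \<in> G \<Longrightarrow> g + h \<in> G" and f: "f \<in> finsupp G" and h: "h \<in> finsupp G"
  shows "{x. tconv \<sigma> f h x \<noteq> 0} \<subseteq> (\<lambda>(y, z). y + z) ` ({g. f g \<noteq> 0} \<times> {g. h g \<noteq> 0})"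
    and "tconv \<sigma> f h \<in> finsupp G"
proof -
  let ?U = "(\<lambda>(y, z). y + z) ` ({g. f g \<noteq> 0} \<times> {g. h g \<noteq> 0})"
  show *: "{x. tconv \<sigma> f h x \<noteq> 0} \<subseteq> ?U"
  proof
    fix x assume "x \<in> {x. tconv \<sigma> f h x \<noteq> 0}"
    then have "(\<Sum>y | f y \<noteq> 0. f y * h (x - y) * \<sigma> y (x - y)) \<noteq> 0" unfolding tconv_def by simp
    then obtain y where y: "y \<in> {y. f y \<noteq> 0}" "f y * h (x - y) * \<sigma> y (x - y) \<noteq> 0"
      by (rule sum.not_neutral_contains_not_neutral)
    show "x \<in> ?U"
      by (rule image_eqI[of _ _ "(y, x - y)"]) (use y in auto)
  qed
  show "tconv \<sigma> f h \<in> finsupp G"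
  proof (rule finsupp_subsetI[OF *])
    show "finite ?U" using f h unfolding finsupp_def by (intro finite_imageI finite_cartesian_product) simp_all
    show "?U \<subseteq> G" using f h unfolding finsupp_def by (auto intro!: G)
  qed
qed

lemma finsupp_tstar:
  fixes G :: "'g::ab_group_add set"
  assumes G: "\<And>g. g \<in> G \<Longrightarrow> - g \<in> G" and f: "f \<in> finsupp G"
  shows "{x. tstar \<sigma> f x \<noteq> 0} \<subseteq> uminus ` {g. f g \<noteq> 0}" and "tstar \<sigma> f \<in> finsupp G"
proof -
  show *: "{x. tstar \<sigma> f x \<noteq> 0} \<subseteq> uminus ` {g. f g \<noteq> 0}"
  proof
    fix x assume "x \<in> {x. tstar \<sigma> f x \<noteq> 0}"
    then have "f (- x) \<noteq> 0" unfolding tstar_def by auto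
    then show "x \<in> uminus ` {g. f g \<noteq> 0}" by (intro image_eqI[of _ _ "- x"]) simp_all
  qed
  show "tstar \<sigma> f \<in> finsupp G"
  proof (rule finsupp_subsetI[OF *])
    show "finite (uminus ` {g. f g \<noteq> 0})" using f unfolding finsupp_def by simp
    show "uminus ` {g. f g \<noteq> 0} \<subseteq> G" using f unfolding finsupp_def by (auto intro!: G)
  qed
qed

locale unitary_representation = cstar_algebra A
    for A :: "'a cstar_alg" (structure) and G :: "'g::ab_group_add set" and \<sigma> W +
  assumes G_zero: "0 \<in> G" and G_add: "\<And>g h. g \<in> G \<Longrightarrow> h \<in> G \<Longrightarrow> g + h \<in> G"
    and G_uminus: "\<And>g. g \<in> G \<Longrightarrow> - g \<in> G"
    and \<sigma>_zero: "\<sigma> 0 0 = 1" and \<sigma>_unit: "\<And>g h. g \<in> G \<Longrightarrow> h \<in> G \<Longrightarrow> cmod (\<sigma> g h) = 1"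
    and family: "unitary_family G \<sigma> A W"
begin

lemma W_closed: "g \<in> G \<Longrightarrow> W g \<in> carrier A"
  using family unfolding unitary_family_def unitary_elt_def by blast

lemma W_mult: "g \<in> G \<Longrightarrow> h \<in> G \<Longrightarrow> W g \<otimes> W h = \<sigma> g h \<odot> W (g + h)"
  using family unfolding unitary_family_def by blast

lemma W_unitary: "g \<in> G \<Longrightarrow> adj A (W g) \<otimes> W g = \<one> \<and> W g \<otimes> adj A (W g) = \<one>"
  using family unfolding unitary_family_def unitary_elt_def by blast

lemma W_zero: "W 0 = \<one>"
proof -
  have c: "W 0 \<in> carrier A" "adj A (W 0) \<in> carrier A" using W_closed G_zero adj_closed by auto
  have "W 0 \<otimes> W 0 = W 0" using W_mult[OF G_zero G_zero] c by (simp add: \<sigma>_zero scale_one)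
  then have "adj A (W 0) \<otimes> (W 0 \<otimes> W 0) = adj A (W 0) \<otimes> W 0" by simp
  then show ?thesis using c W_unitary[OF G_zero] by (simp add: m_assoc[symmetric])
qed

lemma W_adj:
  assumes g: "g \<in> G"
  shows "adj A (W g) = cnj (\<sigma> g (- g)) \<odot> W (- g)"
proof -
  have c: "W g \<in> carrier A" "adj A (W g) \<in> carrier A" "W (- g) \<in> carrier A"
    using W_closed G_uminus adj_closed g by auto
  have u: "cnj (\<sigma> g (- g)) * \<sigma> g (- g) = 1"
    using \<sigma>_unit[OF g G_uminus[OF g]] complex_norm_square[of "\<sigma> g (- g)"] by (simp add: mult.commute)
  have "W g \<otimes> W (- g) = \<sigma> g (- g) \<odot> \<one>"
    using W_mult[OF g G_uminus[OF g]] W_zero by simp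
  then have "W g \<otimes> (cnj (\<sigma> g (- g)) \<odot> W (- g)) = \<one>"
    using c u by (simp add: scale_mult_right scale_scale[symmetric] scale_one)
  then have "adj A (W g) \<otimes> (W g \<otimes> (cnj (\<sigma> g (- g)) \<odot> W (- g))) = adj A (W g)"
    using c by simp
  then show ?thesis
    using c W_unitary[OF g] by (simp add: m_assoc[symmetric] scale_closed)
qed

lemma finsuppD: "f \<in> finsupp G \<Longrightarrow> finite {g. f g \<noteq> 0}" "f \<in> finsupp G \<Longrightarrow> f g \<noteq> 0 \<Longrightarrow> g \<in> G"
  unfolding finsupp_def by auto

lemma lincomb_closed: "f \<in> finsupp G \<Longrightarrow> lincomb A W f \<in> carrier A"
  unfolding lincomb_def using finsuppD W_closed
  by (intro finsum_closed) (auto intro!: scale_closed)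

lemma lincomb_add:
  assumes "f \<in> finsupp G" "h \<in> finsupp G"
  shows "lincomb A W (\<lambda>g. f g + h g) = lincomb A W f \<oplus> lincomb A W h"
proof -
  define S where "S = {g. f g \<noteq> 0} \<union> {g. h g \<noteq> 0}"
  have S: "finite S" "S \<subseteq> G" using assms unfolding S_def finsupp_def by auto
  have W: "\<And>g. g \<in> S \<Longrightarrow> W g \<in> carrier A" using S W_closed by blast
  have "lincomb A W (\<lambda>g. f g + h g) = (\<Oplus>g\<in>S. (f g + h g) \<odot> W g)"
    using S W by (intro lincomb_superset) (auto simp: S_def)
  also have "\<dots> = (\<Oplus>g\<in>S. f g \<odot> W g \<oplus> h g \<odot> W g)"
    using W by (intro finsum_cong') (auto simp: scale_add_left scale_closed)
  also have "\<dots> = (\<Oplus>g\<in>S. f g \<odot> W g) \<oplus> (\<Oplus>g\<in>S. h g \<odot> W g)"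
    using W by (intro finsum_addf) (auto simp: scale_closed)
  also have "\<dots> = lincomb A W f \<oplus> lincomb A W h"
    using S W by (subst (1 2) lincomb_superset[of S]) (auto simp: S_def)
  finally show ?thesis .
qed

lemma lincomb_scale:
  assumes "f \<in> finsupp G"
  shows "lincomb A W (\<lambda>g. c * f g) = c \<odot> lincomb A W f"
proof -
  define S where "S = {g. f g \<noteq> 0}"
  have S: "finite S" "S \<subseteq> G" using assms unfolding S_def finsupp_def by auto
  have W: "\<And>g. g \<in> S \<Longrightarrow> W g \<in> carrier A" using S W_closed by blast
  have "lincomb A W (\<lambda>g. c * f g) = (\<Oplus>g\<in>S. (c * f g) \<odot> W g)"
    using S W by (intro lincomb_superset) (auto simp: S_def)
  also have "\<dots> = (\<Oplus>g\<in>S. c \<odot> (f g \<odot> W g))"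
    using W by (intro finsum_cong') (auto simp: scale_scale scale_closed)
  also have "\<dots> = c \<odot> (\<Oplus>g\<in>S. f g \<odot> W g)"
    using S W by (intro scale_finsum[symmetric]) (auto simp: scale_closed)
  finally show ?thesis by (simp add: lincomb_def S_def)
qed

lemma lincomb_tconv:
  assumes f: "f \<in> finsupp G" and h: "h \<in> finsupp G"
  shows "lincomb A W (tconv \<sigma> f h) = lincomb A W f \<otimes> lincomb A W h"
proof -
  define S T where "S = {g. f g \<noteq> 0}" and "T = {g. h g \<noteq> 0}"
  define U where "U = (\<lambda>(y, z). y + z) ` (S \<times> T)"
  have S: "finite S" "S \<subseteq> G" and T: "finite T" "T \<subseteq> G"
    using assms unfolding S_def T_def finsupp_def by auto
  have U: "finite U" "U \<subseteq> G" using S T G_add unfolding U_def by auto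
  have W: "\<And>g. g \<in> S \<Longrightarrow> W g \<in> carrier A" "\<And>g. g \<in> T \<Longrightarrow> W g \<in> carrier A"
      "\<And>g. g \<in> U \<Longrightarrow> W g \<in> carrier A" using S T U W_closed by blast+
  define t where "t = (\<lambda>y x. f y * h (x - y) * \<sigma> y (x - y))"
  have inner: "(\<Oplus>x\<in>U. t y x \<odot> W x) = (f y \<odot> W y) \<otimes> (\<Oplus>z\<in>T. h z \<odot> W z)" if y: "y \<in> S" for y
  proof -
    have yT: "(+) y ` T \<subseteq> U" using y unfolding U_def by auto
    have "(\<Oplus>x\<in>U. t y x \<odot> W x) = (\<Oplus>x\<in>(+) y ` T. t y x \<odot> W x)"
    proof (rule add.finprod_mono_neutral_cong_right)
      show "finite U" by (fact U)
      show "(+) y ` T \<subseteq> U" by (fact yT)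
      fix x assume x: "x \<in> U - (+) y ` T"
      then have "x - y \<notin> T" by (auto simp: image_iff)
      then have "t y x = 0" unfolding t_def T_def by simp
      then show "t y x \<odot> W x = \<zero>" using x W by (simp add: scale_zero_left)
    qed (use W yT in \<open>auto simp: scale_closed\<close>)
    also have "\<dots> = (\<Oplus>z\<in>T. t y (y + z) \<odot> W (y + z))"
      using W yT by (intro finsum_reindex) (auto simp: scale_closed)
    also have "\<dots> = (\<Oplus>z\<in>T. (f y \<odot> W y) \<otimes> (h z \<odot> W z))"
    proof (rule finsum_cong')
      fix z assume z: "z \<in> T"
      have yz: "y \<in> G" "z \<in> G" using y z S T by auto
      have "(f y \<odot> W y) \<otimes> (h z \<odot> W z) = f y \<odot> (h z \<odot> (W y \<otimes> W z))"
        using W y z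
        by (simp add: scale_mult_left scale_mult_right scale_closed scale_scale[symmetric] mult.commute)
      also have "\<dots> = t y (y + z) \<odot> W (y + z)"
        using W_closed G_add yz by (simp add: W_mult t_def scale_scale scale_closed)
      finally show "t y (y + z) \<odot> W (y + z) = (f y \<odot> W y) \<otimes> (h z \<odot> W z)" by simp
    qed (use W y in \<open>auto simp: scale_closed\<close>)
    also have "\<dots> = (f y \<odot> W y) \<otimes> (\<Oplus>z\<in>T. h z \<odot> W z)"
      using T W y by (intro finsum_rdistr[symmetric]) (auto simp: scale_closed)
    finally show ?thesis .
  qed
  have "lincomb A W (tconv \<sigma> f h) = (\<Oplus>x\<in>U. tconv \<sigma> f h x \<odot> W x)"
    using U W finsupp_tconv(1)[OF G_add f h, of \<sigma>]
    by (intro lincomb_superset) (auto simp: U_def S_def T_def)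
  also have "\<dots> = (\<Oplus>x\<in>U. \<Oplus>y\<in>S. t y x \<odot> W x)"
    using S W unfolding tconv_def S_def[symmetric] t_def
    by (intro finsum_cong') (auto simp: scale_sum scale_closed intro!: finsum_closed)
  also have "\<dots> = (\<Oplus>y\<in>S. \<Oplus>x\<in>U. t y x \<odot> W x)"
    using S U W by (intro finsum_swap) (auto simp: scale_closed)
  also have "\<dots> = (\<Oplus>y\<in>S. (f y \<odot> W y) \<otimes> (\<Oplus>z\<in>T. h z \<odot> W z))"
    using W inner by (intro finsum_cong') (auto simp: scale_closed intro!: finsum_closed)
  also have "\<dots> = (\<Oplus>y\<in>S. f y \<odot> W y) \<otimes> (\<Oplus>z\<in>T. h z \<odot> W z)"
    using S W by (intro finsum_ldistr[symmetric]) (auto simp: scale_closed intro!: finsum_closed)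
  finally show ?thesis by (simp add: lincomb_def S_def T_def)
qed

lemma lincomb_tstar:
  assumes f: "f \<in> finsupp G"
  shows "lincomb A W (tstar \<sigma> f) = adj A (lincomb A W f)"
proof -
  define S where "S = {g. f g \<noteq> 0}"
  have S: "finite S" "S \<subseteq> G" using f unfolding S_def finsupp_def by auto
  have W: "\<And>g. g \<in> S \<Longrightarrow> W g \<in> carrier A" "\<And>g. g \<in> S \<Longrightarrow> W (- g) \<in> carrier A"
    using S W_closed G_uminus by blast+
  have "lincomb A W (tstar \<sigma> f) = (\<Oplus>x\<in>uminus ` S. tstar \<sigma> f x \<odot> W x)"
    using S W finsupp_tstar(1)[OF G_uminus f, of \<sigma>]
    by (intro lincomb_superset) (auto simp: S_def)
  also have "\<dots> = (\<Oplus>g\<in>S. tstar \<sigma> f (- g) \<odot> W (- g))"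
    using W by (intro finsum_reindex) (auto simp: scale_closed)
  also have "\<dots> = (\<Oplus>g\<in>S. adj A (f g \<odot> W g))"
  proof (rule finsum_cong')
    fix g assume g: "g \<in> S"
    then have gG: "g \<in> G" using S by blast
    show "tstar \<sigma> f (- g) \<odot> W (- g) = adj A (f g \<odot> W g)"
      using W[OF g] by (simp add: adj_scale W_adj[OF gG] tstar_def scale_scale[symmetric])
  qed (use W in \<open>auto simp: scale_closed adj_closed\<close>)
  also have "\<dots> = adj A (\<Oplus>g\<in>S. f g \<odot> W g)"
    using S W by (intro adj_finsum[symmetric]) (auto simp: scale_closed)
  finally show ?thesis by (simp add: lincomb_def S_def)
qed

lemma norm_lincomb_seminorm: "cstar_seminorm G \<sigma> (\<lambda>f. cnorm A (lincomb A W f))"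
  unfolding cstar_seminorm_def
  using finsupp_tstar(2)[OF G_uminus]
  by (auto simp: lincomb_closed lincomb_add lincomb_scale lincomb_tconv lincomb_tstar
    norm_nonneg norm_scale norm_add norm_mult cstar_identity)

end

definition norm_lim :: "'a cstar_alg \<Rightarrow> (nat \<Rightarrow> 'a) \<Rightarrow> 'a \<Rightarrow> bool" where
  "norm_lim A X x \<longleftrightarrow> (\<forall>n. X n \<in> carrier A) \<and> x \<in> carrier A \<and> (\<lambda>n. cnorm A (X n \<ominus>\<^bsub>A\<^esub> x)) \<longlonglongrightarrow> 0"

context cstar_algebra
begin

lemma norm_limD: "norm_lim A X x \<Longrightarrow> X n \<in> carrier A" "norm_lim A X x \<Longrightarrow> x \<in> carrier A"
    "norm_lim A X x \<Longrightarrow> (\<lambda>n. cnorm A (X n \<ominus> x)) \<longlonglongrightarrow> 0"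
  unfolding norm_lim_def by auto

lemma norm_limI:
  assumes "\<And>n. X n \<in> carrier A" "x \<in> carrier A"
    and "\<And>n. cnorm A (X n \<ominus> x) \<le> b n" "b \<longlonglongrightarrow> 0"
  shows "norm_lim A X x"
  unfolding norm_lim_def
proof (intro conjI allI assms(1,2))
  show "(\<lambda>n. cnorm A (X n \<ominus> x)) \<longlonglongrightarrow> 0"
    by (rule tendsto_sandwich[OF _ _ tendsto_const assms(4)])
      (use assms in \<open>auto intro!: always_eventually norm_nonneg\<close>)
qed

lemma norm_lim_const: "x \<in> carrier A \<Longrightarrow> norm_lim A (\<lambda>n. x) x"
  by (rule norm_limI[where b = "\<lambda>n. 0"]) (use norm_eq_0[of \<zero>] in \<open>auto simp: a_minus_def r_neg\<close>)

lemma norm_lim_add: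
  assumes "norm_lim A X x" "norm_lim A Y y"
  shows "norm_lim A (\<lambda>n. X n \<oplus> Y n) (x \<oplus> y)"
proof (rule norm_limI)
  note c = norm_limD(1,2)[OF assms(1)] norm_limD(1,2)[OF assms(2)]
  show "X n \<oplus> Y n \<in> carrier A" "x \<oplus> y \<in> carrier A" for n using c by auto
  show "cnorm A (X n \<oplus> Y n \<ominus> (x \<oplus> y)) \<le> cnorm A (X n \<ominus> x) + cnorm A (Y n \<ominus> y)" for n
  proof -
    have "X n \<oplus> Y n \<ominus> (x \<oplus> y) = (X n \<ominus> x) \<oplus> (Y n \<ominus> y)"
      using c by (simp add: a_minus_def minus_add a_ac)
    then show ?thesis using c norm_add[of "X n \<ominus> x" "Y n \<ominus> y"] by simp
  qed
  show "(\<lambda>n. cnorm A (X n \<ominus> x) + cnorm A (Y n \<ominus> y)) \<longlonglongrightarrow> 0"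
    using tendsto_add[OF norm_limD(3)[OF assms(1)] norm_limD(3)[OF assms(2)]] by simp
qed

lemma norm_lim_scale:
  assumes "norm_lim A X x"
  shows "norm_lim A (\<lambda>n. c \<odot> X n) (c \<odot> x)"
proof (rule norm_limI)
  note c = norm_limD(1,2)[OF assms]
  show "c \<odot> X n \<in> carrier A" "c \<odot> x \<in> carrier A" for n using c by (auto simp: scale_closed)
  show "cnorm A (c \<odot> X n \<ominus> c \<odot> x) \<le> cmod c * cnorm A (X n \<ominus> x)" for n
  proof -
    have "\<ominus> (c \<odot> x) = c \<odot> (\<ominus> x)"
      using c by (simp add: scale_minus_one[symmetric] scale_closed scale_scale[symmetric] mult.commute)
    then have "c \<odot> X n \<ominus> c \<odot> x = c \<odot> (X n \<ominus> x)"
      using c by (simp add: a_minus_def scale_add_right)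
    then show ?thesis using c norm_scale[of "X n \<ominus> x" c] by simp
  qed
  show "(\<lambda>n. cmod c * cnorm A (X n \<ominus> x)) \<longlonglongrightarrow> 0"
    using tendsto_mult[OF tendsto_const norm_limD(3)[OF assms]] by simp
qed

lemma norm_lim_adj:
  assumes "norm_lim A X x"
  shows "norm_lim A (\<lambda>n. adj A (X n)) (adj A x)"
proof (rule norm_limI)
  note c = norm_limD(1,2)[OF assms]
  show "adj A (X n) \<in> carrier A" "adj A x \<in> carrier A" for n using c by (auto simp: adj_closed)
  show "cnorm A (adj A (X n) \<ominus> adj A x) \<le> cnorm A (X n \<ominus> x)" for n
  proof -
    have "\<ominus> (adj A x) = adj A (\<ominus> x)"
      using c adj_scale[of x "- 1"] by (simp add: scale_minus_one adj_closed)
    then have "adj A (X n) \<ominus> adj A x = adj A (X n \<ominus> x)"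
      using c by (simp add: a_minus_def adj_add)
    then show ?thesis using c norm_adj[of "X n \<ominus> x"] by simp
  qed
  show "(\<lambda>n. cnorm A (X n \<ominus> x)) \<longlonglongrightarrow> 0" by (rule norm_limD(3)[OF assms])
qed

lemma norm_lim_mult:
  assumes "norm_lim A X x" "norm_lim A Y y"
  shows "norm_lim A (\<lambda>n. X n \<otimes> Y n) (x \<otimes> y)"
proof (rule norm_limI)
  note c = norm_limD(1,2)[OF assms(1)] norm_limD(1,2)[OF assms(2)]
  show "X n \<otimes> Y n \<in> carrier A" "x \<otimes> y \<in> carrier A" for n using c by auto
  show "cnorm A (X n \<otimes> Y n \<ominus> x \<otimes> y)
      \<le> cnorm A (X n \<ominus> x) * (cnorm A (Y n \<ominus> y) + cnorm A y) + cnorm A x * cnorm A (Y n \<ominus> y)" for n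
  proof -
    have e: "(X n \<ominus> x) \<otimes> Y n = X n \<otimes> Y n \<ominus> x \<otimes> Y n" "x \<otimes> (Y n \<ominus> y) = x \<otimes> Y n \<ominus> x \<otimes> y"
      using c by (simp_all add: a_minus_def l_distr r_distr l_minus r_minus)
    have "cnorm A (X n \<otimes> Y n \<ominus> x \<otimes> y) \<le> cnorm A ((X n \<ominus> x) \<otimes> Y n) + cnorm A (x \<otimes> (Y n \<ominus> y))"
      unfolding e using c by (intro norm_triangle_sub) auto
    also have "\<dots> \<le> cnorm A (X n \<ominus> x) * cnorm A (Y n) + cnorm A x * cnorm A (Y n \<ominus> y)"
      using c by (intro add_mono norm_mult) auto
    also have "\<dots> \<le> cnorm A (X n \<ominus> x) * (cnorm A (Y n \<ominus> y) + cnorm A y) + cnorm A x * cnorm A (Y n \<ominus> y)"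
      using c by (intro add_mono mult_left_mono norm_triangle_abs norm_nonneg) auto
    finally show ?thesis .
  qed
  show "(\<lambda>n. cnorm A (X n \<ominus> x) * (cnorm A (Y n \<ominus> y) + cnorm A y) + cnorm A x * cnorm A (Y n \<ominus> y)) \<longlonglongrightarrow> 0"
    by (rule tendsto_eq_intros norm_limD(3)[OF assms(1)] norm_limD(3)[OF assms(2)] refl | simp)+
qed

lemma norm_lim_norm:
  assumes "norm_lim A X x"
  shows "(\<lambda>n. cnorm A (X n)) \<longlonglongrightarrow> cnorm A x"
proof -
  note c = norm_limD(1,2)[OF assms]
  have "\<bar>cnorm A (X n) - cnorm A x\<bar> \<le> cnorm A (X n \<ominus> x)" for n
    using norm_triangle_abs[of "X n" x] norm_triangle_abs[of x "X n"] norm_minus_commute[of x "X n"] c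
    by auto
  then have "(\<lambda>n. cnorm A (X n) - cnorm A x) \<longlonglongrightarrow> 0"
    by (intro tendsto_0_le[OF norm_limD(3)[OF assms], where K = 1] always_eventually)
      (auto intro: order_trans[OF _ abs_ge_self])
  then show ?thesis by (rule LIM_zero_cancel)
qed

end

lemma twisted_group_cstar_universal:
  fixes A :: "'a cstar_alg" and B :: "'b cstar_alg"
  assumes A: "twisted_group_cstar G \<sigma> A W" and B: "unitary_representation B G \<sigma> V"
  shows "\<exists>h. star_hom A B h \<and> (\<forall>g\<in>G. h (W g) = V g) \<and> (\<forall>x\<in>carrier A. cnorm B (h x) \<le> cnorm A x)"
proof -
  interpret B: unitary_representation B G \<sigma> V by (fact B)
  interpret A: unitary_representation A G \<sigma> W
    using A B.G_zero B.G_add B.G_uminus B.\<sigma>_zero B.\<sigma>_unit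
    unfolding twisted_group_cstar_def unitary_representation_def unitary_representation_axioms_def
    by blast
  let ?a = "lincomb A W" and ?b = "lincomb B V"
  have le: "cnorm B (?b f) \<le> cnorm A (?a f)" if "f \<in> finsupp G" for f
    using A B.norm_lincomb_seminorm that unfolding twisted_group_cstar_def by blast
  have dense: "\<exists>f\<in>finsupp G. cnorm A (x \<ominus>\<^bsub>A\<^esub> ?a f) < \<epsilon>" if "x \<in> carrier A" "\<epsilon> > 0" for x \<epsilon>
    using A that unfolding twisted_group_cstar_def by blast
  have fs: "(\<lambda>g. f g + k g) \<in> finsupp G" "(\<lambda>g. c * f g) \<in> finsupp G" "tconv \<sigma> f k \<in> finsupp G"
      "tstar \<sigma> f \<in> finsupp G" if "f \<in> finsupp G" "k \<in> finsupp G" for f k c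
  proof -
    show "(\<lambda>g. f g + k g) \<in> finsupp G"
      by (rule finsupp_subsetI[of _ "{g. f g \<noteq> 0} \<union> {g. k g \<noteq> 0}"])
        (use that in \<open>auto simp: finsupp_def\<close>)
    show "(\<lambda>g. c * f g) \<in> finsupp G"
      by (rule finsupp_subsetI[of _ "{g. f g \<noteq> 0}"]) (use that in \<open>auto simp: finsupp_def\<close>)
    show "tconv \<sigma> f k \<in> finsupp G" using finsupp_tconv(2)[OF B.G_add that] by blast
    show "tstar \<sigma> f \<in> finsupp G" using finsupp_tstar(2)[OF B.G_uminus that(1)] by blast
  qed
  have diffA: "?a f \<ominus>\<^bsub>A\<^esub> ?a k = ?a (\<lambda>g. f g + (- 1) * k g)"
    and diffB: "?b f \<ominus>\<^bsub>B\<^esub> ?b k = ?b (\<lambda>g. f g + (- 1) * k g)"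
    if "f \<in> finsupp G" "k \<in> finsupp G" for f k
    using that fs(2)[OF that(2) that(2)]
    by (simp_all only: a_minus_def A.lincomb_add B.lincomb_add A.lincomb_scale B.lincomb_scale
      A.lincomb_closed B.lincomb_closed A.scale_minus_one B.scale_minus_one)

  define rel where "rel = (\<lambda>x y. \<exists>F. (\<forall>n. F n \<in> finsupp G) \<and>
    norm_lim A (\<lambda>n. ?a (F n)) x \<and> norm_lim B (\<lambda>n. ?b (F n)) y)"
  have rel_closed: "x \<in> carrier A" "y \<in> carrier B" if "rel x y" for x y
    using that unfolding rel_def norm_lim_def by auto
  have rel_norm: "cnorm B y \<le> cnorm A x" if "rel x y" for x y
  proof -
    obtain F where F: "\<And>n. F n \<in> finsupp G" "norm_lim A (\<lambda>n. ?a (F n)) x" "norm_lim B (\<lambda>n. ?b (F n)) y"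
      using \<open>rel x y\<close> unfolding rel_def by blast
    show ?thesis
      by (rule LIMSEQ_le[OF B.norm_lim_norm[OF F(3)] A.norm_lim_norm[OF F(2)]]) (use le F(1) in auto)
  qed
  have rel_add: "rel (x \<oplus>\<^bsub>A\<^esub> x') (y \<oplus>\<^bsub>B\<^esub> y')" and rel_mult: "rel (x \<otimes>\<^bsub>A\<^esub> x') (y \<otimes>\<^bsub>B\<^esub> y')"
    if r: "rel x y" "rel x' y'" for x x' y y'
  proof -
    obtain F where F: "\<And>n. F n \<in> finsupp G" "norm_lim A (\<lambda>n. ?a (F n)) x" "norm_lim B (\<lambda>n. ?b (F n)) y"
      using r(1) unfolding rel_def by blast
    obtain K where K: "\<And>n. K n \<in> finsupp G" "norm_lim A (\<lambda>n. ?a (K n)) x'" "norm_lim B (\<lambda>n. ?b (K n)) y'"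
      using r(2) unfolding rel_def by blast
    show "rel (x \<oplus>\<^bsub>A\<^esub> x') (y \<oplus>\<^bsub>B\<^esub> y')"
      unfolding rel_def
      using A.norm_lim_add[OF F(2) K(2)] B.norm_lim_add[OF F(3) K(3)] fs(1)[OF F(1) K(1)]
      by (intro exI[of _ "\<lambda>n g. F n g + K n g"])
        (simp add: A.lincomb_add[OF F(1) K(1)] B.lincomb_add[OF F(1) K(1)])
    show "rel (x \<otimes>\<^bsub>A\<^esub> x') (y \<otimes>\<^bsub>B\<^esub> y')"
      unfolding rel_def
      using A.norm_lim_mult[OF F(2) K(2)] B.norm_lim_mult[OF F(3) K(3)] fs(3)[OF F(1) K(1)]
      by (intro exI[of _ "\<lambda>n. tconv \<sigma> (F n) (K n)"])
        (simp add: A.lincomb_tconv[OF F(1) K(1)] B.lincomb_tconv[OF F(1) K(1)])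
  qed
  have rel_scale: "rel (c \<odot>\<^bsub>A\<^esub> x) (c \<odot>\<^bsub>B\<^esub> y)" and rel_adj: "rel (adj A x) (adj B y)"
    if r: "rel x y" for x y c
  proof -
    obtain F where F: "\<And>n. F n \<in> finsupp G" "norm_lim A (\<lambda>n. ?a (F n)) x" "norm_lim B (\<lambda>n. ?b (F n)) y"
      using r unfolding rel_def by blast
    show "rel (c \<odot>\<^bsub>A\<^esub> x) (c \<odot>\<^bsub>B\<^esub> y)"
      unfolding rel_def
      using A.norm_lim_scale[OF F(2)] B.norm_lim_scale[OF F(3)] fs(2)[OF F(1) F(1)]
      by (intro exI[of _ "\<lambda>n g. c * F n g"])
        (simp add: A.lincomb_scale[OF F(1)] B.lincomb_scale[OF F(1)])
    show "rel (adj A x) (adj B y)"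
      unfolding rel_def
      using A.norm_lim_adj[OF F(2)] B.norm_lim_adj[OF F(3)] fs(4)[OF F(1) F(1)]
      by (intro exI[of _ "\<lambda>n. tstar \<sigma> (F n)"])
        (simp add: A.lincomb_tstar[OF F(1)] B.lincomb_tstar[OF F(1)])
  qed
  have rel_W: "rel (W g) (V g)" if g: "g \<in> G" for g
  proof -
    define f where "f = (\<lambda>k. if k = g then 1 else 0 :: complex)"
    have supp: "{k. f k \<noteq> 0} = {g}" unfolding f_def by auto
    have f: "f \<in> finsupp G" by (rule finsupp_subsetI[of f "{g}"]) (use g in \<open>simp_all add: supp\<close>)
    have "?a f = W g" "?b f = V g"
      unfolding lincomb_def supp using A.W_closed[OF g] B.W_closed[OF g]
      by (simp_all add: f_def A.scale_one B.scale_one)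
    then show ?thesis unfolding rel_def
      using f A.norm_lim_const[OF A.W_closed[OF g]] B.norm_lim_const[OF B.W_closed[OF g]]
      by (intro exI[of _ "\<lambda>n. f"]) simp
  qed
  have rel_unique: "y = y'" if r: "rel x y" "rel x y'" for x y y'
  proof -
    have c: "x \<in> carrier A" "y \<in> carrier B" "y' \<in> carrier B" using rel_closed r by auto
    have "rel (x \<oplus>\<^bsub>A\<^esub> (- 1) \<odot>\<^bsub>A\<^esub> x) (y \<oplus>\<^bsub>B\<^esub> (- 1) \<odot>\<^bsub>B\<^esub> y')"
      by (intro rel_add rel_scale r)
    then have "rel \<zero>\<^bsub>A\<^esub> (y \<ominus>\<^bsub>B\<^esub> y')"
      using c by (simp add: A.scale_minus_one B.scale_minus_one A.r_neg a_minus_def)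
    then have "cnorm B (y \<ominus>\<^bsub>B\<^esub> y') \<le> 0" using rel_norm A.norm_eq_0 by fastforce
    then have "y \<ominus>\<^bsub>B\<^esub> y' = \<zero>\<^bsub>B\<^esub>"
      using B.norm_nonneg[of "y \<ominus>\<^bsub>B\<^esub> y'"] B.norm_eq_0[of "y \<ominus>\<^bsub>B\<^esub> y'"] c by auto
    then have "y \<oplus>\<^bsub>B\<^esub> \<ominus>\<^bsub>B\<^esub> y' = \<zero>\<^bsub>B\<^esub>" by (simp add: a_minus_def)
    then show ?thesis using c by (metis B.a_inv_closed B.minus_equality B.minus_minus)
  qed
  have rel_ex: "\<exists>y. rel x y" if x: "x \<in> carrier A" for x
  proof -
    have "\<exists>f. f \<in> finsupp G \<and> cnorm A (x \<ominus>\<^bsub>A\<^esub> ?a f) < inverse (real (Suc n))" for n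
      using dense[OF x] by (meson inverse_positive_iff_positive of_nat_0_less_iff zero_less_Suc)
    then obtain F where F: "\<And>n. F n \<in> finsupp G" "\<And>n. cnorm A (x \<ominus>\<^bsub>A\<^esub> ?a (F n)) < inverse (real (Suc n))"
      by metis
    note cA = A.lincomb_closed[OF F(1)] and cB = B.lincomb_closed[OF F(1)]
    have lim: "norm_lim A (\<lambda>n. ?a (F n)) x"
    proof (rule A.norm_limI[OF cA x])
      show "cnorm A (?a (F n) \<ominus>\<^bsub>A\<^esub> x) \<le> inverse (real (Suc n))" for n
        using F(2)[of n] A.norm_minus_commute[OF cA x] by (simp add: less_imp_le)
      show "(\<lambda>n. inverse (real (Suc n))) \<longlonglongrightarrow> 0" by (rule LIMSEQ_inverse_real_of_nat)
    qed
    have "\<forall>\<epsilon>>0. \<exists>K. \<forall>m\<ge>K. \<forall>n\<ge>K. cnorm B (?b (F m) \<ominus>\<^bsub>B\<^esub> ?b (F n)) < \<epsilon>"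
    proof (intro allI impI)
      fix \<epsilon> :: real assume "\<epsilon> > 0"
      then have "\<forall>\<^sub>F n in sequentially. cnorm A (?a (F n) \<ominus>\<^bsub>A\<^esub> x) < \<epsilon> / 2"
        using A.norm_limD(3)[OF lim] by (intro order_tendstoD) auto
      then obtain K where K: "\<And>n. n \<ge> K \<Longrightarrow> cnorm A (?a (F n) \<ominus>\<^bsub>A\<^esub> x) < \<epsilon> / 2"
        unfolding eventually_sequentially by blast
      have "cnorm B (?b (F m) \<ominus>\<^bsub>B\<^esub> ?b (F n)) < \<epsilon>" if mn: "m \<ge> K" "n \<ge> K" for m n
      proof -
        have "cnorm B (?b (F m) \<ominus>\<^bsub>B\<^esub> ?b (F n)) \<le> cnorm A (?a (F m) \<ominus>\<^bsub>A\<^esub> ?a (F n))"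
          unfolding diffA[OF F(1) F(1)] diffB[OF F(1) F(1)] by (intro le fs(1) fs(2)[OF F(1) F(1)] F(1))
        also have "\<dots> \<le> cnorm A (?a (F m) \<ominus>\<^bsub>A\<^esub> x) + cnorm A (x \<ominus>\<^bsub>A\<^esub> ?a (F n))"
          by (rule A.norm_triangle_sub[OF cA x cA])
        also have "\<dots> < \<epsilon>" using K[OF mn(1)] K[OF mn(2)] A.norm_minus_commute[OF cA x, of n] by simp
        finally show ?thesis .
      qed
      then show "\<exists>K. \<forall>m\<ge>K. \<forall>n\<ge>K. cnorm B (?b (F m) \<ominus>\<^bsub>B\<^esub> ?b (F n)) < \<epsilon>" by blast
    qed
    then obtain y where "y \<in> carrier B" "(\<lambda>n. cnorm B (?b (F n) \<ominus>\<^bsub>B\<^esub> y)) \<longlonglongrightarrow> 0"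
      using B.complete[of "\<lambda>n. ?b (F n)", OF cB] by blast
    then have "rel x y" unfolding rel_def using F(1) lim cB by (auto simp: norm_lim_def)
    then show ?thesis by blast
  qed

  define h where "h = (\<lambda>x. THE y. rel x y)"
  have h: "h x = y" if "rel x y" for x y
    unfolding h_def by (rule the_equality) (use that rel_unique in blast)+
  have rel_h: "rel x (h x)" if "x \<in> carrier A" for x using rel_ex[OF that] h by auto
  have "h \<in> ring_hom A B"
  proof (rule ring_hom_memI)
    show "h x \<in> carrier B" if "x \<in> carrier A" for x using rel_closed(2)[OF rel_h[OF that]] .
    show "h (x \<otimes>\<^bsub>A\<^esub> y) = h x \<otimes>\<^bsub>B\<^esub> h y" "h (x \<oplus>\<^bsub>A\<^esub> y) = h x \<oplus>\<^bsub>B\<^esub> h y"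
      if "x \<in> carrier A" "y \<in> carrier A" for x y
      using h[OF rel_mult] h[OF rel_add] rel_h that by auto
    show "h \<one>\<^bsub>A\<^esub> = \<one>\<^bsub>B\<^esub>" using h rel_W[OF B.G_zero] A.W_zero B.W_zero by simp
  qed
  then have "star_hom A B h"
    unfolding star_hom_def using rel_h rel_scale rel_adj h by auto
  then show ?thesis using rel_W h rel_h rel_norm by auto
qed


section \<open>Finitely generated projective left modules\<close>

text \<open>For modules (and for the free module and direct sum constructions) the fields \<open>mult\<close> and
  \<open>one\<close> of the record type \<open>module\<close> are meaningless.  The library locale \<open>module\<close> only covers
  commutative base rings.\<close>

locale left_module = R?: ring R + M?: abelian_group M
    for R :: "('r, 'c) ring_scheme" (structure) and M :: "('r, 'm) module" (structure) +
  assumes smult_closed: "\<lbrakk>a \<in> carrier R; x \<in> carrier M\<rbrakk> \<Longrightarrow> a \<odot>\<^bsub>M\<^esub> x \<in> carrier M"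
    and smult_l_distr: "\<lbrakk>a \<in> carrier R; b \<in> carrier R; x \<in> carrier M\<rbrakk>
      \<Longrightarrow> (a \<oplus>\<^bsub>R\<^esub> b) \<odot>\<^bsub>M\<^esub> x = a \<odot>\<^bsub>M\<^esub> x \<oplus>\<^bsub>M\<^esub> b \<odot>\<^bsub>M\<^esub> x"
    and smult_r_distr: "\<lbrakk>a \<in> carrier R; x \<in> carrier M; y \<in> carrier M\<rbrakk>
      \<Longrightarrow> a \<odot>\<^bsub>M\<^esub> (x \<oplus>\<^bsub>M\<^esub> y) = a \<odot>\<^bsub>M\<^esub> x \<oplus>\<^bsub>M\<^esub> a \<odot>\<^bsub>M\<^esub> y"
    and smult_assoc: "\<lbrakk>a \<in> carrier R; b \<in> carrier R; x \<in> carrier M\<rbrakk>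
      \<Longrightarrow> (a \<otimes>\<^bsub>R\<^esub> b) \<odot>\<^bsub>M\<^esub> x = a \<odot>\<^bsub>M\<^esub> (b \<odot>\<^bsub>M\<^esub> x)"
    and smult_one: "x \<in> carrier M \<Longrightarrow> \<one>\<^bsub>R\<^esub> \<odot>\<^bsub>M\<^esub> x = x"

definition lmod_hom :: "('r, 'c) ring_scheme \<Rightarrow> ('r, 'm) module \<Rightarrow> ('r, 'n) module \<Rightarrow> ('m \<Rightarrow> 'n) set" where
  "lmod_hom R M N = {h \<in> carrier M \<rightarrow> carrier N.
     (\<forall>x\<in>carrier M. \<forall>y\<in>carrier M. h (x \<oplus>\<^bsub>M\<^esub> y) = h x \<oplus>\<^bsub>N\<^esub> h y) \<and>
     (\<forall>a\<in>carrier R. \<forall>x\<in>carrier M. h (a \<odot>\<^bsub>M\<^esub> x) = a \<odot>\<^bsub>N\<^esub> h x)}"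

definition lmod_iso :: "('r, 'c) ring_scheme \<Rightarrow> ('r, 'm) module \<Rightarrow> ('r, 'n) module \<Rightarrow> bool" where
  "lmod_iso R M N \<longleftrightarrow> (\<exists>h\<in>lmod_hom R M N. bij_betw h (carrier M) (carrier N))"

definition lmod_sum :: "('r, 'm) module \<Rightarrow> ('r, 'n) module \<Rightarrow> ('r, 'm \<times> 'n) module" where
  "lmod_sum M N = \<lparr>carrier = carrier M \<times> carrier N, monoid.mult = undefined, one = undefined,
     zero = (\<zero>\<^bsub>M\<^esub>, \<zero>\<^bsub>N\<^esub>), add = (\<lambda>(x, y) (x', y'). (x \<oplus>\<^bsub>M\<^esub> x', y \<oplus>\<^bsub>N\<^esub> y')),
     smult = (\<lambda>a (x, y). (a \<odot>\<^bsub>M\<^esub> x, a \<odot>\<^bsub>N\<^esub> y))\<rparr>"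

text \<open>\<open>R\<close>-rows of length \<open>n\<close>, extended by zero.\<close>

definition free_lmod :: "('r, 'c) ring_scheme \<Rightarrow> nat \<Rightarrow> ('r, nat \<Rightarrow> 'r) module" where
  "free_lmod R n = \<lparr>carrier = {x. \<forall>i. if i < n then x i \<in> carrier R else x i = \<zero>\<^bsub>R\<^esub>},
     monoid.mult = undefined, one = undefined, zero = (\<lambda>i. \<zero>\<^bsub>R\<^esub>),
     add = (\<lambda>x y i. x i \<oplus>\<^bsub>R\<^esub> y i), smult = (\<lambda>a x i. a \<otimes>\<^bsub>R\<^esub> x i)\<rparr>"

text \<open>\<open>M\<close> is a direct summand of a free module of rank \<open>n\<close>, with inclusion \<open>i\<close> and projection \<open>r\<close>.\<close>

definition summand_maps :: "('r, 'c) ring_scheme \<Rightarrow> ('r, 'm) module \<Rightarrow> nat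
    \<Rightarrow> ('m \<Rightarrow> nat \<Rightarrow> 'r) \<Rightarrow> ((nat \<Rightarrow> 'r) \<Rightarrow> 'm) \<Rightarrow> bool" where
  "summand_maps R M n i r \<longleftrightarrow> i \<in> lmod_hom R M (free_lmod R n) \<and> r \<in> lmod_hom R (free_lmod R n) M \<and>
     (\<forall>x\<in>carrier M. r (i x) = x)"

definition fg_projective :: "('r, 'c) ring_scheme \<Rightarrow> ('r, 'm) module \<Rightarrow> bool" where
  "fg_projective R M \<longleftrightarrow> left_module R M \<and> (\<exists>n i r. summand_maps R M n i r)"


section \<open>\<open>K\<^sub>0\<close> and the trace on it\<close>

text \<open>\<open>K\<^sub>0\<close> is the Grothendieck group of the monoid of isomorphism classes of finitely generated
  projective left modules.  Its elements are classes of formal differences \<open>P - Q\<close> of such modules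
  with elements in the type of rows, where \<open>P - Q\<close> and \<open>P' - Q'\<close> agree iff \<open>P + Q' + T\<close> and
  \<open>P' + Q + T\<close> are isomorphic for some \<open>T\<close>.  Every finitely generated projective module is isomorphic
  to a module of rows, so this restriction only serves to obtain a set; \<open>K0_diff R P Q\<close> makes sense for
  modules over arbitrary types.\<close>

definition K0_diff :: "('r, 'c) ring_scheme \<Rightarrow> ('r, 'm) module \<Rightarrow> ('r, 'n) module
    \<Rightarrow> (('r, nat \<Rightarrow> 'r) module \<times> ('r, nat \<Rightarrow> 'r) module) set" where
  "K0_diff R P Q = {(P', Q'). fg_projective R P' \<and> fg_projective R Q' \<and>
     (\<exists>T :: ('r, nat \<Rightarrow> 'r) module. fg_projective R T \<and>
        lmod_iso R (lmod_sum (lmod_sum P' Q) T) (lmod_sum (lmod_sum P Q') T))}"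

definition K0_class :: "('r, 'c) ring_scheme \<Rightarrow> ('r, 'm) module
    \<Rightarrow> (('r, nat \<Rightarrow> 'r) module \<times> ('r, nat \<Rightarrow> 'r) module) set" where
  "K0_class R P = K0_diff R P (free_lmod R 0)"

definition K0 :: "('r, 'c) ring_scheme
    \<Rightarrow> (('r, nat \<Rightarrow> 'r) module \<times> ('r, nat \<Rightarrow> 'r) module) set monoid" where
  "K0 R = \<lparr>carrier = {K0_diff R P Q | (P :: ('r, nat \<Rightarrow> 'r) module) (Q :: ('r, nat \<Rightarrow> 'r) module).
       fg_projective R P \<and> fg_projective R Q},
     monoid.mult = (\<lambda>X Y. \<Union>(P, Q)\<in>X. \<Union>(P', Q')\<in>Y. K0_diff R (lmod_sum P P') (lmod_sum Q Q')),
     one = K0_diff R (free_lmod R 0) (free_lmod R 0)\<rparr>"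

definition unit_row :: "('r, 'c) ring_scheme \<Rightarrow> nat \<Rightarrow> nat \<Rightarrow> 'r" where
  "unit_row R j = (\<lambda>k. if k = j then \<one>\<^bsub>R\<^esub> else \<zero>\<^bsub>R\<^esub>)"

text \<open>Value of \<open>(Tr \<otimes> \<phi>)\<close> on the idempotent matrix \<open>e\<close> of \<open>i \<circ> r\<close>, whose \<open>(j,k)\<close> entry is
  \<open>i (r (unit_row R j)) k\<close> (so \<open>M\<close> is isomorphic to the module of rows \<open>x e\<close>).  For a tracial state this
  does not depend on the presentation of \<open>M\<close> and is a real number, an idempotent matrix over
  a C*-algebra being similar to a projection.\<close>

definition module_trace :: "'a cstar_alg \<Rightarrow> ('a \<Rightarrow> complex) \<Rightarrow> ('a, 'm) module \<Rightarrow> real" where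
  "module_trace A \<phi> M = (THE t. \<forall>n i r. summand_maps A M n i r \<longrightarrow>
     t = Re (\<Sum>j<n. \<phi> (i (r (unit_row A j)) j)))"

definition K0_induced :: "'a cstar_alg \<Rightarrow> ('a \<Rightarrow> complex)
    \<Rightarrow> (('a, nat \<Rightarrow> 'a) module \<times> ('a, nat \<Rightarrow> 'a) module) set \<Rightarrow> real" where
  "K0_induced A \<phi> X = (THE t. \<forall>(P, Q)\<in>X. t = module_trace A \<phi> P - module_trace A \<phi> Q)"

text \<open>The common value of all homomorphisms induced by tracial states; unspecified if these disagree or
  if there is no tracial state.\<close>

definition K0_trace :: "'a cstar_alg
    \<Rightarrow> (('a, nat \<Rightarrow> 'a) module \<times> ('a, nat \<Rightarrow> 'a) module) set \<Rightarrow> real" where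
  "K0_trace A X = (THE t. \<forall>\<phi>. tracial_state A \<phi> \<longrightarrow> t = K0_induced A \<phi> X)"


section \<open>Noncommutative solenoids\<close>

definition Zinv :: "nat \<Rightarrow> rat set" where
  "Zinv p = {of_int z / of_nat p ^ k | z k. True}"

text \<open>The reduced form of \<open>r \<in> Zinv p\<close> is \<open>of_int (pnum p r) / of_nat p ^ pexp p r\<close>.\<close>

definition pexp :: "nat \<Rightarrow> rat \<Rightarrow> nat" where
  "pexp p r = (LEAST k. r * of_nat p ^ k \<in> \<int>)"

definition pnum :: "nat \<Rightarrow> rat \<Rightarrow> int" where
  "pnum p r = \<lfloor>r * of_nat p ^ pexp p r\<rfloor>"

definition Xi :: "nat \<Rightarrow> (nat \<Rightarrow> real) set" where
  "Xi p = {\<alpha>. \<alpha> 0 \<in> {0..<1} \<and> (\<forall>n. \<exists>k\<in>{0..<p}. real p * \<alpha> (Suc n) = \<alpha> n + real k)}"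

text \<open>Reduced fractions are chosen here; by \<open>Psi_fractions\<close> every choice gives the same value.\<close>

definition Psi :: "nat \<Rightarrow> (nat \<Rightarrow> real) \<Rightarrow> rat \<times> rat \<Rightarrow> rat \<times> rat \<Rightarrow> complex" where
  "Psi p \<alpha> g h = exp (2 * \<i> * of_real pi * of_real (\<alpha> (pexp p (fst g) + pexp p (snd h)))
     * of_int (pnum p (fst g)) * of_int (pnum p (snd h)))"

lemma Xi_power:
  assumes "\<alpha> \<in> Xi p"
  shows "\<exists>j::int. real p ^ c * \<alpha> (m + c) = \<alpha> m + of_int j"
proof (induction c)
  case 0
  show ?case by (auto intro: exI[of _ 0])
next
  case (Suc c)
  then obtain j :: int where j: "real p ^ c * \<alpha> (m + c) = \<alpha> m + of_int j" by blast
  obtain k where k: "real p * \<alpha> (Suc (m + c)) = \<alpha> (m + c) + real k"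
    using assms unfolding Xi_def by blast
  have "real p ^ Suc c * \<alpha> (m + Suc c) = real p ^ c * (real p * \<alpha> (Suc (m + c)))"
    by (simp add: algebra_simps)
  also have "\<dots> = \<alpha> m + of_int (j + int p ^ c * int k)"
    unfolding k using j by (simp add: algebra_simps)
  finally show ?case by blast
qed

lemma pexp_Ints:
  assumes "p > 0" "r \<in> Zinv p"
  shows "r * of_nat p ^ pexp p r \<in> \<int>"
proof -
  obtain z k where "r = of_int z / of_nat p ^ k"
    using assms(2) unfolding Zinv_def by blast
  then have "r * of_nat p ^ k \<in> \<int>" using assms(1) by simp
  then show ?thesis unfolding pexp_def by (rule LeastI)
qed

lemma reduced_form:
  assumes "p > 0" "r \<in> Zinv p"
  shows "r = of_int (pnum p r) / of_nat p ^ pexp p r"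
proof -
  have "of_int (pnum p r) = r * of_nat p ^ pexp p r"
    unfolding pnum_def using pexp_Ints[OF assms] by simp
  then show ?thesis using assms(1) by simp
qed

lemma fraction_reduced:
  assumes "p > 0" "r = of_int z / of_nat p ^ k"
  obtains c where "k = pexp p r + c" "z = pnum p r * int p ^ c"
proof -
  have Z: "r \<in> Zinv p" using assms(2) unfolding Zinv_def by blast
  have "r * of_nat p ^ k \<in> \<int>" using assms by simp
  then have "pexp p r \<le> k" unfolding pexp_def by (rule Least_le)
  then obtain c where c: "k = pexp p r + c" using le_Suc_ex by blast
  have "(of_int z :: rat) = r * of_nat p ^ k" using assms by simp
  also have "\<dots> = of_int (pnum p r) * of_nat p ^ c"
    using assms(1) by (subst reduced_form[OF assms(1) Z]) (simp add: c power_add)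
  finally have "(of_int z :: rat) = of_int (pnum p r * int p ^ c)" by simp
  then have "z = pnum p r * int p ^ c" unfolding of_int_eq_iff .
  then show thesis using c that by blast
qed

lemma Psi_fractions:
  assumes "p > 0" "\<alpha> \<in> Xi p"
  shows "Psi p \<alpha> (of_int q1 / of_nat p ^ k1, of_int q2 / of_nat p ^ k2)
                 (of_int q3 / of_nat p ^ k3, of_int q4 / of_nat p ^ k4)
       = exp (2 * \<i> * of_real pi * of_real (\<alpha> (k1 + k4)) * of_int q1 * of_int q4)"
proof -
  define r where "r = (of_int q1 / of_nat p ^ k1 :: rat)"
  define s where "s = (of_int q4 / of_nat p ^ k4 :: rat)"
  obtain a where a: "k1 = pexp p r + a" "q1 = pnum p r * int p ^ a"
    using fraction_reduced[OF assms(1) r_def] by blast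
  obtain b where b: "k4 = pexp p s + b" "q4 = pnum p s * int p ^ b"
    using fraction_reduced[OF assms(1) s_def] by blast
  define m where "m = pexp p r + pexp p s"
  obtain j :: int where j: "real p ^ (a + b) * \<alpha> (m + (a + b)) = \<alpha> m + of_int j"
    using Xi_power[OF assms(2)] by blast
  have m: "k1 + k4 = m + (a + b)" using a b m_def by simp
  have "\<alpha> (k1 + k4) * of_int q1 * of_int q4
      = (real p ^ (a + b) * \<alpha> (m + (a + b))) * of_int (pnum p r) * of_int (pnum p s)"
    unfolding m a(2) b(2) by (simp add: power_add algebra_simps)
  also have "\<dots> = \<alpha> m * of_int (pnum p r) * of_int (pnum p s) + of_int (j * pnum p r * pnum p s)"
    unfolding j by (simp add: algebra_simps)
  finally have *: "\<alpha> (k1 + k4) * of_int q1 * of_int q4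
      = \<alpha> m * of_int (pnum p r) * of_int (pnum p s) + of_int (j * pnum p r * pnum p s)" .
  have "2 * \<i> * of_real pi * of_real (\<alpha> (k1 + k4)) * of_int q1 * of_int q4
      = 2 * \<i> * of_real pi * of_real (\<alpha> (k1 + k4) * of_int q1 * of_int q4)"
    by (simp add: mult.assoc)
  also have "\<dots> = 2 * \<i> * of_real pi * of_real (\<alpha> m) * of_int (pnum p r) * of_int (pnum p s)
      + \<i> * of_real (of_int (2 * (j * pnum p r * pnum p s)) * pi)"
    unfolding * by (simp add: algebra_simps)
  finally have "exp (2 * \<i> * of_real pi * of_real (\<alpha> (k1 + k4)) * of_int q1 * of_int q4)
     = exp (2 * \<i> * of_real pi * of_real (\<alpha> m) * of_int (pnum p r) * of_int (pnum p s))
      * exp (\<i> * of_real (of_int (2 * (j * pnum p r * pnum p s)) * pi))"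
    by (simp only: exp_add)
  also have "exp (\<i> * of_real (of_int (2 * (j * pnum p r * pnum p s)) * pi)) = 1"
    using cis_multiple_2pi[of "of_int (j * pnum p r * pnum p s)"]
    by (simp only: cis_conv_exp[symmetric]) (simp add: algebra_simps)
  finally show ?thesis
    unfolding Psi_def by (simp add: m_def r_def s_def)
qed

definition solenoid_algebra :: "nat \<Rightarrow> (nat \<Rightarrow> real) \<Rightarrow> 'a cstar_alg \<Rightarrow> (rat \<times> rat \<Rightarrow> 'a) \<Rightarrow> bool" where
  "solenoid_algebra p \<alpha> A W \<longleftrightarrow> twisted_group_cstar (Zinv p \<times> Zinv p) (Psi p \<alpha>) A W"

lemma solenoid_algebra_universal:
  assumes p: "p > 0" and A: "solenoid_algebra p \<alpha> A W"
    and B: "cstar_algebra B" "unitary_family (Zinv p \<times> Zinv p) (Psi p \<alpha>) B V"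
  shows "\<exists>h. star_hom A B h \<and> (\<forall>g\<in>Zinv p \<times> Zinv p. h (W g) = V g) \<and>
    (\<forall>x\<in>carrier A. cnorm B (h x) \<le> cnorm A x)"
proof -
  have zero: "0 \<in> Zinv p" unfolding Zinv_def by (auto intro!: exI[of _ 0])
  have add: "r + s \<in> Zinv p" if r: "r \<in> Zinv p" and s: "s \<in> Zinv p" for r s
  proof -
    obtain z k w l where rs: "r = of_int z / of_nat p ^ k" "s = of_int w / of_nat p ^ l"
      using r s unfolding Zinv_def by blast
    have "r + s = of_int (z * int p ^ l + w * int p ^ k) / of_nat p ^ (k + l)"
      using p unfolding rs by (simp add: field_simps power_add)
    then show ?thesis unfolding Zinv_def by blast
  qed
  have minus: "- r \<in> Zinv p" if r: "r \<in> Zinv p" for r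
  proof -
    obtain z k where r: "r = of_int z / of_nat p ^ k" using r unfolding Zinv_def by blast
    have "- r = of_int (- z) / of_nat p ^ k" unfolding r by simp
    then show ?thesis unfolding Zinv_def by blast
  qed
  have "cmod (Psi p \<alpha> g h) = 1" for g h
  proof -
    have "Psi p \<alpha> g h = exp (\<i> * of_real (2 * pi * \<alpha> (pexp p (fst g) + pexp p (snd h))
        * of_int (pnum p (fst g)) * of_int (pnum p (snd h))))"
      unfolding Psi_def by (simp add: mult_ac)
    then show ?thesis by (simp only: cis_conv_exp[symmetric] norm_cis)
  qed
  moreover have "Psi p \<alpha> 0 0 = 1" by (simp add: Psi_def pnum_def)
  ultimately have "unitary_representation B (Zinv p \<times> Zinv p) (Psi p \<alpha>) V"
    using B zero add minus
    by (intro unitary_representation.intro unitary_representation_axioms.intro)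
      (auto simp: zero_prod_def)
  then show ?thesis
    using A twisted_group_cstar_universal unfolding solenoid_algebra_def by blast
qed

text \<open>For \<open>\<alpha> \<in> Xi p\<close> the arguments of the floor functions in \<open>J\<close>, and for \<open>r, s \<in> Zinv p\<close>
  those in \<open>xi\<close>, are integers; see \<open>J_eq\<close> and \<open>xi_eq\<close>.\<close>

definition J :: "nat \<Rightarrow> (nat \<Rightarrow> real) \<Rightarrow> nat \<Rightarrow> int" where
  "J p \<alpha> k = \<lfloor>real p ^ k * \<alpha> k - \<alpha> 0\<rfloor>"

definition xi_rat :: "nat \<Rightarrow> (nat \<Rightarrow> real) \<Rightarrow> rat \<Rightarrow> rat \<Rightarrow> rat" where
  "xi_rat p \<alpha> r s = (let k = pexp p r; l = pexp p s in
     if l > k then - r * of_int (J p \<alpha> l - J p \<alpha> k)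
     else if k > l then - s * of_int (J p \<alpha> k - J p \<alpha> l)
     else (r + s) * of_int (J p \<alpha> k - J p \<alpha> (pexp p (r + s))))"

definition xi :: "nat \<Rightarrow> (nat \<Rightarrow> real) \<Rightarrow> rat \<Rightarrow> rat \<Rightarrow> int" where
  "xi p \<alpha> r s = \<lfloor>xi_rat p \<alpha> r s\<rfloor>"

lemma J_eq:
  assumes "\<alpha> \<in> Xi p"
  shows "of_int (J p \<alpha> k) = real p ^ k * \<alpha> k - \<alpha> 0"
  using Xi_power[OF assms, of k 0] unfolding J_def by auto

lemma J_diff_dvd:
  assumes "\<alpha> \<in> Xi p" "k \<le> l"
  shows "\<exists>j. J p \<alpha> l - J p \<alpha> k = int p ^ k * j"
proof -
  obtain c where c: "l = k + c" using assms(2) le_Suc_ex by blast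
  obtain j :: int where j: "real p ^ c * \<alpha> (k + c) = \<alpha> k + of_int j"
    using Xi_power[OF assms(1)] by blast
  have "(of_int (J p \<alpha> l - J p \<alpha> k) :: real) = real p ^ k * (real p ^ c * \<alpha> (k + c)) - real p ^ k * \<alpha> k"
    by (simp add: J_eq[OF assms(1)] c power_add mult.assoc)
  also have "\<dots> = of_int (int p ^ k * j)" unfolding j by (simp add: algebra_simps)
  finally show ?thesis unfolding of_int_eq_iff by blast
qed

lemma xi_eq:
  assumes "p > 0" "\<alpha> \<in> Xi p" "r \<in> Zinv p" "s \<in> Zinv p"
  shows "of_int (xi p \<alpha> r s) = xi_rat p \<alpha> r s"
proof -
  have *: "t * of_int (J p \<alpha> l - J p \<alpha> (pexp p t)) \<in> \<int>" if t: "t \<in> Zinv p" "pexp p t \<le> l" for t l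
  proof -
    obtain j where "J p \<alpha> l - J p \<alpha> (pexp p t) = int p ^ pexp p t * j"
      using J_diff_dvd[OF assms(2) t(2)] by blast
    then have e: "t * of_int (J p \<alpha> l - J p \<alpha> (pexp p t)) = (t * of_nat p ^ pexp p t) * of_int j"
      by simp
    show ?thesis unfolding e by (intro Ints_mult pexp_Ints[OF assms(1) t(1)] Ints_of_int)
  qed
  have sum: "r + s \<in> Zinv p" "pexp p (r + s) \<le> pexp p r" if eq: "pexp p r = pexp p s"
  proof -
    have e: "r + s = of_int (pnum p r + pnum p s) / of_nat p ^ pexp p r"
      using reduced_form[OF assms(1,3)] reduced_form[OF assms(1,4)] eq
      by (metis add_divide_distrib of_int_add)
    then show "r + s \<in> Zinv p" unfolding Zinv_def by blast
    show "pexp p (r + s) \<le> pexp p r" using fraction_reduced[OF assms(1) e] by (metis le_add1)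
  qed
  have "xi_rat p \<alpha> r s \<in> \<int>"
    using *[of r "pexp p s"] *[of s "pexp p r"] *[of "r + s" "pexp p r"] sum assms(3,4)
    unfolding xi_rat_def Let_def by (auto simp: minus_mult_left[symmetric] simp del: of_int_diff)
  then show ?thesis unfolding xi_def by simp
qed

definition QJ :: "nat \<Rightarrow> (nat \<Rightarrow> real) \<Rightarrow> (int \<times> rat) monoid" where
  "QJ p \<alpha> = \<lparr>carrier = UNIV \<times> Zinv p,
     monoid.mult = (\<lambda>(z, r) (w, s). (z + w + xi p \<alpha> r s, r + s)), one = (0, 0)\<rparr>"

definition K0_identification :: "nat \<Rightarrow> (nat \<Rightarrow> real) \<Rightarrow> 'a cstar_alg
    \<Rightarrow> ((('a, nat \<Rightarrow> 'a) module \<times> ('a, nat \<Rightarrow> 'a) module) set \<Rightarrow> int \<times> rat) \<Rightarrow> bool" where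
  "K0_identification p \<alpha> A \<Phi> \<longleftrightarrow> \<Phi> \<in> iso (K0 A) (QJ p \<alpha>) \<and>
     (\<forall>X\<in>carrier (K0 A). \<Phi> X = (1, 0) \<longrightarrow> K0_trace A X = 1) \<and>
     (\<forall>X\<in>carrier (K0 A). \<forall>k. \<Phi> X = (0, 1 / of_nat p ^ k) \<longrightarrow> K0_trace A X = \<alpha> k)"

end

theory Submission
  imports Defs "HOL-Analysis.Analysis"
begin

text \<open>Since \<open>\<alpha> 0\<close> is irrational, \<open>Psi p \<alpha>\<close> is a nondegenerate bicharacter, so every tracial state vanishes on
  \<open>W g\<close> for \<open>g \<noteq> 0\<close>; as tracial states are bounded, the canonical one, obtained from the regular
  representation, is the only one, and the trace on \<open>K\<^sub>0\<close> is additive. If \<open>q \<noteq> 0\<close>, the unitaries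
  \<open>W (q / p\<^sup>N, 0)\<close> and \<open>W (0, -1)\<close> generate an irrational rotation algebra of angle
  \<open>\<beta> = frac (q \<alpha>\<^sub>N)\<close>. Applying the functional calculus of the first unitary, Rieffel's construction gives
  an idempotent \<open>e\<close> of trace \<open>\<beta>\<close>, and \<open>A\<^sup>m \<oplus> A e\<close> with \<open>m = \<lfloor>\<gamma>\<rfloor>\<close> has trace \<open>\<gamma>\<close>. Under any
  identification of \<open>K\<^sub>0\<close> with \<open>QJ p \<alpha>\<close> the trace becomes the homomorphism with the prescribed values on
  generators; it is injective because \<open>\<alpha> 0\<close> is irrational, so the trace determines the class.\<close>

section \<open>Left modules and their isomorphism classes\<close>

text \<open>\<open>module_trace\<close>, \<open>K0_induced\<close> and \<open>K0_trace\<close> are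
  definite descriptions, so each needs existence and uniqueness before it yields a number;
  \<open>K0_trace\<close> can be evaluated here because a tracial state exists and all of them
  agree. The algebra is an arbitrary model of the universal one, so no concrete operators and no
  spectral theory are at hand. Two facts replace them. Its norm dominates every C*-seminorm on
  finitely supported functions, so comparison with the operator norm of the regular representation
  makes the coefficient at \<open>0\<close> continuous. And continuous functions on the circle are
  themselves the universal algebra of the integers, so the functional calculus of a unitary is an
  instance of the universal property. Boundedness of tracial states rests on a square root of
  \<open>1 - x\<close> for small self-adjoint \<open>x\<close>; this gives a constant that is not
  sharp, but continuity is all that matters. A projective module needs only an idempotent, so the
  Rieffel element is not shown to be self-adjoint.\<close>

lemma lmod_homI:
  assumes "\<And>x. x \<in> carrier M \<Longrightarrow> h x \<in> carrier N"
    and "\<And>x y. x \<in> carrier M \<Longrightarrow> y \<in> carrier M \<Longrightarrow> h (x \<oplus>\<^bsub>M\<^esub> y) = h x \<oplus>\<^bsub>N\<^esub> h y"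
    and "\<And>a x. a \<in> carrier R \<Longrightarrow> x \<in> carrier M \<Longrightarrow> h (a \<odot>\<^bsub>M\<^esub> x) = a \<odot>\<^bsub>N\<^esub> h x"
  shows "h \<in> lmod_hom R M N"
  using assms unfolding lmod_hom_def by auto

lemma lmod_homD:
  assumes "h \<in> lmod_hom R M N"
  shows "x \<in> carrier M \<Longrightarrow> h x \<in> carrier N"
    and "x \<in> carrier M \<Longrightarrow> y \<in> carrier M \<Longrightarrow> h (x \<oplus>\<^bsub>M\<^esub> y) = h x \<oplus>\<^bsub>N\<^esub> h y"
    and "a \<in> carrier R \<Longrightarrow> x \<in> carrier M \<Longrightarrow> h (a \<odot>\<^bsub>M\<^esub> x) = a \<odot>\<^bsub>N\<^esub> h x"
  using assms unfolding lmod_hom_def by auto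

lemma lmod_hom_comp:
  "f \<in> lmod_hom R M N \<Longrightarrow> g \<in> lmod_hom R N L \<Longrightarrow> (\<lambda>x. g (f x)) \<in> lmod_hom R M L"
  unfolding lmod_hom_def by (auto simp: Pi_def)

lemma left_moduleD:
  assumes "left_module R M"
  shows "ring R" "abelian_group M"
    and "x \<in> carrier M \<Longrightarrow> y \<in> carrier M \<Longrightarrow> x \<oplus>\<^bsub>M\<^esub> y \<in> carrier M"
    and "a \<in> carrier R \<Longrightarrow> x \<in> carrier M \<Longrightarrow> a \<odot>\<^bsub>M\<^esub> x \<in> carrier M"
    and "\<zero>\<^bsub>M\<^esub> \<in> carrier M"
proof -
  interpret left_module R M by fact
  show "ring R" "abelian_group M" by unfold_locales
  show "x \<in> carrier M \<Longrightarrow> y \<in> carrier M \<Longrightarrow> x \<oplus>\<^bsub>M\<^esub> y \<in> carrier M" by (rule M.a_closed)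
  show "a \<in> carrier R \<Longrightarrow> x \<in> carrier M \<Longrightarrow> a \<odot>\<^bsub>M\<^esub> x \<in> carrier M" by (rule smult_closed)
  show "\<zero>\<^bsub>M\<^esub> \<in> carrier M" by (rule M.zero_closed)
qed

lemma lmod_hom_zero:
  assumes "left_module R M" "left_module R N" "h \<in> lmod_hom R M N"
  shows "h \<zero>\<^bsub>M\<^esub> = \<zero>\<^bsub>N\<^esub>"
proof -
  interpret M: abelian_group M using left_moduleD[OF assms(1)] by blast
  interpret N: abelian_group N using left_moduleD[OF assms(2)] by blast
  have "h \<zero>\<^bsub>M\<^esub> \<oplus>\<^bsub>N\<^esub> h \<zero>\<^bsub>M\<^esub> = h \<zero>\<^bsub>M\<^esub>"
    using lmod_homD(2)[OF assms(3), of "\<zero>\<^bsub>M\<^esub>" "\<zero>\<^bsub>M\<^esub>"] by simp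
  then show ?thesis using lmod_homD(1)[OF assms(3), of "\<zero>\<^bsub>M\<^esub>"]
    by (metis M.zero_closed N.add.r_cancel_one')
qed

lemma lmod_isoI:
  assumes "f \<in> lmod_hom R M N" "g \<in> lmod_hom R N M"
    and "\<And>x. x \<in> carrier M \<Longrightarrow> g (f x) = x" "\<And>y. y \<in> carrier N \<Longrightarrow> f (g y) = y"
  shows "lmod_iso R M N"
  unfolding lmod_iso_def
proof (rule bexI[OF _ assms(1)])
  show "bij_betw f (carrier M) (carrier N)"
    by (rule bij_betw_byWitness[where f' = g]) (use assms lmod_homD(1) in \<open>auto simp: image_subset_iff\<close>)
qed

lemma lmod_isoE:
  assumes "lmod_iso R M N" "left_module R M"
  obtains f g where "f \<in> lmod_hom R M N" "g \<in> lmod_hom R N M"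
    "\<And>x. x \<in> carrier M \<Longrightarrow> g (f x) = x" "\<And>y. y \<in> carrier N \<Longrightarrow> f (g y) = y"
proof -
  obtain f where f: "f \<in> lmod_hom R M N" "bij_betw f (carrier M) (carrier N)"
    using assms(1) unfolding lmod_iso_def by blast
  define g where "g = inv_into (carrier M) f"
  have gf: "g (f x) = x" if "x \<in> carrier M" for x
    using f(2) that unfolding g_def by (simp add: bij_betw_inv_into_left)
  have fg: "f (g y) = y" if "y \<in> carrier N" for y
    using f(2) that unfolding g_def by (simp add: bij_betw_inv_into_right)
  have gc: "g y \<in> carrier M" if "y \<in> carrier N" for y
    using f(2) that unfolding g_def by (metis bij_betw_def inv_into_into)
  have "g \<in> lmod_hom R N M"
  proof (rule lmod_homI[OF gc])
    show "g (x \<oplus>\<^bsub>N\<^esub> y) = g x \<oplus>\<^bsub>M\<^esub> g y" if "x \<in> carrier N" "y \<in> carrier N" for x y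
      using lmod_homD(2)[OF f(1), of "g x" "g y"] gf[of "g x \<oplus>\<^bsub>M\<^esub> g y"] gc fg that
        left_moduleD(3)[OF assms(2)] by metis
    show "g (a \<odot>\<^bsub>N\<^esub> x) = a \<odot>\<^bsub>M\<^esub> g x" if "a \<in> carrier R" "x \<in> carrier N" for a x
      using lmod_homD(3)[OF f(1), of a "g x"] gf[of "a \<odot>\<^bsub>M\<^esub> g x"] gc fg that
        left_moduleD(4)[OF assms(2)] by metis
  qed
  then show thesis using that f(1) gf fg by blast
qed

lemma lmod_iso_refl: "lmod_iso R M M"
  by (rule lmod_isoI[where f = "\<lambda>x. x" and g = "\<lambda>x. x"]) (auto intro!: lmod_homI)

lemma lmod_iso_sym: "lmod_iso R M N \<Longrightarrow> left_module R M \<Longrightarrow> lmod_iso R N M"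
  by (metis lmod_isoE lmod_isoI)

lemma lmod_iso_trans:
  assumes "lmod_iso R M N" "lmod_iso R N L"
  shows "lmod_iso R M L"
proof -
  obtain f g where "f \<in> lmod_hom R M N" "bij_betw f (carrier M) (carrier N)"
      "g \<in> lmod_hom R N L" "bij_betw g (carrier N) (carrier L)"
    using assms unfolding lmod_iso_def by blast
  then show ?thesis unfolding lmod_iso_def
    using lmod_hom_comp bij_betw_trans[of f _ _ g] by (intro bexI[of _ "\<lambda>x. g (f x)"]) (auto simp: comp_def)
qed

lemma left_moduleI:
  fixes R (structure) and M (structure)
  assumes "ring R" "\<zero>\<^bsub>M\<^esub> \<in> carrier M"
    and "\<And>x y. x \<in> carrier M \<Longrightarrow> y \<in> carrier M \<Longrightarrow> x \<oplus>\<^bsub>M\<^esub> y \<in> carrier M"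
    and "\<And>x y. x \<in> carrier M \<Longrightarrow> y \<in> carrier M \<Longrightarrow> x \<oplus>\<^bsub>M\<^esub> y = y \<oplus>\<^bsub>M\<^esub> x"
    and "\<And>x y z. x \<in> carrier M \<Longrightarrow> y \<in> carrier M \<Longrightarrow> z \<in> carrier M
      \<Longrightarrow> (x \<oplus>\<^bsub>M\<^esub> y) \<oplus>\<^bsub>M\<^esub> z = x \<oplus>\<^bsub>M\<^esub> (y \<oplus>\<^bsub>M\<^esub> z)"
    and "\<And>x. x \<in> carrier M \<Longrightarrow> \<zero>\<^bsub>M\<^esub> \<oplus>\<^bsub>M\<^esub> x = x"
    and "\<And>x. x \<in> carrier M \<Longrightarrow> \<exists>y\<in>carrier M. y \<oplus>\<^bsub>M\<^esub> x = \<zero>\<^bsub>M\<^esub>"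
    and "\<And>a x. a \<in> carrier R \<Longrightarrow> x \<in> carrier M \<Longrightarrow> a \<odot>\<^bsub>M\<^esub> x \<in> carrier M"
    and "\<And>a b x. a \<in> carrier R \<Longrightarrow> b \<in> carrier R \<Longrightarrow> x \<in> carrier M
      \<Longrightarrow> (a \<oplus>\<^bsub>R\<^esub> b) \<odot>\<^bsub>M\<^esub> x = a \<odot>\<^bsub>M\<^esub> x \<oplus>\<^bsub>M\<^esub> b \<odot>\<^bsub>M\<^esub> x"
    and "\<And>a x y. a \<in> carrier R \<Longrightarrow> x \<in> carrier M \<Longrightarrow> y \<in> carrier M
      \<Longrightarrow> a \<odot>\<^bsub>M\<^esub> (x \<oplus>\<^bsub>M\<^esub> y) = a \<odot>\<^bsub>M\<^esub> x \<oplus>\<^bsub>M\<^esub> a \<odot>\<^bsub>M\<^esub> y"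
    and "\<And>a b x. a \<in> carrier R \<Longrightarrow> b \<in> carrier R \<Longrightarrow> x \<in> carrier M
      \<Longrightarrow> (a \<otimes>\<^bsub>R\<^esub> b) \<odot>\<^bsub>M\<^esub> x = a \<odot>\<^bsub>M\<^esub> (b \<odot>\<^bsub>M\<^esub> x)"
    and "\<And>x. x \<in> carrier M \<Longrightarrow> \<one>\<^bsub>R\<^esub> \<odot>\<^bsub>M\<^esub> x = x"
  shows "left_module R M"
  by (intro left_module.intro left_module_axioms.intro assms abelian_groupI)

text \<open>Transport of structure along a bijection. \<open>N\<close> is a mere record here, so
  nothing but the hypothesis \<open>zero\<close> ties its zero element to its addition.\<close>

lemma left_module_iso:
  assumes M: "left_module R M" and h: "h \<in> lmod_hom R M N" "bij_betw h (carrier M) (carrier N)"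
    and zero: "h \<zero>\<^bsub>M\<^esub> = \<zero>\<^bsub>N\<^esub>"
  shows "left_module R N"
proof -
  interpret left_module R M by fact
  note hD = lmod_homD[OF h(1)] and hs = lmod_homD(2,3)[OF h(1), symmetric]
  have ex: "\<exists>x\<in>carrier M. y = h x" if "y \<in> carrier N" for y
    using h(2) that unfolding bij_betw_def by blast
  show ?thesis
  proof (rule left_moduleI)
    show "ring R" by (rule ring_axioms)
    show "\<zero>\<^bsub>N\<^esub> \<in> carrier N" using hD(1)[OF M.zero_closed] zero by simp
    fix x y z assume "x \<in> carrier N" "y \<in> carrier N" "z \<in> carrier N"
    then obtain x' y' z' where e: "x' \<in> carrier M" "y' \<in> carrier M" "z' \<in> carrier M"
        "x = h x'" "y = h y'" "z = h z'" using ex by metis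
    show "x \<oplus>\<^bsub>N\<^esub> y \<oplus>\<^bsub>N\<^esub> z = x \<oplus>\<^bsub>N\<^esub> (y \<oplus>\<^bsub>N\<^esub> z)" using e by (simp add: hs M.a_assoc)
  next
    fix x y assume "x \<in> carrier N" "y \<in> carrier N"
    then obtain x' y' where e: "x' \<in> carrier M" "y' \<in> carrier M" "x = h x'" "y = h y'" using ex by metis
    show "x \<oplus>\<^bsub>N\<^esub> y \<in> carrier N" using e by (simp add: hs hD(1))
    show "x \<oplus>\<^bsub>N\<^esub> y = y \<oplus>\<^bsub>N\<^esub> x" using e by (simp add: hs M.a_comm)
    fix a assume a: "a \<in> carrier R"
    show "a \<odot>\<^bsub>N\<^esub> (x \<oplus>\<^bsub>N\<^esub> y) = a \<odot>\<^bsub>N\<^esub> x \<oplus>\<^bsub>N\<^esub> a \<odot>\<^bsub>N\<^esub> y"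
      using a e by (simp add: hs smult_r_distr smult_closed)
  next
    fix x assume "x \<in> carrier N"
    then obtain x' where e: "x' \<in> carrier M" "x = h x'" using ex by metis
    show "\<zero>\<^bsub>N\<^esub> \<oplus>\<^bsub>N\<^esub> x = x" using e by (simp add: hs zero[symmetric])
    show "\<exists>y\<in>carrier N. y \<oplus>\<^bsub>N\<^esub> x = \<zero>\<^bsub>N\<^esub>"
      using e by (intro bexI[of _ "h (\<ominus>\<^bsub>M\<^esub> x')"]) (simp_all add: hs zero[symmetric] M.l_neg hD(1))
    show "\<one>\<^bsub>R\<^esub> \<odot>\<^bsub>N\<^esub> x = x" using e by (simp add: hs smult_one)
    fix a b assume ab: "a \<in> carrier R"  "b \<in> carrier R"
    show "a \<odot>\<^bsub>N\<^esub> x \<in> carrier N" using ab e by (simp add: hs hD(1) smult_closed)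
    show "(a \<oplus>\<^bsub>R\<^esub> b) \<odot>\<^bsub>N\<^esub> x = a \<odot>\<^bsub>N\<^esub> x \<oplus>\<^bsub>N\<^esub> b \<odot>\<^bsub>N\<^esub> x"
      using ab e by (simp add: hs smult_l_distr smult_closed)
    show "(a \<otimes>\<^bsub>R\<^esub> b) \<odot>\<^bsub>N\<^esub> x = a \<odot>\<^bsub>N\<^esub> (b \<odot>\<^bsub>N\<^esub> x)"
      using ab e by (simp add: hs smult_assoc smult_closed)
  qed
qed

lemma left_module_free:
  assumes "ring R"
  shows "left_module R (free_lmod R n)"
proof -
  interpret ring R by fact
  have *: "(if i < n then x i \<in> carrier R else x i = \<zero>\<^bsub>R\<^esub>) \<Longrightarrow> x i \<in> carrier R" for x :: "nat \<Rightarrow> 'a" and i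
    by (auto split: if_splits)
  show ?thesis
  proof (rule left_moduleI)
    fix x assume x: "x \<in> carrier (free_lmod R n)"
    show "\<exists>y\<in>carrier (free_lmod R n). y \<oplus>\<^bsub>free_lmod R n\<^esub> x = \<zero>\<^bsub>free_lmod R n\<^esub>"
      using x by (intro bexI[of _ "\<lambda>i. \<ominus>\<^bsub>R\<^esub> x i"]) (auto simp: free_lmod_def * l_neg)
  qed (auto simp: free_lmod_def * a_ac m_assoc l_distr r_distr fun_eq_iff assms)
qed

lemma left_module_sum:
  assumes "left_module R M" "left_module R N"
  shows "left_module R (lmod_sum M N)"
proof -
  interpret M: left_module R M by fact
  interpret N: left_module R N by fact
  show ?thesis
  proof (rule left_moduleI)
    fix x assume x: "x \<in> carrier (lmod_sum M N)"
    show "\<exists>y\<in>carrier (lmod_sum M N). y \<oplus>\<^bsub>lmod_sum M N\<^esub> x = \<zero>\<^bsub>lmod_sum M N\<^esub>"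
      using x by (intro bexI[of _ "(\<ominus>\<^bsub>M\<^esub> fst x, \<ominus>\<^bsub>N\<^esub> snd x)"]) (auto simp: lmod_sum_def M.M.l_neg N.M.l_neg)
  qed (auto simp: lmod_sum_def M.R.ring_axioms M.M.a_ac N.M.a_ac M.smult_closed N.smult_closed
      M.smult_l_distr M.smult_r_distr M.smult_assoc M.smult_one
      N.smult_l_distr N.smult_r_distr N.smult_assoc N.smult_one)
qed

lemma lmod_iso_sum_cong:
  assumes "lmod_iso R M M'" "lmod_iso R N N'"
  shows "lmod_iso R (lmod_sum M N) (lmod_sum M' N')"
proof -
  obtain f g where "f \<in> lmod_hom R M M'" "bij_betw f (carrier M) (carrier M')"
      "g \<in> lmod_hom R N N'" "bij_betw g (carrier N) (carrier N')"
    using assms unfolding lmod_iso_def by blast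
  moreover then have "map_prod f g \<in> lmod_hom R (lmod_sum M N) (lmod_sum M' N')"
    by (intro lmod_homI) (auto simp: lmod_sum_def dest: lmod_homD)
  ultimately show ?thesis unfolding lmod_iso_def
    by (intro bexI[of _ "map_prod f g"]) (auto simp: lmod_sum_def intro: bij_betw_map_prod)
qed

lemma lmod_iso_sum_comm: "lmod_iso R (lmod_sum M N) (lmod_sum N M)"
  by (rule lmod_isoI[where f = prod.swap and g = prod.swap]) (auto simp: lmod_sum_def intro!: lmod_homI)

lemma lmod_iso_sum_assoc:
  "lmod_iso R (lmod_sum (lmod_sum M N) L) (lmod_sum M (lmod_sum N L))"
  by (rule lmod_isoI[where f = "\<lambda>((x, y), z). (x, y, z)" and g = "\<lambda>(x, y, z). ((x, y), z)"])
    (auto simp: lmod_sum_def intro!: lmod_homI)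

lemma carrier_free_0: "carrier (free_lmod R 0) = {\<zero>\<^bsub>free_lmod R 0\<^esub>}"
  by (auto simp: free_lmod_def)

lemma lmod_iso_sum_zero:
  assumes M: "left_module R M"
  shows "lmod_iso R (lmod_sum M (free_lmod R 0)) M"
proof -
  interpret left_module R M by fact
  interpret F: left_module R "free_lmod R 0" by (rule left_module_free) (rule ring_axioms)
  show ?thesis
  proof (rule lmod_isoI[where f = fst and g = "\<lambda>x. (x, \<zero>\<^bsub>free_lmod R 0\<^esub>)"])
    show "(\<lambda>x. (x, \<zero>\<^bsub>free_lmod R 0\<^esub>)) \<in> lmod_hom R M (lmod_sum M (free_lmod R 0))"
      using F.smult_closed by (intro lmod_homI) (auto simp: lmod_sum_def carrier_free_0)
  qed (auto simp: lmod_sum_def carrier_free_0 intro!: lmod_homI)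
qed

lemma fg_projectiveD:
  assumes "fg_projective R M"
  shows "left_module R M" "ring R"
  using assms left_moduleD(1) unfolding fg_projective_def by blast+

lemma summand_maps_iso:
  assumes s: "summand_maps R M n i r" and fg: "f \<in> lmod_hom R M N" "g \<in> lmod_hom R N M"
    and inv: "\<And>y. y \<in> carrier N \<Longrightarrow> f (g y) = y"
  shows "summand_maps R N n (\<lambda>y. i (g y)) (\<lambda>x. f (r x))"
  using s lmod_hom_comp[OF fg(2)] lmod_hom_comp[OF _ fg(1)] inv lmod_homD(1)[OF fg(2)]
  unfolding summand_maps_def by fastforce

lemma fg_projective_iso:
  assumes "fg_projective R M" "lmod_iso R M N" "left_module R N"
  shows "fg_projective R N"
proof -
  obtain f g where fg: "f \<in> lmod_hom R M N" "g \<in> lmod_hom R N M"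
      "\<And>y. y \<in> carrier N \<Longrightarrow> f (g y) = y"
    using lmod_isoE[OF assms(2) fg_projectiveD(1)[OF assms(1)]] by metis
  obtain n i r where "summand_maps R M n i r"
    using assms(1) unfolding fg_projective_def by blast
  then show ?thesis using assms(3) summand_maps_iso[OF _ fg] unfolding fg_projective_def by blast
qed

text \<open>\<open>K0\<close> quantifies over modules of rows only. The image of the injection
  \<open>i\<close> into a free module is such a module, which brings modules over arbitrary types
  into that range.\<close>

lemma row_copy:
  assumes "fg_projective R M"
  shows "\<exists>P :: ('r, nat \<Rightarrow> 'r) module. fg_projective (R :: ('r, 'c) ring_scheme) P \<and> lmod_iso R M P"
proof -
  obtain n i r where s: "summand_maps R M n i r" using assms unfolding fg_projective_def by blast
  define P where "P = (free_lmod R n)\<lparr>carrier := i ` carrier M\<rparr>"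
  have i: "i \<in> lmod_hom R M (free_lmod R n)" using s unfolding summand_maps_def by blast
  have ops: "x \<oplus>\<^bsub>P\<^esub> y = x \<oplus>\<^bsub>free_lmod R n\<^esub> y" "a \<odot>\<^bsub>P\<^esub> x = a \<odot>\<^bsub>free_lmod R n\<^esub> x"
    "\<zero>\<^bsub>P\<^esub> = \<zero>\<^bsub>free_lmod R n\<^esub>" "carrier P = i ` carrier M" for x y a
    by (simp_all add: P_def)
  have i': "i \<in> lmod_hom R M P"
    using lmod_homD[OF i] by (intro lmod_homI) (auto simp: ops)
  have bij: "bij_betw i (carrier M) (carrier P)"
    using s unfolding summand_maps_def ops by (metis bij_betw_def inj_onI)
  have zero: "i \<zero>\<^bsub>M\<^esub> = \<zero>\<^bsub>P\<^esub>"
    using lmod_hom_zero[OF _ left_module_free i] fg_projectiveD[OF assms] by (simp add: ops)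
  have "left_module R P" using left_module_iso[OF fg_projectiveD(1)[OF assms] i' bij zero] .
  moreover have "lmod_iso R M P" unfolding lmod_iso_def using i' bij by blast
  ultimately show ?thesis using fg_projective_iso[OF assms] by blast
qed

lemma summand_maps_free: "summand_maps R (free_lmod R n) n (\<lambda>x. x) (\<lambda>x. x)"
  unfolding summand_maps_def by (auto intro!: lmod_homI)

lemma fg_projective_free: "ring R \<Longrightarrow> fg_projective R (free_lmod R n)"
  unfolding fg_projective_def using left_module_free summand_maps_free by blast

text \<open>Rows of length \<open>m + n\<close> are concatenations. The left block must be cut off
  at \<open>m\<close> before \<open>r\<close> is applied, whereas the right block vanishes beyond
  \<open>n\<close> by itself.\<close>

lemma summand_maps_sum:
  assumes "ring R" "summand_maps R M m i r" "summand_maps R N n j s"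
  shows "summand_maps R (lmod_sum M N) (m + n) (\<lambda>(x, y) k. if k < m then i x k else j y (k - m))
    (\<lambda>z. (r (\<lambda>k. if k < m then z k else \<zero>\<^bsub>R\<^esub>), s (\<lambda>k. z (m + k))))"
proof -
  interpret ring R by fact
  note h = assms(2,3)[unfolded summand_maps_def]
  note i = lmod_homD[OF h(1)[THEN conjunct1]] and r = lmod_homD[OF h(1)[THEN conjunct2, THEN conjunct1]]
    and j = lmod_homD[OF h(2)[THEN conjunct1]] and s = lmod_homD[OF h(2)[THEN conjunct2, THEN conjunct1]]
  have left: "(\<lambda>k. if k < m then z k else \<zero>\<^bsub>R\<^esub>) \<in> carrier (free_lmod R m)"
    and right: "(\<lambda>k. z (m + k)) \<in> carrier (free_lmod R n)"
    if "z \<in> carrier (free_lmod R (m + n))" for z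
    using that by (auto simp: free_lmod_def)
  have ic: "k < m \<Longrightarrow> i x k \<in> carrier R" "\<not> k < m \<Longrightarrow> i x k = \<zero>\<^bsub>R\<^esub>" if "x \<in> carrier M" for x k
    using i(1)[OF that] by (auto simp: free_lmod_def split: if_splits)
  have jc: "k < n \<Longrightarrow> j x k \<in> carrier R" "\<not> k < n \<Longrightarrow> j x k = \<zero>\<^bsub>R\<^esub>" if "x \<in> carrier N" for x k
    using j(1)[OF that] by (auto simp: free_lmod_def split: if_splits)
  show ?thesis
    unfolding summand_maps_def
  proof (intro conjI ballI)
    show "(\<lambda>(x, y) k. if k < m then i x k else j y (k - m)) \<in> lmod_hom R (lmod_sum M N) (free_lmod R (m + n))"
    proof (rule lmod_homI, goal_cases)
      case (1 x) then show ?case by (auto simp: lmod_sum_def free_lmod_def ic jc)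
    next
      case (2 x y) then show ?case by (auto simp: lmod_sum_def i(2) j(2) fun_eq_iff) (auto simp: free_lmod_def)
    next
      case (3 a x) then show ?case by (auto simp: lmod_sum_def i(3) j(3) fun_eq_iff) (auto simp: free_lmod_def)
    qed
    show "(\<lambda>z. (r (\<lambda>k. if k < m then z k else \<zero>\<^bsub>R\<^esub>), s (\<lambda>k. z (m + k))))
      \<in> lmod_hom R (free_lmod R (m + n)) (lmod_sum M N)"
    proof (rule lmod_homI, goal_cases)
      case (1 z) then show ?case using r(1)[OF left] s(1)[OF right] by (simp add: lmod_sum_def)
    next
      case (2 x y)
      have "(\<lambda>k. if k < m then (x \<oplus>\<^bsub>free_lmod R (m + n)\<^esub> y) k else \<zero>\<^bsub>R\<^esub>)
        = (\<lambda>k. if k < m then x k else \<zero>\<^bsub>R\<^esub>) \<oplus>\<^bsub>free_lmod R m\<^esub> (\<lambda>k. if k < m then y k else \<zero>\<^bsub>R\<^esub>)"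
        "(\<lambda>k. (x \<oplus>\<^bsub>free_lmod R (m + n)\<^esub> y) (m + k)) = (\<lambda>k. x (m + k)) \<oplus>\<^bsub>free_lmod R n\<^esub> (\<lambda>k. y (m + k))"
        by (auto simp: free_lmod_def)
      then show ?case using 2 by (simp add: r(2) s(2) left right) (simp add: lmod_sum_def)
    next
      case (3 a x)
      have "(\<lambda>k. if k < m then (a \<odot>\<^bsub>free_lmod R (m + n)\<^esub> x) k else \<zero>\<^bsub>R\<^esub>)
        = a \<odot>\<^bsub>free_lmod R m\<^esub> (\<lambda>k. if k < m then x k else \<zero>\<^bsub>R\<^esub>)"
        "(\<lambda>k. (a \<odot>\<^bsub>free_lmod R (m + n)\<^esub> x) (m + k)) = a \<odot>\<^bsub>free_lmod R n\<^esub> (\<lambda>k. x (m + k))"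
        using 3 by (auto simp: free_lmod_def)
      then show ?case using 3 by (simp add: r(3) s(3) left right) (simp add: lmod_sum_def)
    qed
    fix z assume "z \<in> carrier (lmod_sum M N)"
    then obtain x y where z: "z = (x, y)" "x \<in> carrier M" "y \<in> carrier N" by (auto simp: lmod_sum_def)
    have "(\<lambda>k. if k < m then i x k else \<zero>\<^bsub>R\<^esub>) = i x" using ic(2)[OF z(2)] by auto
    moreover have "(\<lambda>k. j y (m + k - m)) = j y" by simp
    ultimately show "(r (\<lambda>k. if k < m then (case z of (x, y) \<Rightarrow> \<lambda>k. if k < m then i x k else j y (k - m)) k else \<zero>\<^bsub>R\<^esub>),
        s (\<lambda>k. (case z of (x, y) \<Rightarrow> \<lambda>k. if k < m then i x k else j y (k - m)) (m + k))) = z"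
      using h z by (simp cong: if_cong)
  qed
qed

lemma fg_projective_sum:
  assumes "fg_projective R M" "fg_projective R N"
  shows "fg_projective R (lmod_sum M N)"
  using assms summand_maps_sum[OF fg_projectiveD(2)[OF assms(1)]] left_module_sum
  unfolding fg_projective_def by blast

section \<open>Isomorphism classes and their Grothendieck group\<close>

text \<open>Representatives are taken among modules of rows, so that the classes of modules over
  different types lie in one set and can be compared.\<close>

definition lmod_class :: "('r, 'c) ring_scheme \<Rightarrow> ('r, 'm) module \<Rightarrow> ('r, nat \<Rightarrow> 'r) module set" where
  "lmod_class R M = {P. fg_projective R P \<and> lmod_iso R P M}"

text \<open>The commutative monoid whose group completion is \<open>K0\<close>. Passing to it turns
  chains of isomorphisms between direct sums into calculation in a commutative monoid.\<close>

definition lmod_classes :: "('r, 'c) ring_scheme \<Rightarrow> ('r, nat \<Rightarrow> 'r) module set monoid" where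
  "lmod_classes R = \<lparr>carrier = {lmod_class R (P :: ('r, nat \<Rightarrow> 'r) module) | P. fg_projective R P},
     monoid.mult = (\<lambda>C D. \<Union>P\<in>C. \<Union>Q\<in>D. lmod_class R (lmod_sum P Q)), one = lmod_class R (free_lmod R 0)\<rparr>"

text \<open>\<open>M\<close> may have elements of another type than rows and is then no member of
  its own class; a row copy of \<open>M\<close> serves as the common member.\<close>

lemma lmod_class_eq_iff:
  assumes "fg_projective R M" "fg_projective R N"
  shows "lmod_class R M = lmod_class R N \<longleftrightarrow> lmod_iso R M N"
proof
  assume eq: "lmod_class R M = lmod_class R N"
  obtain P :: "('a, nat \<Rightarrow> 'a) module" where P: "fg_projective R P" "lmod_iso R M P"
    using row_copy[OF assms(1)] by blast
  then have "P \<in> lmod_class R M"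
    unfolding lmod_class_def using lmod_iso_sym[OF P(2)] fg_projectiveD(1)[OF assms(1)] by blast
  then have "lmod_iso R P N" using eq unfolding lmod_class_def by blast
  then show "lmod_iso R M N" using lmod_iso_trans[OF P(2)] by blast
next
  assume i: "lmod_iso R M N"
  have "lmod_iso R P M \<longleftrightarrow> lmod_iso R P N" for P :: "('a, nat \<Rightarrow> 'a) module"
    using lmod_iso_trans[of R P M N] lmod_iso_trans[of R P N M] i
      lmod_iso_sym[OF i fg_projectiveD(1)[OF assms(1)]] by blast
  then show "lmod_class R M = lmod_class R N" unfolding lmod_class_def by simp
qed

lemma lmod_class_closed:
  assumes "fg_projective R M"
  shows "lmod_class R M \<in> carrier (lmod_classes R)"
  using row_copy[OF assms] lmod_class_eq_iff[OF assms] unfolding lmod_classes_def by auto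

lemma lmod_class_mult:
  assumes "fg_projective R M" "fg_projective R N"
  shows "lmod_class R M \<otimes>\<^bsub>lmod_classes R\<^esub> lmod_class R N = lmod_class R (lmod_sum M N)"
proof -
  have "lmod_class R (lmod_sum P Q) = lmod_class R (lmod_sum M N)"
    if "P \<in> lmod_class R M" "Q \<in> lmod_class R N" for P Q
  proof (subst lmod_class_eq_iff)
    show "lmod_iso R (lmod_sum P Q) (lmod_sum M N)"
      using that unfolding lmod_class_def by (auto intro: lmod_iso_sum_cong)
  qed (use that assms in \<open>auto simp: lmod_class_def intro: fg_projective_sum\<close>)
  moreover obtain P Q where "P \<in> lmod_class R M" "Q \<in> lmod_class R N"
    using row_copy[OF assms(1)] row_copy[OF assms(2)] lmod_iso_sym
      fg_projectiveD(1)[OF assms(1)] fg_projectiveD(1)[OF assms(2)]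
    unfolding lmod_class_def mem_Collect_eq by metis
  ultimately show ?thesis unfolding lmod_classes_def by auto
qed

lemma lmod_classes_comm_monoid:
  assumes "ring R"
  shows "comm_monoid (lmod_classes R)"
proof -
  have ex: "\<exists>P :: ('a, nat \<Rightarrow> 'a) module. fg_projective R P \<and> C = lmod_class R P" if "C \<in> carrier (lmod_classes R)" for C
    using that unfolding lmod_classes_def by auto
  have one: "\<one>\<^bsub>lmod_classes R\<^esub> = lmod_class R (free_lmod R 0)" by (simp add: lmod_classes_def)
  note free = fg_projective_free[OF assms]
  show ?thesis
  proof (rule comm_monoidI)
    show "\<one>\<^bsub>lmod_classes R\<^esub> \<in> carrier (lmod_classes R)"
      unfolding one by (rule lmod_class_closed[OF free])
    fix x y z assume x: "x \<in> carrier (lmod_classes R)" and y: "y \<in> carrier (lmod_classes R)"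
      and z: "z \<in> carrier (lmod_classes R)"
    obtain P Q L :: "('a, nat \<Rightarrow> 'a) module" where P: "fg_projective R P" "x = lmod_class R P"
      and Q: "fg_projective R Q" "y = lmod_class R Q" and L: "fg_projective R L" "z = lmod_class R L"
      using ex x y z by metis
    show "x \<otimes>\<^bsub>lmod_classes R\<^esub> y \<otimes>\<^bsub>lmod_classes R\<^esub> z = x \<otimes>\<^bsub>lmod_classes R\<^esub> (y \<otimes>\<^bsub>lmod_classes R\<^esub> z)"
      using P Q L lmod_iso_sum_assoc by (auto simp: lmod_class_mult lmod_class_eq_iff fg_projective_sum)
  next
    fix x y assume x: "x \<in> carrier (lmod_classes R)" and y: "y \<in> carrier (lmod_classes R)"
    obtain P Q :: "('a, nat \<Rightarrow> 'a) module" where P: "fg_projective R P" "x = lmod_class R P"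
      and Q: "fg_projective R Q" "y = lmod_class R Q"
      using ex x y by metis
    show "x \<otimes>\<^bsub>lmod_classes R\<^esub> y \<in> carrier (lmod_classes R)"
      using P Q by (simp add: lmod_class_mult lmod_class_closed fg_projective_sum)
    show "x \<otimes>\<^bsub>lmod_classes R\<^esub> y = y \<otimes>\<^bsub>lmod_classes R\<^esub> x"
      using P Q lmod_iso_sum_comm by (auto simp: lmod_class_mult lmod_class_eq_iff fg_projective_sum)
  next
    fix x assume x: "x \<in> carrier (lmod_classes R)"
    obtain P :: "('a, nat \<Rightarrow> 'a) module" where P: "fg_projective R P" "x = lmod_class R P"
      using ex x by metis
    have "lmod_iso R (lmod_sum (free_lmod R 0) P) P"
      using lmod_iso_trans[OF lmod_iso_sum_comm lmod_iso_sum_zero[OF fg_projectiveD(1)[OF P(1)]]] .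
    then show "\<one>\<^bsub>lmod_classes R\<^esub> \<otimes>\<^bsub>lmod_classes R\<^esub> x = x"
      using P free by (simp add: one lmod_class_mult lmod_class_eq_iff fg_projective_sum)
  qed
qed

text \<open>Transitivity of the relation behind formal differences. The monoid need not be
  cancellative, so \<open>q\<close> cannot be removed and joins \<open>t\<close> and
  \<open>u\<close> in the witness.\<close>

lemma (in comm_monoid) difference_trans:
  assumes c: "p \<in> carrier G" "q \<in> carrier G" "p' \<in> carrier G" "q' \<in> carrier G"
      "r \<in> carrier G" "s \<in> carrier G" "t \<in> carrier G" "u \<in> carrier G"
    and e: "p' \<otimes> q \<otimes> t = p \<otimes> q' \<otimes> t" "r \<otimes> q \<otimes> u = p \<otimes> s \<otimes> u"
  shows "\<exists>w\<in>carrier G. r \<otimes> q' \<otimes> w = p' \<otimes> s \<otimes> w"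
proof (rule bexI[of _ "t \<otimes> u \<otimes> q"])
  have "r \<otimes> q' \<otimes> (t \<otimes> u \<otimes> q) = (r \<otimes> q \<otimes> u) \<otimes> (q' \<otimes> t)" using c by (simp add: m_ac)
  also have "\<dots> = (p \<otimes> q' \<otimes> t) \<otimes> (s \<otimes> u)" unfolding e(2) using c by (simp add: m_ac)
  also have "\<dots> = p' \<otimes> s \<otimes> (t \<otimes> u \<otimes> q)" unfolding e(1)[symmetric] using c by (simp add: m_ac)
  finally show "r \<otimes> q' \<otimes> (t \<otimes> u \<otimes> q) = p' \<otimes> s \<otimes> (t \<otimes> u \<otimes> q)" .
qed (use c in simp)

lemma (in comm_monoid) interchange:
  assumes "a \<in> carrier G" "b \<in> carrier G" "a' \<in> carrier G" "b' \<in> carrier G" "t \<in> carrier G" "u \<in> carrier G"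
  shows "(a \<otimes> a') \<otimes> (b \<otimes> b') \<otimes> (t \<otimes> u) = (a \<otimes> b \<otimes> t) \<otimes> (a' \<otimes> b' \<otimes> u)"
  using assms by (simp add: m_ac)

lemma K0_diff_iff:
  assumes P: "fg_projective R P" and Q: "fg_projective R Q"
  shows "(P', Q') \<in> K0_diff R P Q \<longleftrightarrow> fg_projective R P' \<and> fg_projective R Q' \<and>
    (\<exists>t\<in>carrier (lmod_classes R).
      lmod_class R P' \<otimes>\<^bsub>lmod_classes R\<^esub> lmod_class R Q \<otimes>\<^bsub>lmod_classes R\<^esub> t
      = lmod_class R P \<otimes>\<^bsub>lmod_classes R\<^esub> lmod_class R Q' \<otimes>\<^bsub>lmod_classes R\<^esub> t)"
proof -
  have "lmod_iso R (lmod_sum (lmod_sum P' Q) T) (lmod_sum (lmod_sum P Q') T)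
    \<longleftrightarrow> lmod_class R P' \<otimes>\<^bsub>lmod_classes R\<^esub> lmod_class R Q \<otimes>\<^bsub>lmod_classes R\<^esub> lmod_class R T
      = lmod_class R P \<otimes>\<^bsub>lmod_classes R\<^esub> lmod_class R Q' \<otimes>\<^bsub>lmod_classes R\<^esub> lmod_class R T"
    if "fg_projective R P'" "fg_projective R Q'" "fg_projective R T" for T :: "('a, nat \<Rightarrow> 'a) module"
    using that P Q by (simp add: lmod_class_mult fg_projective_sum lmod_class_eq_iff)
  moreover have "(\<exists>t\<in>carrier (lmod_classes R). \<Phi> t) \<longleftrightarrow>
      (\<exists>T :: ('a, nat \<Rightarrow> 'a) module. fg_projective R T \<and> \<Phi> (lmod_class R T))" for \<Phi>
    by (auto simp: lmod_classes_def)
  ultimately show ?thesis unfolding K0_diff_def by auto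
qed

text \<open>Equivalent pairs have the same equivalence class: \<open>difference_trans\<close> is
  used once in each direction.\<close>

lemma K0_diff_cong:
  assumes P: "fg_projective R P" "fg_projective R Q" and P': "fg_projective R P'" "fg_projective R Q'"
    and t: "t \<in> carrier (lmod_classes R)"
    and eq: "lmod_class R P' \<otimes>\<^bsub>lmod_classes R\<^esub> lmod_class R Q \<otimes>\<^bsub>lmod_classes R\<^esub> t
      = lmod_class R P \<otimes>\<^bsub>lmod_classes R\<^esub> lmod_class R Q' \<otimes>\<^bsub>lmod_classes R\<^esub> t"
  shows "K0_diff R P Q = K0_diff R P' Q'"
proof -
  interpret comm_monoid "lmod_classes R"
    by (rule lmod_classes_comm_monoid) (rule fg_projectiveD(2)[OF P(1)])
  note c = lmod_class_closed
  have "(X, Y) \<in> K0_diff R P Q \<longleftrightarrow> (X, Y) \<in> K0_diff R P' Q'" for X Y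
    unfolding K0_diff_iff[OF P] K0_diff_iff[OF P']
    using difference_trans[of "lmod_class R P" "lmod_class R Q" "lmod_class R P'" "lmod_class R Q'" "lmod_class R X" "lmod_class R Y" t]
      difference_trans[of "lmod_class R P'" "lmod_class R Q'" "lmod_class R P" "lmod_class R Q" "lmod_class R X" "lmod_class R Y" t]
      c[OF P(1)] c[OF P(2)] c[OF P'(1)] c[OF P'(2)] c[of R X] c[of R Y] t eq by metis
  then show ?thesis by auto
qed

lemma K0_diff_self: "ring R \<Longrightarrow> fg_projective R P \<Longrightarrow> fg_projective R Q \<Longrightarrow> (P, Q) \<in> K0_diff R P Q"
  unfolding K0_diff_def using fg_projective_free[of R 0] lmod_iso_refl by auto

lemma K0_diff_carrier:
  assumes "fg_projective R P" "fg_projective R Q"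
  shows "K0_diff R P Q \<in> carrier (K0 R)"
proof -
  obtain P' Q' :: "('a, nat \<Rightarrow> 'a) module" where P': "fg_projective R P'" "lmod_iso R P P'"
      and Q': "fg_projective R Q'" "lmod_iso R Q Q'"
    using row_copy assms by metis
  \<comment> \<open>The monoid classes of the row copies equal those of \<open>P\<close> and
    \<open>Q\<close>, so any class would do for \<open>t\<close>.\<close>
  have "K0_diff R P Q = K0_diff R P' Q'"
    using lmod_class_eq_iff[OF assms(1) P'(1)] lmod_class_eq_iff[OF assms(2) Q'(1)] P' Q' assms
    by (intro K0_diff_cong[where t = "lmod_class R P"]) (simp_all add: lmod_class_closed)
  then show ?thesis unfolding K0_def using P' Q' by auto
qed

text \<open>The product in \<open>K0\<close> is a union over representatives. All of them contribute
  the same set, and the last two hypotheses exclude a union over nothing.\<close>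

lemma K0_mult:
  assumes P: "fg_projective R P" "fg_projective R Q" and P': "fg_projective R P'" "fg_projective R Q'"
    and "K0_diff R P Q \<noteq> {}" "K0_diff R P' Q' \<noteq> {}"
  shows "K0_diff R P Q \<otimes>\<^bsub>K0 R\<^esub> K0_diff R P' Q' = K0_diff R (lmod_sum P P') (lmod_sum Q Q')"
proof -
  interpret comm_monoid "lmod_classes R"
    by (rule lmod_classes_comm_monoid) (rule fg_projectiveD(2)[OF P(1)])
  have "K0_diff R (lmod_sum X X') (lmod_sum Y Y') = K0_diff R (lmod_sum P P') (lmod_sum Q Q')"
    if XY: "(X, Y) \<in> K0_diff R P Q" "(X', Y') \<in> K0_diff R P' Q'" for X Y X' Y'
  proof -
    obtain t u where X: "fg_projective R X" "fg_projective R Y" "fg_projective R X'" "fg_projective R Y'"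
      and t: "t \<in> carrier (lmod_classes R)" "u \<in> carrier (lmod_classes R)"
        "lmod_class R X \<otimes>\<^bsub>lmod_classes R\<^esub> lmod_class R Q \<otimes>\<^bsub>lmod_classes R\<^esub> t
          = lmod_class R P \<otimes>\<^bsub>lmod_classes R\<^esub> lmod_class R Y \<otimes>\<^bsub>lmod_classes R\<^esub> t"
        "lmod_class R X' \<otimes>\<^bsub>lmod_classes R\<^esub> lmod_class R Q' \<otimes>\<^bsub>lmod_classes R\<^esub> u
          = lmod_class R P' \<otimes>\<^bsub>lmod_classes R\<^esub> lmod_class R Y' \<otimes>\<^bsub>lmod_classes R\<^esub> u"
      using XY unfolding K0_diff_iff[OF P] K0_diff_iff[OF P'] by blast
    have c: "lmod_class R X \<in> carrier (lmod_classes R)" "lmod_class R Y \<in> carrier (lmod_classes R)"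
      "lmod_class R X' \<in> carrier (lmod_classes R)" "lmod_class R Y' \<in> carrier (lmod_classes R)"
      "lmod_class R P \<in> carrier (lmod_classes R)" "lmod_class R Q \<in> carrier (lmod_classes R)"
      "lmod_class R P' \<in> carrier (lmod_classes R)" "lmod_class R Q' \<in> carrier (lmod_classes R)"
      using X P P' by (simp_all add: lmod_class_closed)
    show ?thesis
    proof (rule K0_diff_cong[symmetric, where t = "t \<otimes>\<^bsub>lmod_classes R\<^esub> u"])
      show "lmod_class R (lmod_sum X X') \<otimes>\<^bsub>lmod_classes R\<^esub> lmod_class R (lmod_sum Q Q') \<otimes>\<^bsub>lmod_classes R\<^esub> (t \<otimes>\<^bsub>lmod_classes R\<^esub> u)
        = lmod_class R (lmod_sum P P') \<otimes>\<^bsub>lmod_classes R\<^esub> lmod_class R (lmod_sum Y Y') \<otimes>\<^bsub>lmod_classes R\<^esub> (t \<otimes>\<^bsub>lmod_classes R\<^esub> u)"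
        using c t by (simp add: lmod_class_mult[symmetric] X P P' interchange)
    qed (use X P P' t in \<open>auto simp: fg_projective_sum\<close>)
  qed
  then have "(case z of (P, Q) \<Rightarrow> \<Union>(Pa, Qa)\<in>K0_diff R P' Q'. K0_diff R (lmod_sum P Pa) (lmod_sum Q Qa))
      = K0_diff R (lmod_sum P P') (lmod_sum Q Q')" if "z \<in> K0_diff R P Q" for z
    using that assms(6) by (auto 0 3)
  then show ?thesis using assms(5) unfolding K0_def by auto
qed

section \<open>Traces of projective modules\<close>

text \<open>A left linear map between free modules is right multiplication by a matrix, whose rows
  are the images of the unit rows. The induction runs over a bound \<open>l\<close> beyond which the
  entries of \<open>x\<close> vanish.\<close>

lemma (in ring) hom_row_expansion:
  assumes h: "h \<in> lmod_hom R (free_lmod R n) (free_lmod R m)" and x: "x \<in> carrier (free_lmod R n)"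
  shows "h x k = (\<Oplus>j\<in>{..<n}. x j \<otimes> h (unit_row R j) k)"
proof -
  note hD = lmod_homD[OF h]
  have row: "y j \<in> carrier R" if "y \<in> carrier (free_lmod R l)" for y l j
    using that by (auto simp: free_lmod_def split: if_splits)
  have u: "unit_row R j \<in> carrier (free_lmod R n)" if "j < n" for j
    using that by (auto simp: free_lmod_def unit_row_def)
  have hc: "h y k \<in> carrier R" if "y \<in> carrier (free_lmod R n)" for y
    by (rule row[OF hD(1)[OF that]])
  have "h x k = (\<Oplus>j\<in>{..<l}. x j \<otimes> h (unit_row R j) k)"
    if "l \<le> n" "x \<in> carrier (free_lmod R n)" "\<And>i. i \<ge> l \<Longrightarrow> x i = \<zero>" for l x
    using that
  proof (induction l arbitrary: x)
    case 0
    then have "x = (\<lambda>i. \<zero>)" by auto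
    then have "x = \<zero>\<^bsub>free_lmod R n\<^esub>" by (simp add: free_lmod_def)
    then have "h x = \<zero>\<^bsub>free_lmod R m\<^esub>"
      using lmod_hom_zero[OF left_module_free left_module_free h] ring_axioms by simp
    then show ?case by (simp add: free_lmod_def)
  next
    case (Suc l)
    then have l: "l < n" by simp
    \<comment> \<open>The last entry that may be nonzero is split off, so that the induction
      hypothesis applies to the rest.\<close>
    define y where "y = x(l := \<zero>)"
    have y: "y \<in> carrier (free_lmod R n)" using Suc.prems unfolding y_def by (auto simp: free_lmod_def)
    have xl: "x l \<in> carrier R" using row Suc.prems by blast
    have xe: "x = y \<oplus>\<^bsub>free_lmod R n\<^esub> x l \<odot>\<^bsub>free_lmod R n\<^esub> unit_row R l"
      using row[OF Suc.prems(2)] by (auto simp: free_lmod_def y_def unit_row_def fun_eq_iff)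
    have sc: "x l \<odot>\<^bsub>free_lmod R n\<^esub> unit_row R l \<in> carrier (free_lmod R n)"
      using u[OF l] xl by (auto simp: free_lmod_def unit_row_def)
    have "h x k = h y k \<oplus> x l \<otimes> h (unit_row R l) k"
      by (subst xe, simp add: hD(2)[OF y sc] hD(3)[OF xl u[OF l]]) (simp add: free_lmod_def)
    also have "h y k = (\<Oplus>j\<in>{..<l}. y j \<otimes> h (unit_row R j) k)"
    proof (rule Suc.IH[OF _ y])
      show "y i = \<zero>" if "i \<ge> l" for i
        using that Suc.prems(3)[of i] by (cases "i = l") (simp_all add: y_def)
    qed (use l in simp)
    also have "\<dots> = (\<Oplus>j\<in>{..<l}. x j \<otimes> h (unit_row R j) k)"
      using l u hc row[OF Suc.prems(2)] by (intro finsum_cong') (auto simp: y_def intro!: m_closed hc u)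
    finally show ?case
      using l xl hc[OF u] row[OF Suc.prems(2)]
      by (simp add: lessThan_Suc) (subst a_comm, auto intro!: finsum_closed)
  qed
  from this[OF order_refl x] x show ?thesis by (auto simp: free_lmod_def)
qed

locale traced_algebra = cstar_algebra A for A :: "'a cstar_alg" (structure) +
  fixes \<phi> :: "'a \<Rightarrow> complex"
  assumes tracial: "tracial_state A \<phi>"
begin

lemma trace_add: "x \<in> carrier A \<Longrightarrow> y \<in> carrier A \<Longrightarrow> \<phi> (x \<oplus> y) = \<phi> x + \<phi> y"
  and trace_scale: "x \<in> carrier A \<Longrightarrow> \<phi> (c \<odot> x) = c * \<phi> x"
  and trace_one: "\<phi> \<one> = 1"
  and trace_mult_commute: "x \<in> carrier A \<Longrightarrow> y \<in> carrier A \<Longrightarrow> \<phi> (x \<otimes> y) = \<phi> (y \<otimes> x)"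
  and trace_nonneg: "x \<in> carrier A \<Longrightarrow> \<phi> (adj A x \<otimes> x) \<in> \<real> \<and> 0 \<le> Re (\<phi> (adj A x \<otimes> x))"
  using tracial unfolding tracial_state_def by blast+

lemma trace_zero: "\<phi> \<zero> = 0"
  using trace_add[of \<zero> \<zero>] by simp

lemma trace_diff: "x \<in> carrier A \<Longrightarrow> y \<in> carrier A \<Longrightarrow> \<phi> (x \<ominus> y) = \<phi> x - \<phi> y"
  using trace_add[of x "\<ominus> y"] trace_scale[of y "- 1"] by (simp add: scale_minus_one a_minus_def)

lemma trace_finsum:
  assumes "finite S" "\<And>j. j \<in> S \<Longrightarrow> F j \<in> carrier A"
  shows "\<phi> (\<Oplus>j\<in>S. F j) = (\<Sum>j\<in>S. \<phi> (F j))"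
  using assms
proof induction
  case empty
  then show ?case by (simp add: trace_zero)
next
  case (insert y S)
  then show ?case by (simp add: trace_add Pi_def)
qed

text \<open>\<open>Tr(FG) = Tr(GF)\<close> for rectangular matrices: over a noncommutative ring this
  holds after applying \<open>\<phi>\<close>, which commutes the factors of each entrywise
  product.\<close>

lemma trace_matrix_commute:
  assumes f: "f \<in> lmod_hom A (free_lmod A n) (free_lmod A m)"
    and g: "g \<in> lmod_hom A (free_lmod A m) (free_lmod A n)"
  shows "(\<Sum>j<n. \<phi> (g (f (unit_row A j)) j)) = (\<Sum>k<m. \<phi> (f (g (unit_row A k)) k))"
proof -
  have row: "y j \<in> carrier A" if "y \<in> carrier (free_lmod A l)" for y l j
    using that by (auto simp: free_lmod_def split: if_splits)
  have u: "unit_row A j \<in> carrier (free_lmod A l)" if "j < l" for j l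
    using that by (auto simp: free_lmod_def unit_row_def)
  note fD = lmod_homD(1)[OF f, OF u] and gD = lmod_homD(1)[OF g, OF u]
  have "(\<Sum>j<n. \<phi> (g (f (unit_row A j)) j)) = (\<Sum>j<n. \<Sum>k<m. \<phi> (f (unit_row A j) k \<otimes> g (unit_row A k) j))"
  proof (intro sum.cong refl)
    fix j assume j: "j \<in> {..<n}"
    have "\<phi> (g (f (unit_row A j)) j) = \<phi> (\<Oplus>k\<in>{..<m}. f (unit_row A j) k \<otimes> g (unit_row A k) j)"
      using hom_row_expansion[OF g fD] j by simp
    also have "\<dots> = (\<Sum>k<m. \<phi> (f (unit_row A j) k \<otimes> g (unit_row A k) j))"
      using row[OF fD] row[OF gD] j by (intro trace_finsum) auto
    finally show "\<phi> (g (f (unit_row A j)) j) = (\<Sum>k<m. \<phi> (f (unit_row A j) k \<otimes> g (unit_row A k) j))" .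
  qed
  also have "\<dots> = (\<Sum>k<m. \<Sum>j<n. \<phi> (g (unit_row A k) j \<otimes> f (unit_row A j) k))"
    by (subst sum.swap) (use row[OF fD] row[OF gD] in \<open>auto intro!: sum.cong trace_mult_commute\<close>)
  also have "\<dots> = (\<Sum>k<m. \<phi> (f (g (unit_row A k)) k))"
  proof (intro sum.cong refl)
    fix k assume k: "k \<in> {..<m}"
    have "\<phi> (f (g (unit_row A k)) k) = \<phi> (\<Oplus>j\<in>{..<n}. g (unit_row A k) j \<otimes> f (unit_row A j) k)"
      using hom_row_expansion[OF f gD] k by simp
    also have "\<dots> = (\<Sum>j<n. \<phi> (g (unit_row A k) j \<otimes> f (unit_row A j) k))"
      using row[OF fD] row[OF gD] k by (intro trace_finsum) auto
    finally show "(\<Sum>j<n. \<phi> (g (unit_row A k) j \<otimes> f (unit_row A j) k)) = \<phi> (f (g (unit_row A k)) k)" by simp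
  qed
  finally show ?thesis .
qed

text \<open>With \<open>F = i' f r\<close> and \<open>G = i g r'\<close> the two idempotents are the
  composites of \<open>F\<close> and \<open>G\<close> in either order. Independence of the
  presentation and invariance under isomorphism follow at once.\<close>

lemma trace_presentation_unique:
  assumes M: "summand_maps A M n i r" and N: "summand_maps A N m i' r'"
    and iso: "lmod_iso A M N" and mod: "left_module A M"
  shows "(\<Sum>j<n. \<phi> (i (r (unit_row A j)) j)) = (\<Sum>k<m. \<phi> (i' (r' (unit_row A k)) k))"
proof -
  obtain f g where fg: "f \<in> lmod_hom A M N" "g \<in> lmod_hom A N M"
    "\<And>x. x \<in> carrier M \<Longrightarrow> g (f x) = x" "\<And>y. y \<in> carrier N \<Longrightarrow> f (g y) = y"
    using lmod_isoE[OF iso mod] by metis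
  have h: "i \<in> lmod_hom A M (free_lmod A n)" "r \<in> lmod_hom A (free_lmod A n) M" "\<And>x. x \<in> carrier M \<Longrightarrow> r (i x) = x"
    "i' \<in> lmod_hom A N (free_lmod A m)" "r' \<in> lmod_hom A (free_lmod A m) N" "\<And>x. x \<in> carrier N \<Longrightarrow> r' (i' x) = x"
    using M N unfolding summand_maps_def by auto
  have u: "unit_row A j \<in> carrier (free_lmod A l)" if "j < l" for j l
    using that by (auto simp: free_lmod_def unit_row_def)
  have F: "(\<lambda>x. i' (f (r x))) \<in> lmod_hom A (free_lmod A n) (free_lmod A m)"
    and G: "(\<lambda>x. i (g (r' x))) \<in> lmod_hom A (free_lmod A m) (free_lmod A n)"
    using lmod_hom_comp[OF lmod_hom_comp[OF h(2) fg(1)] h(4)]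
      lmod_hom_comp[OF lmod_hom_comp[OF h(5) fg(2)] h(1)] by auto
  have "i (g (r' (i' (f (r x))))) = i (r x)" if "x \<in> carrier (free_lmod A n)" for x
    using that fg(3) h(6) lmod_homD(1)[OF h(2)] lmod_homD(1)[OF fg(1)] by simp
  moreover have "i' (f (r (i (g (r' x))))) = i' (r' x)" if "x \<in> carrier (free_lmod A m)" for x
    using that fg(4) h(3) lmod_homD(1)[OF h(5)] lmod_homD(1)[OF fg(2)] by simp
  ultimately show ?thesis using trace_matrix_commute[OF F G] u by simp
qed

lemma module_trace_eq:
  assumes "left_module A M" "summand_maps A M n i r"
  shows "module_trace A \<phi> M = Re (\<Sum>j<n. \<phi> (i (r (unit_row A j)) j))"
  unfolding module_trace_def
proof (rule the_equality)
  show "\<forall>m i' r'. summand_maps A M m i' r' \<longrightarrow>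
      Re (\<Sum>j<n. \<phi> (i (r (unit_row A j)) j)) = Re (\<Sum>j<m. \<phi> (i' (r' (unit_row A j)) j))"
    by (intro allI impI arg_cong[where f = Re] trace_presentation_unique[OF assms(2) _ lmod_iso_refl assms(1)])
  fix t assume "\<forall>n i r. summand_maps A M n i r \<longrightarrow> t = Re (\<Sum>j<n. \<phi> (i (r (unit_row A j)) j))"
  then show "t = Re (\<Sum>j<n. \<phi> (i (r (unit_row A j)) j))" using assms(2) by (elim allE impE)
qed

lemma module_trace_iso:
  assumes "fg_projective A M" "fg_projective A N" "lmod_iso A M N"
  shows "module_trace A \<phi> M = module_trace A \<phi> N"
proof -
  obtain m i r n j s where M: "left_module A M" "summand_maps A M m i r"
    and N: "left_module A N" "summand_maps A N n j s"
    using assms(1,2) unfolding fg_projective_def by blast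
  show ?thesis
    unfolding module_trace_eq[OF M] module_trace_eq[OF N]
    using trace_presentation_unique[OF M(2) N(2) assms(3) M(1)] by simp
qed

lemma module_trace_free: "module_trace A \<phi> (free_lmod A n) = real n"
  using module_trace_eq[OF left_module_free summand_maps_free, of n] ring_axioms
  by (simp add: unit_row_def trace_one)

lemma module_trace_sum:
  assumes "fg_projective A M" "fg_projective A N"
  shows "module_trace A \<phi> (lmod_sum M N) = module_trace A \<phi> M + module_trace A \<phi> N"
proof -
  obtain m i r n j s where M: "left_module A M" "summand_maps A M m i r"
    and N: "left_module A N" "summand_maps A N n j s"
    using assms unfolding fg_projective_def by blast
  define I where "I = (\<lambda>(x, y) k. if k < m then i x k else j y (k - m))"
  define S where "S = (\<lambda>z. (r (\<lambda>k. if k < m then z k else \<zero>), s (\<lambda>k. z (m + k))))"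
  have s: "summand_maps A (lmod_sum M N) (m + n) I S"
    unfolding I_def S_def by (rule summand_maps_sum[OF ring_axioms M(2) N(2)])
  have "(\<Sum>k<m + n. \<phi> (I (S (unit_row A k)) k))
      = (\<Sum>k<m. \<phi> (I (S (unit_row A k)) k)) + (\<Sum>k<n. \<phi> (I (S (unit_row A (m + k))) (m + k)))"
    by (induction n) simp_all
  moreover have "(\<lambda>l. if l < m then unit_row A k l else \<zero>) = unit_row A k" if "k < m" for k
    using that by (auto simp: unit_row_def)
  moreover have "(\<lambda>l. unit_row A (m + k) (m + l)) = unit_row A k" for k
    by (auto simp: unit_row_def)
  ultimately have "(\<Sum>k<m + n. \<phi> (I (S (unit_row A k)) k))
      = (\<Sum>k<m. \<phi> (i (r (unit_row A k)) k)) + (\<Sum>k<n. \<phi> (j (s (unit_row A k)) k))"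
    by (simp add: I_def S_def)
  then show ?thesis
    unfolding module_trace_eq[OF left_module_sum[OF M(1) N(1)] s] module_trace_eq[OF M] module_trace_eq[OF N]
    by simp
qed

text \<open>The stabilising summand \<open>T\<close> cancels because traces are real
  numbers.\<close>

lemma K0_diff_trace:
  assumes "fg_projective A P" "fg_projective A Q" "(P', Q') \<in> K0_diff A P Q"
  shows "module_trace A \<phi> P' - module_trace A \<phi> Q' = module_trace A \<phi> P - module_trace A \<phi> Q"
proof -
  obtain T :: "('a, nat \<Rightarrow> 'a) module" where h: "fg_projective A P'" "fg_projective A Q'" "fg_projective A T"
    "lmod_iso A (lmod_sum (lmod_sum P' Q) T) (lmod_sum (lmod_sum P Q') T)"
    using assms(3) unfolding K0_diff_def by blast
  have "module_trace A \<phi> (lmod_sum (lmod_sum P' Q) T) = module_trace A \<phi> (lmod_sum (lmod_sum P Q') T)"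
    using h assms(1,2) by (intro module_trace_iso fg_projective_sum)
  then show ?thesis using h assms by (simp add: module_trace_sum fg_projective_sum)
qed

lemma K0_carrierE:
  assumes "X \<in> carrier (K0 A)"
  obtains P Q :: "('a, nat \<Rightarrow> 'a) module"
  where "fg_projective A P" "fg_projective A Q" "X = K0_diff A P Q" "(P, Q) \<in> X"
  using assms K0_diff_self[OF ring_axioms] unfolding K0_def by auto

lemma K0_induced_eq:
  assumes "fg_projective A P" "fg_projective A Q"
  shows "K0_induced A \<phi> (K0_diff A P Q) = module_trace A \<phi> P - module_trace A \<phi> Q"
proof -
  \<comment> \<open>Uniqueness in the definite description requires the class to have a
    member.\<close>
  obtain P' Q' where PQ: "(P', Q') \<in> K0_diff A P Q"
    using K0_carrierE[OF K0_diff_carrier[OF assms]] by metis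
  show ?thesis
    unfolding K0_induced_def
  proof (rule the_equality)
    show "\<forall>(P', Q')\<in>K0_diff A P Q. module_trace A \<phi> P - module_trace A \<phi> Q
        = module_trace A \<phi> P' - module_trace A \<phi> Q'"
      using K0_diff_trace[OF assms] by auto
    show "t = module_trace A \<phi> P - module_trace A \<phi> Q"
      if "\<forall>(P, Q)\<in>K0_diff A P Q. t = module_trace A \<phi> P - module_trace A \<phi> Q" for t
      using bspec[OF that PQ] K0_diff_trace[OF assms PQ] by simp
  qed
qed

lemma K0_mult_diff:
  assumes X: "X \<in> carrier (K0 A)" and Y: "Y \<in> carrier (K0 A)"
  shows "X \<otimes>\<^bsub>K0 A\<^esub> Y \<in> carrier (K0 A)"
    and "K0_induced A \<phi> (X \<otimes>\<^bsub>K0 A\<^esub> Y) = K0_induced A \<phi> X + K0_induced A \<phi> Y"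
proof -
  obtain P Q :: "('a, nat \<Rightarrow> 'a) module" where P: "fg_projective A P" "fg_projective A Q" "X = K0_diff A P Q" "(P, Q) \<in> X"
    by (rule K0_carrierE[OF X])
  obtain P' Q' :: "('a, nat \<Rightarrow> 'a) module" where P': "fg_projective A P'" "fg_projective A Q'" "Y = K0_diff A P' Q'" "(P', Q') \<in> Y"
    by (rule K0_carrierE[OF Y])
  have e: "X \<otimes>\<^bsub>K0 A\<^esub> Y = K0_diff A (lmod_sum P P') (lmod_sum Q Q')"
    using K0_mult[OF P(1,2) P'(1,2)] P(3,4) P'(3,4) by blast
  show "X \<otimes>\<^bsub>K0 A\<^esub> Y \<in> carrier (K0 A)"
    unfolding e using P P' by (intro K0_diff_carrier fg_projective_sum)
  show "K0_induced A \<phi> (X \<otimes>\<^bsub>K0 A\<^esub> Y) = K0_induced A \<phi> X + K0_induced A \<phi> Y"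
    unfolding e unfolding P(3) P'(3) using P(1,2) P'(1,2)
    by (simp add: K0_induced_eq fg_projective_sum module_trace_sum)
qed

end

section \<open>Modules given by idempotents\<close>

text \<open>The left ideal \<open>R e\<close>. For idempotent \<open>e\<close> it is the image of
  right multiplication by \<open>e\<close>, hence a direct summand of \<open>R\<close>.\<close>

definition corner_module :: "('r, 'c) ring_scheme \<Rightarrow> 'r \<Rightarrow> ('r, 'r) module" where
  "corner_module R e = \<lparr>carrier = {x \<in> carrier R. x \<otimes>\<^bsub>R\<^esub> e = x}, monoid.mult = undefined, one = undefined,
     zero = \<zero>\<^bsub>R\<^esub>, add = add R, module.smult = monoid.mult R\<rparr>"

context ring
begin

lemma left_module_corner:
  assumes "e \<in> carrier R"
  shows "left_module R (corner_module R e)"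
proof (rule left_moduleI)
  show "ring R" by (rule ring_axioms)
  fix x assume x: "x \<in> carrier (corner_module R e)"
  show "\<exists>y\<in>carrier (corner_module R e). y \<oplus>\<^bsub>corner_module R e\<^esub> x = \<zero>\<^bsub>corner_module R e\<^esub>"
    using x assms by (intro bexI[of _ "\<ominus> x"]) (auto simp: corner_module_def l_neg l_minus)
qed (use assms in \<open>auto simp: corner_module_def a_ac l_distr r_distr m_assoc\<close>)

lemma summand_maps_corner:
  assumes e: "e \<in> carrier R" "e \<otimes> e = e"
  shows "summand_maps R (corner_module R e) 1 (\<lambda>x k. if k = 0 then x else \<zero>) (\<lambda>y. y 0 \<otimes> e)"
  unfolding summand_maps_def
  using e by (auto intro!: lmod_homI simp: corner_module_def free_lmod_def fun_eq_iff m_assoc l_distr)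

lemma fg_projective_corner: "e \<in> carrier R \<Longrightarrow> e \<otimes> e = e \<Longrightarrow> fg_projective R (corner_module R e)"
  unfolding fg_projective_def using left_module_corner summand_maps_corner by blast

end

lemma (in traced_algebra) module_trace_corner:
  assumes e: "e \<in> carrier A" "e \<otimes> e = e"
  shows "module_trace A \<phi> (corner_module A e) = Re (\<phi> e)"
  using module_trace_eq[OF left_module_corner summand_maps_corner, OF e(1) e] e by (simp add: unit_row_def)

section \<open>Algebras with exactly one tracial state\<close>

locale uniquely_traced_algebra = traced_algebra +
  assumes trace_unique: "\<And>\<psi> x. tracial_state A \<psi> \<Longrightarrow> x \<in> carrier A \<Longrightarrow> \<psi> x = \<phi> x"
begin

text \<open>A module trace evaluates the state only at diagonal entries of a matrix over
  \<open>A\<close>, so two states that agree on the carrier induce the same map, whatever values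
  they take outside it.\<close>

lemma K0_trace_eq_induced:
  assumes "X \<in> carrier (K0 A)"
  shows "K0_trace A X = K0_induced A \<phi> X"
proof -
  obtain P Q :: "('a, nat \<Rightarrow> 'a) module" where P: "fg_projective A P" "fg_projective A Q" "X = K0_diff A P Q" "(P, Q) \<in> X"
    by (rule K0_carrierE[OF assms])
  have "K0_induced A \<psi> X = K0_induced A \<phi> X" if \<psi>: "tracial_state A \<psi>" for \<psi>
  proof -
    interpret psi: traced_algebra A \<psi> by unfold_locales (fact \<psi>)
    have "module_trace A \<psi> M = module_trace A \<phi> M" if M: "fg_projective A M" for M :: "('a, nat \<Rightarrow> 'a) module"
    proof -
      obtain n i r where s: "left_module A M" "summand_maps A M n i r"
        using M unfolding fg_projective_def by blast
      have "i (r (unit_row A j)) j \<in> carrier A" if "j < n" for j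
      proof -
        have "unit_row A j \<in> carrier (free_lmod A n)"
          using that by (auto simp: free_lmod_def unit_row_def)
        then have "i (r (unit_row A j)) \<in> carrier (free_lmod A n)"
          using s(2) unfolding summand_maps_def by (blast dest: lmod_homD(1))
        then show ?thesis using that by (auto simp: free_lmod_def)
      qed
      then show ?thesis
        unfolding module_trace_eq[OF s] psi.module_trace_eq[OF s]
        by (intro arg_cong[where f = Re] sum.cong) (auto intro: trace_unique[OF \<psi>])
    qed
    then show ?thesis using P by (simp add: K0_induced_eq psi.K0_induced_eq)
  qed
  note eq = this
  show ?thesis
    unfolding K0_trace_def
  proof (rule the_equality)
    show "\<forall>\<psi>. tracial_state A \<psi> \<longrightarrow> K0_induced A \<phi> X = K0_induced A \<psi> X"
      by (intro allI impI eq[symmetric])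
    show "t = K0_induced A \<phi> X" if "\<forall>\<psi>. tracial_state A \<psi> \<longrightarrow> t = K0_induced A \<psi> X" for t
      by (rule mp[OF spec[OF that] tracial])
  qed
qed

lemma K0_trace_diff:
  assumes "fg_projective A P" "fg_projective A Q"
  shows "K0_trace A (K0_diff A P Q) = module_trace A \<phi> P - module_trace A \<phi> Q"
  using K0_trace_eq_induced[OF K0_diff_carrier[OF assms]] K0_induced_eq[OF assms] by simp

lemma K0_class_carrier: "fg_projective A P \<Longrightarrow> K0_class A P \<in> carrier (K0 A)"
  unfolding K0_class_def by (rule K0_diff_carrier[OF _ fg_projective_free[OF ring_axioms]])

lemma K0_trace_class: "fg_projective A P \<Longrightarrow> K0_trace A (K0_class A P) = module_trace A \<phi> P"
  unfolding K0_class_def using fg_projective_free[OF ring_axioms]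
  by (subst K0_trace_diff) (simp_all add: module_trace_free)

lemma K0_trace_mult:
  "X \<in> carrier (K0 A) \<Longrightarrow> Y \<in> carrier (K0 A) \<Longrightarrow> K0_trace A (X \<otimes>\<^bsub>K0 A\<^esub> Y) = K0_trace A X + K0_trace A Y"
  by (simp add: K0_trace_eq_induced K0_mult_diff)

end

section \<open>Tracial states are bounded\<close>

context cstar_algebra
begin

lemma eq_of_norm_diff_0: "x \<in> carrier A \<Longrightarrow> y \<in> carrier A \<Longrightarrow> cnorm A (x \<ominus> y) = 0 \<Longrightarrow> x = y"
  by (metis minus_closed norm_eq_0 a_minus_def a_inv_closed minus_equality minus_minus)

lemma norm_lim_unique:
  assumes "norm_lim A X x" "norm_lim A X y"
  shows "x = y"
proof -
  note c = norm_limD(1,2)[OF assms(1)] norm_limD(2)[OF assms(2)]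
  have "cnorm A (x \<ominus> y) \<le> cnorm A (X n \<ominus> x) + cnorm A (X n \<ominus> y)" for n
    using norm_triangle_sub[of x "X n" y] norm_minus_commute[of x "X n"] c by simp
  moreover have "(\<lambda>n. cnorm A (X n \<ominus> x) + cnorm A (X n \<ominus> y)) \<longlonglongrightarrow> 0 + 0"
    by (intro tendsto_add norm_limD(3) assms)
  ultimately have "cnorm A (x \<ominus> y) \<le> 0"
    by (intro LIMSEQ_le_const[of _ 0]) auto
  then have "cnorm A (x \<ominus> y) = 0" using norm_nonneg[of "x \<ominus> y"] c by auto
  then show ?thesis using c by (intro eq_of_norm_diff_0)
qed

lemma scale_diff:
  assumes "x \<in> carrier A" "y \<in> carrier A"
  shows "c \<odot> (x \<ominus> y) = c \<odot> x \<ominus> c \<odot> y"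
proof -
  have "c \<odot> (\<ominus> y) = \<ominus> (c \<odot> y)"
    using assms by (simp add: scale_minus_one[symmetric] scale_closed scale_scale[symmetric] mult.commute)
  then show ?thesis using assms by (simp add: a_minus_def scale_add_right)
qed

lemma geometric_limit:
  assumes X: "\<And>n. X n \<in> carrier A" and d: "\<And>n. cnorm A (X (Suc n) \<ominus> X n) \<le> (1 / 2) ^ n"
  shows "\<exists>x. norm_lim A X x"
proof -
  \<comment> \<open>The bound is the exact partial sum of the geometric series, which is what lets
    the induction close.\<close>
  have step: "cnorm A (X (n + k) \<ominus> X n) \<le> 2 * (1 / 2) ^ n - 2 * (1 / 2) ^ (n + k)" for n k
  proof (induction k)
    case 0
    then show ?case using norm_eq_0[of \<zero>] X by (simp add: a_minus_def r_neg)
  next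
    case (Suc k)
    have "cnorm A (X (n + Suc k) \<ominus> X n) \<le> cnorm A (X (Suc (n + k)) \<ominus> X (n + k)) + cnorm A (X (n + k) \<ominus> X n)"
      using norm_triangle_sub[of "X (Suc (n + k))" "X (n + k)" "X n"] X by simp
    also have "\<dots> \<le> (1 / 2) ^ (n + k) + (2 * (1 / 2) ^ n - 2 * (1 / 2) ^ (n + k))"
      by (intro add_mono d Suc)
    finally show ?case by simp
  qed
  have bound: "cnorm A (X m \<ominus> X n) \<le> 2 * (1 / 2) ^ min m n" for m n
  proof -
    have le: "cnorm A (X (n + k) \<ominus> X n) \<le> 2 * (1 / 2) ^ n" for n k
      using step[of n k] by (smt (verit) zero_le_power divide_nonneg_nonneg)
    show ?thesis
    proof (cases "n \<le> m")
      case True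
      then show ?thesis using le[of n "m - n"] by simp
    next
      case False
      then show ?thesis using le[of m "n - m"] norm_minus_commute[OF X X, of m n] by simp
    qed
  qed
  have "\<forall>\<epsilon>>0. \<exists>K. \<forall>m\<ge>K. \<forall>n\<ge>K. cnorm A (X m \<ominus> X n) < \<epsilon>"
  proof (intro allI impI)
    fix \<epsilon> :: real assume "\<epsilon> > 0"
    then obtain K where K: "(1 / 2) ^ K < \<epsilon> / 2" using real_arch_pow_inv[of "\<epsilon> / 2" "1 / 2"] by auto
    have "cnorm A (X m \<ominus> X n) < \<epsilon>" if "m \<ge> K" "n \<ge> K" for m n
    proof -
      have "(1 / 2 :: real) ^ min m n \<le> (1 / 2) ^ K" using that by (intro power_decreasing) auto
      then show ?thesis using bound[of m n] K by linarith
    qed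
    then show "\<exists>K. \<forall>m\<ge>K. \<forall>n\<ge>K. cnorm A (X m \<ominus> X n) < \<epsilon>" by blast
  qed
  then have "\<exists>x\<in>carrier A. (\<lambda>n. cnorm A (X n \<ominus> x)) \<longlonglongrightarrow> 0"
    by (rule complete[where X = X, OF X])
  then show ?thesis using X unfolding norm_lim_def by auto
qed

text \<open>\<open>1 - x = (1 - y)\<^sup>2\<close> for the fixed point \<open>y\<close> of the contraction \<open>y \<mapsto> (x + y\<^sup>2) / 2\<close>.\<close>

lemma sqrt_one_minus:
  assumes x: "x \<in> carrier A" "adj A x = x" "cnorm A x \<le> 3 / 4"
  shows "\<exists>b\<in>carrier A. adj A b = b \<and> b \<otimes> b = \<one> \<ominus> x"
proof -
  define Y where "Y = rec_nat \<zero> (\<lambda>_ y. (1 / 2) \<odot> (x \<oplus> y \<otimes> y))"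
  have Y0: "Y 0 = \<zero>" and YS: "Y (Suc n) = (1 / 2) \<odot> (x \<oplus> Y n \<otimes> Y n)" for n by (simp_all add: Y_def)
  have Yc: "Y n \<in> carrier A" for n
    by (induction n) (use x in \<open>auto simp: Y0 YS scale_closed\<close>)
  have Yadj: "adj A (Y n) = Y n" for n
    by (induction n) (use x Yc in \<open>auto simp: Y0 YS adj_zero adj_scale adj_add adj_mult\<close>)
  \<comment> \<open>The ball of radius \<open>1 / 2\<close> is preserved because
    \<open>(3/4 + 1/4) / 2 = 1/2\<close>; this is the origin of the bound \<open>3 / 4\<close> on
    \<open>x\<close>.\<close>
  have Ynorm: "cnorm A (Y n) \<le> 1 / 2" for n
  proof (induction n)
    case 0
    then show ?case using norm_eq_0[of \<zero>] by (simp add: Y0)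
  next
    case (Suc n)
    have "cnorm A (x \<oplus> Y n \<otimes> Y n) \<le> cnorm A x + cnorm A (Y n) * cnorm A (Y n)"
      using norm_add[of x "Y n \<otimes> Y n"] norm_mult[of "Y n" "Y n"] x Yc by fastforce
    also have "\<dots> \<le> 3 / 4 + (1 / 2) * (1 / 2)"
      using Suc x norm_nonneg[OF Yc] by (intro add_mono mult_mono) auto
    finally show ?case using x Yc by (simp add: YS norm_scale norm_divide)
  qed
  \<comment> \<open>On that ball \<open>a a - b b = (a - b) a + b (a - b)\<close> has norm at most
    that of \<open>a - b\<close>, and the factor \<open>1 / 2\<close> in front makes the map a
    contraction.\<close>
  have "cnorm A (Y (Suc n) \<ominus> Y n) \<le> (1 / 2) ^ n" for n
  proof (induction n)
    case 0
    then show ?case using Ynorm[of 1] Yc[of 1] by (simp add: Y0 a_minus_def)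
  next
    case (Suc n)
    let ?a = "Y (Suc n)" and ?b = "Y n"
    have c: "?a \<in> carrier A" "?b \<in> carrier A" "x \<in> carrier A" using Yc x by auto
    have "(x \<oplus> ?a \<otimes> ?a) \<ominus> (x \<oplus> ?b \<otimes> ?b) = ?a \<otimes> ?a \<ominus> ?b \<otimes> ?b"
      using c by (simp add: a_minus_def minus_add a_ac r_neg2 r_neg1)
    also have "\<dots> = (?a \<ominus> ?b) \<otimes> ?a \<oplus> ?b \<otimes> (?a \<ominus> ?b)"
    proof -
      have "\<ominus> (?b \<otimes> ?a) \<oplus> (?b \<otimes> ?a) = \<zero>" using c by (simp add: l_neg)
      then show ?thesis using c
        by (simp add: a_minus_def l_distr r_distr l_minus r_minus a_assoc)
          (simp add: a_assoc[symmetric] l_neg)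
    qed
    finally have "Y (Suc (Suc n)) \<ominus> Y (Suc n) = (1 / 2) \<odot> ((?a \<ominus> ?b) \<otimes> ?a \<oplus> ?b \<otimes> (?a \<ominus> ?b))"
      using c by (subst (2) YS, subst YS, subst scale_diff[symmetric]) simp_all
    then have "cnorm A (Y (Suc (Suc n)) \<ominus> Y (Suc n)) = 1 / 2 * cnorm A ((?a \<ominus> ?b) \<otimes> ?a \<oplus> ?b \<otimes> (?a \<ominus> ?b))"
      using c by (simp add: norm_scale norm_divide)
    also have "cnorm A ((?a \<ominus> ?b) \<otimes> ?a \<oplus> ?b \<otimes> (?a \<ominus> ?b)) \<le> cnorm A ((?a \<ominus> ?b) \<otimes> ?a) + cnorm A (?b \<otimes> (?a \<ominus> ?b))"
      using c by (intro norm_add) auto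
    also have "\<dots> \<le> cnorm A (?a \<ominus> ?b) * cnorm A ?a + cnorm A ?b * cnorm A (?a \<ominus> ?b)"
      using c by (intro add_mono norm_mult) auto
    also have "\<dots> \<le> (1 / 2) ^ n * (1 / 2) + 1 / 2 * (1 / 2) ^ n"
      using c Ynorm Suc norm_nonneg[OF Yc] by (intro add_mono mult_mono norm_nonneg) auto
    finally show ?case by simp
  qed
  then obtain y where y: "norm_lim A Y y" using geometric_limit[where X = Y, OF Yc] by blast
  have yc: "y \<in> carrier A" by (rule norm_limD(2)[OF y])
  have "norm_lim A (\<lambda>n. Y (Suc n)) ((1 / 2) \<odot> (x \<oplus> y \<otimes> y))"
    unfolding YS by (intro norm_lim_scale norm_lim_add norm_lim_mult norm_lim_const y x)
  moreover have "norm_lim A (\<lambda>n. Y (Suc n)) y"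
    using y LIMSEQ_Suc[OF norm_limD(3)[OF y]] unfolding norm_lim_def by simp
  ultimately have fixpoint: "(1 / 2) \<odot> (x \<oplus> y \<otimes> y) = y" by (rule norm_lim_unique)
  have "2 \<odot> ((1 / 2) \<odot> (x \<oplus> y \<otimes> y)) = x \<oplus> y \<otimes> y"
    using x yc by (simp add: scale_scale[symmetric] scale_one)
  moreover have "2 \<odot> y = y \<oplus> y" using scale_add_left[OF yc, of 1 1] yc by (simp add: scale_one)
  ultimately have xy: "x \<oplus> y \<otimes> y = y \<oplus> y" using fixpoint by simp
  have ya: "adj A y = y"
    using norm_lim_unique[OF norm_lim_adj[OF y]] y by (simp add: Yadj)
  show ?thesis
  proof (intro bexI[of _ "\<one> \<ominus> y"] conjI)
    show "adj A (\<one> \<ominus> y) = \<one> \<ominus> y"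
      using adj_scale[OF yc, of "-1"] yc ya
      by (simp add: a_minus_def adj_add adj_one scale_minus_one)
    have "y \<otimes> y = (y \<oplus> y) \<ominus> x" unfolding xy[symmetric] using x yc
      by (simp add: a_minus_def a_ac r_neg1 r_neg2)
    then show "(\<one> \<ominus> y) \<otimes> (\<one> \<ominus> y) = \<one> \<ominus> x"
      using x yc by (simp add: a_minus_def l_distr r_distr l_minus r_minus a_assoc minus_add r_neg1 r_neg2)
  qed (use yc in simp)
qed

end

context traced_algebra
begin

text \<open>With a self-adjoint square root \<open>b\<close> of \<open>1 - y\<close>, positivity at
  \<open>b\<close> says that \<open>1 - \<phi> y\<close> is real and nonnegative.\<close>

lemma trace_selfadjoint:
  assumes y: "y \<in> carrier A" "adj A y = y" "cnorm A y \<le> 3 / 4"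
  shows "\<phi> y \<in> \<real>" "Re (\<phi> y) \<le> 1"
proof -
  obtain b where b: "b \<in> carrier A" "adj A b = b" "b \<otimes> b = \<one> \<ominus> y"
    using sqrt_one_minus[OF y] by blast
  have "\<phi> (adj A b \<otimes> b) = 1 - \<phi> y" using b y by (simp add: trace_diff trace_one)
  then have "1 - \<phi> y \<in> \<real>" "0 \<le> Re (1 - \<phi> y)" using trace_nonneg[OF b(1)] by auto
  then show "\<phi> y \<in> \<real>" "Re (\<phi> y) \<le> 1"
    using Reals_diff[OF Reals_1, of "1 - \<phi> y"] by auto
qed

text \<open>Rescaling \<open>y\<close> to norm \<open>3 / 4\<close> with either sign bounds the real
  number \<open>\<phi> y\<close> from both sides; \<open>4 / 3\<close> is the reciprocal of that
  norm.\<close>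

lemma trace_selfadjoint_bound:
  assumes y: "y \<in> carrier A" "adj A y = y"
  shows "cmod (\<phi> y) \<le> 4 / 3 * cnorm A y"
proof (cases "cnorm A y = 0")
  case True
  then have "y = \<zero>" using norm_eq_0 y by simp
  then show ?thesis using norm_nonneg[of \<zero>] trace_zero by simp
next
  case False
  define c where "c = 3 / (4 * cnorm A y)"
  have pos: "cnorm A y > 0" using False norm_nonneg[OF y(1)] by simp
  have cn: "cnorm A (of_real s \<odot> y) \<le> 3 / 4" if "\<bar>s\<bar> = c" for s
    using y that pos by (simp add: norm_scale c_def)
  have sa: "adj A (of_real s \<odot> y) = of_real s \<odot> y" "of_real s \<odot> y \<in> carrier A" for s
    using y by (simp_all add: adj_scale scale_closed)
  have c: "c > 0" using pos by (simp add: c_def)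
  have 1: "of_real c * \<phi> y \<in> \<real>" "Re (of_real c * \<phi> y) \<le> 1"
    using trace_selfadjoint[OF sa(2) sa(1) cn, of c] c y by (auto simp: trace_scale)
  have 2: "Re (of_real (- c) * \<phi> y) \<le> 1"
    using trace_selfadjoint(2)[OF sa(2) sa(1) cn, of "- c"] c y by (simp add: trace_scale)
  have "cmod (of_real c * \<phi> y) \<le> 1" using 1 2 by (auto simp: in_Reals_norm)
  then have "c * cmod (\<phi> y) \<le> 1" using c by (simp add: Real_Vector_Spaces.norm_mult)
  then show ?thesis using pos by (simp add: c_def field_simps)
qed

text \<open>Real and imaginary parts each contribute \<open>4 / 3\<close>.\<close>

lemma trace_bound:
  assumes x: "x \<in> carrier A"
  shows "cmod (\<phi> x) \<le> 8 / 3 * cnorm A x"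
proof -
  define a where "a = (1 / 2) \<odot> (x \<oplus> adj A x)"
  define b where "b = (1 / (2 * \<i>)) \<odot> (x \<ominus> adj A x)"
  have ac: "adj A x \<in> carrier A" using x by (rule adj_closed)
  have c: "a \<in> carrier A" "b \<in> carrier A" unfolding a_def b_def using x ac by (auto simp: scale_closed)
  have "adj A a = a" unfolding a_def using x ac by (simp add: adj_scale adj_add adj_adj a_comm)
  moreover have "adj A b = b"
  proof -
    have "adj A (x \<ominus> adj A x) = (- 1) \<odot> (x \<ominus> adj A x)"
      using x ac adj_scale[OF ac, of "-1"]
      by (simp add: a_minus_def adj_add scale_minus_one minus_add adj_adj a_comm)
    then show ?thesis unfolding b_def using x ac by (simp add: adj_scale scale_scale[symmetric])
  qed
  moreover have "cnorm A a \<le> cnorm A x" "cnorm A b \<le> cnorm A x"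
    using norm_add[OF x ac] norm_add[OF x a_inv_closed[OF ac]] norm_adj[OF x] norm_minus[OF ac] x ac
    by (simp_all add: a_def b_def norm_scale norm_divide norm_mult a_minus_def)
  ultimately have "cmod (\<phi> a) \<le> 4 / 3 * cnorm A x" "cmod (\<phi> b) \<le> 4 / 3 * cnorm A x"
    using trace_selfadjoint_bound[OF c(1)] trace_selfadjoint_bound[OF c(2)] by auto
  moreover have "\<phi> x = \<phi> a + \<i> * \<phi> b"
    unfolding a_def b_def using x ac by (simp add: trace_scale trace_add trace_diff field_simps)
  ultimately show ?thesis using norm_triangle_ineq[of "\<phi> a" "\<i> * \<phi> b"] by (simp add: Real_Vector_Spaces.norm_mult)
qed

end

text \<open>Linear combinations of the unitaries are dense and tracial states are bounded, so the
  values on the unitaries determine a tracial state.\<close>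

lemma tracial_states_eqI:
  assumes "twisted_group_cstar G \<sigma> A W" "unitary_representation A G \<sigma> W"
    and "tracial_state A \<phi>" "tracial_state A \<psi>"
    and eq: "\<And>g. g \<in> G \<Longrightarrow> \<phi> (W g) = \<psi> (W g)" and x: "x \<in> carrier A"
  shows "\<phi> x = \<psi> x"
proof -
  interpret unitary_representation A G \<sigma> W by fact
  interpret f: traced_algebra A \<phi> by unfold_locales fact
  interpret p: traced_algebra A \<psi> by unfold_locales fact
  have lin: "\<phi> (lincomb A W f) = \<psi> (lincomb A W f)" if f: "f \<in> finsupp G" for f
  proof -
    have w: "f g \<odot>\<^bsub>A\<^esub> W g \<in> carrier A" if "g \<in> {g. f g \<noteq> 0}" for g
      using finsuppD(2)[OF f] that by (simp add: scale_closed W_closed)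
    have "\<phi> (f g \<odot>\<^bsub>A\<^esub> W g) = \<psi> (f g \<odot>\<^bsub>A\<^esub> W g)" if "g \<in> {g. f g \<noteq> 0}" for g
      using finsuppD(2)[OF f] that by (simp add: f.trace_scale p.trace_scale W_closed eq)
    note eqW = this
    have "\<phi> (lincomb A W f) = (\<Sum>g | f g \<noteq> 0. \<phi> (f g \<odot>\<^bsub>A\<^esub> W g))"
      unfolding lincomb_def by (rule f.trace_finsum[OF finsuppD(1)[OF f] w])
    also have "\<dots> = (\<Sum>g | f g \<noteq> 0. \<psi> (f g \<odot>\<^bsub>A\<^esub> W g))"
      by (rule sum.cong[OF refl eqW])
    also have "\<dots> = \<psi> (lincomb A W f)"
      unfolding lincomb_def by (rule p.trace_finsum[OF finsuppD(1)[OF f] w, symmetric])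
    finally show ?thesis .
  qed
  have "cmod (\<phi> x - \<psi> x) \<le> 0 + \<epsilon>" if \<epsilon>: "\<epsilon> > 0" for \<epsilon>
  proof -
    \<comment> \<open>Two applications of \<open>trace_bound\<close> cost the factor
      \<open>16 / 3\<close>, which is below \<open>9\<close>.\<close>
    have "\<epsilon> / 9 > 0" using \<epsilon> by simp
    then obtain f where f: "f \<in> finsupp G" "cnorm A (x \<ominus>\<^bsub>A\<^esub> lincomb A W f) < \<epsilon> / 9"
      using assms(1) x unfolding twisted_group_cstar_def by blast
    let ?d = "x \<ominus>\<^bsub>A\<^esub> lincomb A W f"
    have c: "lincomb A W f \<in> carrier A" by (rule lincomb_closed[OF f(1)])
    have "\<phi> x - \<psi> x = \<phi> ?d - \<psi> ?d" using x c lin[OF f(1)] by (simp add: f.trace_diff p.trace_diff)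
    then have "cmod (\<phi> x - \<psi> x) \<le> cmod (\<phi> ?d) + cmod (\<psi> ?d)" by (simp add: norm_triangle_ineq4)
    also have "\<dots> \<le> 8 / 3 * cnorm A ?d + 8 / 3 * cnorm A ?d"
      using x c by (intro add_mono f.trace_bound p.trace_bound) auto
    finally show ?thesis using f(2) \<epsilon> norm_nonneg[of ?d] x c by simp
  qed
  then have "cmod (\<phi> x - \<psi> x) \<le> 0" by (rule field_le_epsilon)
  then show ?thesis by simp
qed

section \<open>The norm of the regular representation\<close>

text \<open>The substitution \<open>w = y - z\<close> in double sums for convolutions. The outer
  variable \<open>y\<close> ranges over the fixed set \<open>S + T\<close>, which contains the
  translate of \<open>T\<close> by each \<open>z\<close>.\<close>

lemma sum_translate_support:
  fixes t :: "'g::ab_group_add \<Rightarrow> 'b::comm_monoid_add"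
  assumes fin: "finite S" "finite T" and z: "z \<in> S" and t: "\<And>w. w \<notin> T \<Longrightarrow> t w = 0"
  shows "(\<Sum>y\<in>(\<lambda>(y, z). y + z) ` (S \<times> T). t (y - z)) = (\<Sum>w\<in>T. t w)"
proof -
  have "(\<Sum>y\<in>(\<lambda>(y, z). y + z) ` (S \<times> T). t (y - z)) = (\<Sum>y\<in>(+) z ` T. t (y - z))"
  proof (rule sum.mono_neutral_right)
    show "\<forall>y\<in>(\<lambda>(y, z). y + z) ` (S \<times> T) - (+) z ` T. t (y - z) = 0"
    proof
      fix y assume "y \<in> (\<lambda>(y, z). y + z) ` (S \<times> T) - (+) z ` T"
      then have "y - z \<notin> T" using image_eqI[of y "(+) z" "y - z" T] by auto
      then show "t (y - z) = 0" by (rule t)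
    qed
  qed (use fin z in auto)
  also have "\<dots> = (\<Sum>w\<in>T. t w)" by (subst sum.reindex) (auto simp: inj_on_def)
  finally show ?thesis .
qed

text \<open>A bicharacter is in particular a normalised 2-cocycle, and replacing an argument by its
  negative conjugates its value. \<open>Psi\<close> is one, so general cocycles do not have to be
  handled.\<close>

locale bicharacter =
  fixes G :: "'g::ab_group_add set" and \<sigma> :: "'g \<Rightarrow> 'g \<Rightarrow> complex"
  assumes zero_mem: "0 \<in> G" and add_mem: "\<And>g h. g \<in> G \<Longrightarrow> h \<in> G \<Longrightarrow> g + h \<in> G"
    and uminus_mem: "\<And>g. g \<in> G \<Longrightarrow> - g \<in> G"
    and add_left: "\<And>g g' h. g \<in> G \<Longrightarrow> g' \<in> G \<Longrightarrow> h \<in> G \<Longrightarrow> \<sigma> (g + g') h = \<sigma> g h * \<sigma> g' h"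
    and add_right: "\<And>g h h'. g \<in> G \<Longrightarrow> h \<in> G \<Longrightarrow> h' \<in> G \<Longrightarrow> \<sigma> g (h + h') = \<sigma> g h * \<sigma> g h'"
    and unit_modulus: "\<And>g h. g \<in> G \<Longrightarrow> h \<in> G \<Longrightarrow> cmod (\<sigma> g h) = 1"
begin

lemma diff_mem: "g \<in> G \<Longrightarrow> h \<in> G \<Longrightarrow> g - h \<in> G"
  using add_mem[of g "- h"] uminus_mem by simp

lemma nonzero: "g \<in> G \<Longrightarrow> h \<in> G \<Longrightarrow> \<sigma> g h \<noteq> 0"
  using unit_modulus[of g h] by auto

lemma zero_left: "h \<in> G \<Longrightarrow> \<sigma> 0 h = 1"
  using add_left[of 0 0 h] zero_mem nonzero[of 0 h] by simp

lemma zero_right: "g \<in> G \<Longrightarrow> \<sigma> g 0 = 1"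
  using add_right[of g 0 0] zero_mem nonzero[of g 0] by simp

lemma cnj_mult: "g \<in> G \<Longrightarrow> h \<in> G \<Longrightarrow> cnj (\<sigma> g h) * \<sigma> g h = 1" "g \<in> G \<Longrightarrow> h \<in> G \<Longrightarrow> \<sigma> g h * cnj (\<sigma> g h) = 1"
  using unit_modulus[of g h] complex_norm_square[of "\<sigma> g h"] by (simp_all add: mult.commute)

lemma uminus_left: "g \<in> G \<Longrightarrow> h \<in> G \<Longrightarrow> \<sigma> (- g) h = cnj (\<sigma> g h)"
  using add_left[of "- g" g h] uminus_mem zero_left[of h] cnj_mult(1)[of g h] nonzero[of g h]
  by (metis add.left_inverse mult_cancel_right)

lemma uminus_right: "g \<in> G \<Longrightarrow> h \<in> G \<Longrightarrow> \<sigma> g (- h) = cnj (\<sigma> g h)"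
  using add_right[of g "- h" h] uminus_mem zero_right[of g] cnj_mult(1)[of g h] nonzero[of g h]
  by (metis add.left_inverse mult_cancel_right)

abbreviation F :: "('g \<Rightarrow> complex) set" where "F \<equiv> finsupp G"

lemma F_finite: "f \<in> F \<Longrightarrow> finite {x. f x \<noteq> 0}"
  and F_mem: "f \<in> F \<Longrightarrow> f x \<noteq> 0 \<Longrightarrow> x \<in> G"
  unfolding finsupp_def by auto

lemma F_add: "f \<in> F \<Longrightarrow> h \<in> F \<Longrightarrow> (\<lambda>x. f x + h x) \<in> F"
  by (rule finsupp_subsetI[of _ "{x. f x \<noteq> 0} \<union> {x. h x \<noteq> 0}"]) (auto simp: finsupp_def)

lemma F_scale: "f \<in> F \<Longrightarrow> (\<lambda>x. c * f x) \<in> F"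
  by (rule finsupp_subsetI[of _ "{x. f x \<noteq> 0}"]) (auto simp: finsupp_def)

lemma F_zero: "(\<lambda>x. 0) \<in> F"
  by (simp add: finsupp_def)

lemma F_tconv: "f \<in> F \<Longrightarrow> h \<in> F \<Longrightarrow> tconv \<sigma> f h \<in> F"
  using finsupp_tconv(2)[OF add_mem] by blast

lemma F_tstar: "f \<in> F \<Longrightarrow> tstar \<sigma> f \<in> F"
  using finsupp_tstar(2)[OF uminus_mem] by blast

lemma tconv_superset:
  assumes "finite S" "{y. f y \<noteq> 0} \<subseteq> S"
  shows "tconv \<sigma> f h x = (\<Sum>y\<in>S. f y * h (x - y) * \<sigma> y (x - y))"
  unfolding tconv_def using assms by (intro sum.mono_neutral_left) auto

section \<open>The inner product on finitely supported functions\<close>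

text \<open>Conjugate linear in the first argument. The operator norm of the regular representation
  is determined on this dense subspace, so its Hilbert space completion is not constructed.\<close>

definition ip :: "('g \<Rightarrow> complex) \<Rightarrow> ('g \<Rightarrow> complex) \<Rightarrow> complex" where
  "ip f h = (\<Sum>x | f x \<noteq> 0. cnj (f x) * h x)"

definition l2 :: "('g \<Rightarrow> complex) \<Rightarrow> real" where
  "l2 f = L2_set (\<lambda>x. cmod (f x)) {x. f x \<noteq> 0}"

lemma ip_superset:
  assumes "finite S" "{x. f x \<noteq> 0} \<subseteq> S"
  shows "ip f h = (\<Sum>x\<in>S. cnj (f x) * h x)"
  unfolding ip_def using assms by (intro sum.mono_neutral_left) auto

lemma l2_superset:
  assumes "finite S" "{x. f x \<noteq> 0} \<subseteq> S"
  shows "l2 f = L2_set (\<lambda>x. cmod (f x)) S"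
  unfolding l2_def L2_set_def using assms by (intro arg_cong[where f = sqrt] sum.mono_neutral_left) auto

lemma l2_nonneg: "0 \<le> l2 f"
  unfolding l2_def by (rule L2_set_nonneg)

lemma ip_self: "ip f f = of_real ((l2 f)\<^sup>2)"
proof -
  have "ip f f = (\<Sum>x | f x \<noteq> 0. of_real ((cmod (f x))\<^sup>2))"
    unfolding ip_def by (intro sum.cong refl) (simp only: complex_norm_square mult.commute)
  then show ?thesis unfolding l2_def L2_set_def by (simp add: sum_nonneg)
qed

lemma ip_Cauchy_Schwarz:
  assumes "f \<in> F" "h \<in> F"
  shows "cmod (ip f h) \<le> l2 f * l2 h"
proof -
  let ?S = "{x. f x \<noteq> 0} \<union> {x. h x \<noteq> 0}"
  have S: "finite ?S" using assms F_finite by simp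
  have "cmod (ip f h) \<le> (\<Sum>x\<in>?S. cmod (cnj (f x) * h x))"
    by (subst ip_superset[OF S]) (auto intro: norm_sum)
  also have "\<dots> = (\<Sum>x\<in>?S. \<bar>cmod (f x)\<bar> * \<bar>cmod (h x)\<bar>)" by (simp add: norm_mult)
  also have "\<dots> \<le> L2_set (\<lambda>x. cmod (f x)) ?S * L2_set (\<lambda>x. cmod (h x)) ?S" by (rule L2_set_mult_ineq)
  also have "\<dots> = l2 f * l2 h" using l2_superset[OF S, of f] l2_superset[OF S, of h] by simp
  finally show ?thesis .
qed

lemma l2_triangle:
  assumes "f \<in> F" "h \<in> F"
  shows "l2 (\<lambda>x. f x + h x) \<le> l2 f + l2 h"
proof -
  let ?S = "{x. f x \<noteq> 0} \<union> {x. h x \<noteq> 0}"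
  have S: "finite ?S" using assms F_finite by simp
  have "l2 (\<lambda>x. f x + h x) = L2_set (\<lambda>x. cmod (f x + h x)) ?S" by (rule l2_superset[OF S]) auto
  also have "\<dots> \<le> L2_set (\<lambda>x. cmod (f x) + cmod (h x)) ?S" by (intro L2_set_mono norm_triangle_ineq) auto
  also have "\<dots> \<le> L2_set (\<lambda>x. cmod (f x)) ?S + L2_set (\<lambda>x. cmod (h x)) ?S" by (rule L2_set_triangle_ineq)
  also have "\<dots> = l2 f + l2 h" using l2_superset[OF S, of f] l2_superset[OF S, of h] by simp
  finally show ?thesis .
qed

lemma l2_scale:
  assumes "f \<in> F"
  shows "l2 (\<lambda>x. c * f x) = cmod c * l2 f"
proof -
  have S: "finite {x. f x \<noteq> 0}" using F_finite[OF assms] .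
  have "l2 (\<lambda>x. c * f x) = L2_set (\<lambda>x. cmod c * cmod (f x)) {x. f x \<noteq> 0}"
    by (subst l2_superset[OF S]) (auto simp: norm_mult)
  then show ?thesis by (simp add: l2_def L2_set_right_distrib)
qed

lemma l2_zero: "l2 (\<lambda>x. 0) = 0"
  by (simp add: l2_def)

lemma l2_eq_0: "f \<in> F \<Longrightarrow> l2 f = 0 \<Longrightarrow> f = (\<lambda>x. 0)"
  unfolding l2_def using F_finite by (auto simp: L2_set_eq_0_iff fun_eq_iff)

lemma l2_ge: "f \<in> F \<Longrightarrow> cmod (f x) \<le> l2 f"
  using member_le_L2_set[OF F_finite, of f x "\<lambda>x. cmod (f x)"] l2_nonneg[of f]
  by (cases "f x = 0") (auto simp: l2_def)

lemma l2_sum: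
  assumes "finite S" "\<And>y. y \<in> S \<Longrightarrow> k y \<in> F"
  shows "(\<lambda>x. \<Sum>y\<in>S. k y x) \<in> F \<and> l2 (\<lambda>x. \<Sum>y\<in>S. k y x) \<le> (\<Sum>y\<in>S. l2 (k y))"
  using assms
proof induction
  case empty
  then show ?case by (simp add: F_zero l2_zero)
next
  case (insert y S)
  then have IH: "(\<lambda>x. \<Sum>y\<in>S. k y x) \<in> F" "l2 (\<lambda>x. \<Sum>y\<in>S. k y x) \<le> (\<Sum>y\<in>S. l2 (k y))" "k y \<in> F" by auto
  have "l2 (\<lambda>x. k y x + (\<Sum>y\<in>S. k y x)) \<le> l2 (k y) + l2 (\<lambda>x. \<Sum>y\<in>S. k y x)"
    by (rule l2_triangle[OF IH(3,1)])
  then show ?case using insert.hyps IH F_add[OF IH(3,1)] by simp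
qed

text \<open>The function is the image of \<open>h\<close> under the regular representation at
  \<open>y\<close>: a translation combined with a multiplication by numbers of modulus one.\<close>

lemma l2_translate:
  assumes y: "y \<in> G" and h: "h \<in> F"
  shows "(\<lambda>x. h (x - y) * \<sigma> y (x - y)) \<in> F" "l2 (\<lambda>x. h (x - y) * \<sigma> y (x - y)) = l2 h"
proof -
  let ?k = "\<lambda>x. h (x - y) * \<sigma> y (x - y)" and ?S = "{x. h x \<noteq> 0}"
  have S: "finite ((+) y ` ?S)" "{x. ?k x \<noteq> 0} \<subseteq> (+) y ` ?S" "(+) y ` ?S \<subseteq> G"
    using F_finite[OF h] F_mem[OF h] add_mem[OF y] by (auto intro!: image_eqI[of _ _ "_ - y"])
  show "?k \<in> F" by (rule finsupp_subsetI[OF S(2,1,3)])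
  have "(\<Sum>x\<in>(+) y ` ?S. (cmod (?k x))\<^sup>2) = (\<Sum>x\<in>?S. (cmod (?k (y + x)))\<^sup>2)"
    by (subst sum.reindex) (auto simp: inj_on_def)
  also have "\<dots> = (\<Sum>x\<in>?S. (cmod (h x))\<^sup>2)"
    using F_mem[OF h] y by (intro sum.cong) (auto simp: norm_mult unit_modulus)
  finally show "l2 ?k = l2 h" by (subst l2_superset[OF S(1,2)]) (simp add: l2_def L2_set_def)
qed

text \<open>Left convolution by \<open>f\<close> is a finite combination of isometries. The bound
  ensures that the supremum in \<open>reg_norm\<close> is finite.\<close>

lemma l2_tconv_le:
  assumes f: "f \<in> F" and h: "h \<in> F"
  shows "l2 (tconv \<sigma> f h) \<le> (\<Sum>y | f y \<noteq> 0. cmod (f y)) * l2 h"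
proof -
  let ?T = "\<lambda>y x. f y * (h (x - y) * \<sigma> y (x - y))"
  have T: "?T y \<in> F" "l2 (?T y) = cmod (f y) * l2 h" if "y \<in> {y. f y \<noteq> 0}" for y
    using l2_translate[OF F_mem[OF f] h, of y] that by (auto simp: F_scale l2_scale)
  have "tconv \<sigma> f h = (\<lambda>x. \<Sum>y | f y \<noteq> 0. ?T y x)" unfolding tconv_def by (simp add: mult.assoc)
  then have "l2 (tconv \<sigma> f h) \<le> (\<Sum>y | f y \<noteq> 0. l2 (?T y))"
    using l2_sum[OF F_finite[OF f], of ?T] T(1) by auto
  also have "\<dots> = (\<Sum>y | f y \<noteq> 0. cmod (f y) * l2 h)" by (intro sum.cong T(2)) auto
  finally show ?thesis by (simp add: sum_distrib_right)
qed

lemma tconv_assoc: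
  assumes f: "f \<in> F" and g: "g \<in> F" and h: "h \<in> F"
  shows "tconv \<sigma> (tconv \<sigma> f g) h = tconv \<sigma> f (tconv \<sigma> g h)"
proof
  fix x
  let ?S = "{z. f z \<noteq> 0}" and ?T = "{w. g w \<noteq> 0}"
  let ?U = "(\<lambda>(y, z). y + z) ` (?S \<times> ?T)"
  have fin: "finite ?S" "finite ?T" "finite ?U" using F_finite f g by auto
  \<comment> \<open>The summand in the variables \<open>z\<close> and \<open>w = y - z\<close> that
    both bracketings have in common.\<close>
  define t where "t = (\<lambda>z w. f z * \<sigma> z (x - z) * (g w * h (x - z - w) * \<sigma> w (x - z - w)))"
  have t: "f z * g (y - z) * \<sigma> z (y - z) * h (x - y) * \<sigma> y (x - y) = t z (y - z)" for y z
  proof (cases "f z = 0 \<or> g (y - z) = 0 \<or> h (x - y) = 0")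
    case True
    then show ?thesis by (auto simp: t_def)
  next
    case False
    then have m: "z \<in> G" "y - z \<in> G" "x - y \<in> G" using F_mem f g h by auto
    have "\<sigma> y (x - y) = \<sigma> z (x - y) * \<sigma> (y - z) (x - y)" using add_left[OF m] by simp
    moreover have "\<sigma> z (x - z) = \<sigma> z (y - z) * \<sigma> z (x - y)" using add_right[OF m] by simp
    ultimately show ?thesis by (simp add: t_def algebra_simps)
  qed
  have "tconv \<sigma> (tconv \<sigma> f g) h x = (\<Sum>y\<in>?U. tconv \<sigma> f g y * h (x - y) * \<sigma> y (x - y))"
    by (rule tconv_superset[OF fin(3) finsupp_tconv(1)[OF add_mem f g]])
  also have "\<dots> = (\<Sum>y\<in>?U. \<Sum>z\<in>?S. t z (y - z))"
    unfolding tconv_def[of \<sigma> f g] by (simp add: sum_distrib_right t)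
  also have "\<dots> = (\<Sum>z\<in>?S. \<Sum>y\<in>?U. t z (y - z))" by (rule sum.swap)
  also have "\<dots> = (\<Sum>z\<in>?S. \<Sum>w\<in>?T. t z w)"
  proof (rule sum.cong[OF refl])
    fix z assume z: "z \<in> ?S"
    show "(\<Sum>y\<in>?U. t z (y - z)) = (\<Sum>w\<in>?T. t z w)"
      by (rule sum_translate_support[OF fin(1,2) z]) (simp add: t_def)
  qed
  also have "\<dots> = tconv \<sigma> f (tconv \<sigma> g h) x"
    unfolding tconv_def t_def by (simp add: sum_distrib_left sum_distrib_right mult_ac)
  finally show "tconv \<sigma> (tconv \<sigma> f g) h x = tconv \<sigma> f (tconv \<sigma> g h) x" .
qed

lemma tstar_tstar:
  assumes "f \<in> F"
  shows "tstar \<sigma> (tstar \<sigma> f) = f"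
proof
  fix x show "tstar \<sigma> (tstar \<sigma> f) x = f x"
    using F_mem[OF assms, of x] uminus_mem[of x]
    by (cases "f x = 0") (auto simp: tstar_def uminus_left uminus_right cnj_mult)
qed

text \<open>\<open>tstar\<close> gives the Hilbert space adjoint of left convolution. The factors
  that \<open>tstar\<close> introduces cancel against those of the bicharacter at
  \<open>z + y\<close>.\<close>

lemma ip_tconv:
  assumes f: "f \<in> F" and h: "h \<in> F" and k: "k \<in> F"
  shows "ip (tconv \<sigma> f h) k = ip h (tconv \<sigma> (tstar \<sigma> f) k)"
proof -
  let ?S = "{z. f z \<noteq> 0}" and ?T = "{w. h w \<noteq> 0}"
  let ?U = "(\<lambda>(y, z). y + z) ` (?S \<times> ?T)"
  have fin: "finite ?S" "finite ?T" "finite ?U" using F_finite f h by auto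
  define t where "t = (\<lambda>y z. cnj (f y) * cnj (h z) * cnj (\<sigma> y z) * k (y + z))"
  have "ip (tconv \<sigma> f h) k = (\<Sum>x\<in>?U. cnj (tconv \<sigma> f h x) * k x)"
    by (rule ip_superset[OF fin(3) finsupp_tconv(1)[OF add_mem f h]])
  also have "\<dots> = (\<Sum>x\<in>?U. \<Sum>y\<in>?S. t y (x - y))"
    unfolding tconv_def t_def by (simp add: sum_distrib_right)
  also have "\<dots> = (\<Sum>y\<in>?S. \<Sum>x\<in>?U. t y (x - y))" by (rule sum.swap)
  also have "\<dots> = (\<Sum>y\<in>?S. \<Sum>z\<in>?T. t y z)"
  proof (rule sum.cong[OF refl])
    fix y assume y: "y \<in> ?S"
    show "(\<Sum>x\<in>?U. t y (x - y)) = (\<Sum>z\<in>?T. t y z)"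
      by (rule sum_translate_support[OF fin(1,2) y]) (simp add: t_def)
  qed
  also have "\<dots> = (\<Sum>z\<in>?T. \<Sum>y\<in>?S. t y z)" by (rule sum.swap)
  also have "\<dots> = (\<Sum>z\<in>?T. cnj (h z) * tconv \<sigma> (tstar \<sigma> f) k z)"
  proof (rule sum.cong[OF refl])
    fix z assume z: "z \<in> ?T"
    have "tconv \<sigma> (tstar \<sigma> f) k z = (\<Sum>w\<in>uminus ` ?S. tstar \<sigma> f w * k (z - w) * \<sigma> w (z - w))"
      by (rule tconv_superset) (use fin finsupp_tstar(1)[OF uminus_mem f] in auto)
    also have "\<dots> = (\<Sum>y\<in>?S. tstar \<sigma> f (- y) * k (z + y) * \<sigma> (- y) (z + y))"
      by (subst sum.reindex) (auto simp: inj_on_def)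
    also have "\<dots> = (\<Sum>y\<in>?S. cnj (f y) * cnj (\<sigma> y z) * k (y + z))"
    proof (rule sum.cong[OF refl])
      fix y assume y: "y \<in> ?S"
      have m: "y \<in> G" "z \<in> G" using y z F_mem f h by auto
      have "cnj (\<sigma> y (- y)) * \<sigma> (- y) (z + y) = (\<sigma> y y * cnj (\<sigma> y y)) * cnj (\<sigma> y z)"
        using m add_mem by (simp add: uminus_left uminus_right add_right algebra_simps)
      then have "cnj (\<sigma> y (- y)) * \<sigma> (- y) (z + y) = cnj (\<sigma> y z)" using m by (simp add: cnj_mult)
      then show "tstar \<sigma> f (- y) * k (z + y) * \<sigma> (- y) (z + y) = cnj (f y) * cnj (\<sigma> y z) * k (y + z)"
        by (simp add: tstar_def add.commute mult_ac)
    qed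
    finally show "(\<Sum>y\<in>?S. t y z) = cnj (h z) * tconv \<sigma> (tstar \<sigma> f) k z"
      by (simp add: t_def sum_distrib_left mult_ac)
  qed
  finally show ?thesis by (simp add: ip_def)
qed

section \<open>The operator norm of left convolution\<close>

definition reg_norm :: "('g \<Rightarrow> complex) \<Rightarrow> real" where
  "reg_norm f = Sup {l2 (tconv \<sigma> f h) | h. h \<in> F \<and> l2 h \<le> 1}"

lemma tconv_scale_right: "tconv \<sigma> f (\<lambda>x. c * h x) = (\<lambda>x. c * tconv \<sigma> f h x)"
  unfolding tconv_def by (simp add: sum_distrib_left mult_ac)

lemma tconv_scale_left:
  assumes "f \<in> F"
  shows "tconv \<sigma> (\<lambda>x. c * f x) h = (\<lambda>x. c * tconv \<sigma> f h x)"
proof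
  fix x
  have "tconv \<sigma> (\<lambda>x. c * f x) h x = (\<Sum>y | f y \<noteq> 0. c * f y * h (x - y) * \<sigma> y (x - y))"
    by (rule tconv_superset) (use F_finite[OF assms] in auto)
  then show "tconv \<sigma> (\<lambda>x. c * f x) h x = c * tconv \<sigma> f h x"
    by (simp add: tconv_def sum_distrib_left mult_ac)
qed

lemma tconv_add_left:
  assumes "f \<in> F" "g \<in> F"
  shows "tconv \<sigma> (\<lambda>x. f x + g x) h = (\<lambda>x. tconv \<sigma> f h x + tconv \<sigma> g h x)"
proof
  fix x
  let ?S = "{x. f x \<noteq> 0} \<union> {x. g x \<noteq> 0}"
  have S: "finite ?S" using assms F_finite by simp
  have "tconv \<sigma> (\<lambda>x. f x + g x) h x = (\<Sum>y\<in>?S. (f y + g y) * h (x - y) * \<sigma> y (x - y))"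
    by (rule tconv_superset[OF S]) auto
  then show "tconv \<sigma> (\<lambda>x. f x + g x) h x = tconv \<sigma> f h x + tconv \<sigma> g h x"
    using tconv_superset[OF S, of f h x] tconv_superset[OF S, of g h x]
    by (simp add: ring_distribs sum.distrib)
qed

lemma tconv_zero_right: "tconv \<sigma> f (\<lambda>x. 0) = (\<lambda>x. 0)"
  by (simp add: tconv_def)

lemma reg_norm_leI:
  assumes "\<And>h. h \<in> F \<Longrightarrow> l2 h \<le> 1 \<Longrightarrow> l2 (tconv \<sigma> f h) \<le> c"
  shows "reg_norm f \<le> c"
  unfolding reg_norm_def
proof (rule cSup_least)
  show "{l2 (tconv \<sigma> f h) |h. h \<in> F \<and> l2 h \<le> 1} \<noteq> {}"
    using F_zero l2_zero by (auto intro!: exI[of _ "\<lambda>x. 0"])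
qed (use assms in auto)

lemma reg_norm_ge:
  assumes f: "f \<in> F" and h: "h \<in> F" "l2 h \<le> 1"
  shows "l2 (tconv \<sigma> f h) \<le> reg_norm f"
  unfolding reg_norm_def
proof (rule cSup_upper)
  show "bdd_above {l2 (tconv \<sigma> f h) |h. h \<in> F \<and> l2 h \<le> 1}"
  proof (rule bdd_aboveI)
    fix s assume "s \<in> {l2 (tconv \<sigma> f h) |h. h \<in> F \<and> l2 h \<le> 1}"
    then obtain k where k: "k \<in> F" "l2 k \<le> 1" "s = l2 (tconv \<sigma> f k)" by blast
    have "s \<le> (\<Sum>y | f y \<noteq> 0. cmod (f y)) * l2 k" unfolding k(3) by (rule l2_tconv_le[OF f k(1)])
    also have "\<dots> \<le> (\<Sum>y | f y \<noteq> 0. cmod (f y)) * 1" using k by (intro mult_left_mono sum_nonneg) auto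
    finally show "s \<le> (\<Sum>y | f y \<noteq> 0. cmod (f y))" by simp
  qed
qed (use h in blast)

lemma reg_norm_nonneg: "f \<in> F \<Longrightarrow> 0 \<le> reg_norm f"
  using reg_norm_ge[OF _ F_zero] by (simp add: l2_zero tconv_zero_right)

lemma l2_tconv_reg_norm:
  assumes f: "f \<in> F" and h: "h \<in> F"
  shows "l2 (tconv \<sigma> f h) \<le> reg_norm f * l2 h"
proof (cases "l2 h = 0")
  case True
  then have "h = (\<lambda>x. 0)" using l2_eq_0[OF h] by simp
  then show ?thesis by (simp add: tconv_zero_right l2_zero)
next
  case False
  then have pos: "l2 h > 0" using l2_nonneg[of h] by simp
  define c where "c = complex_of_real (1 / l2 h)"
  have c: "cmod c = 1 / l2 h" unfolding c_def norm_of_real using pos by simp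
  have "l2 (tconv \<sigma> f (\<lambda>x. c * h x)) \<le> reg_norm f"
    by (rule reg_norm_ge[OF f F_scale[OF h]]) (use pos in \<open>simp add: l2_scale[OF h] c\<close>)
  then have "1 / l2 h * l2 (tconv \<sigma> f h) \<le> reg_norm f"
    by (simp add: tconv_scale_right l2_scale F_tconv f h c)
  then show ?thesis using pos by (simp add: field_simps)
qed

lemma reg_norm_mult:
  assumes f: "f \<in> F" and g: "g \<in> F"
  shows "reg_norm (tconv \<sigma> f g) \<le> reg_norm f * reg_norm g"
proof (rule reg_norm_leI)
  fix h assume h: "h \<in> F" "l2 h \<le> 1"
  have "l2 (tconv \<sigma> (tconv \<sigma> f g) h) \<le> reg_norm f * l2 (tconv \<sigma> g h)"
    unfolding tconv_assoc[OF f g h(1)] by (intro l2_tconv_reg_norm f F_tconv g h)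
  also have "\<dots> \<le> reg_norm f * reg_norm g"
    by (intro mult_left_mono reg_norm_ge g h reg_norm_nonneg f)
  finally show "l2 (tconv \<sigma> (tconv \<sigma> f g) h) \<le> reg_norm f * reg_norm g" .
qed

text \<open>The usual argument for operators: the square of the length of \<open>f h\<close> is the
  inner product of \<open>h\<close> with the adjoint of \<open>f\<close> applied to
  \<open>f h\<close>, and Cauchy-Schwarz applies.\<close>

lemma reg_norm_sq_le:
  assumes f: "f \<in> F"
  shows "(reg_norm f)\<^sup>2 \<le> reg_norm (tconv \<sigma> (tstar \<sigma> f) f)"
proof -
  let ?g = "tconv \<sigma> (tstar \<sigma> f) f"
  have g: "?g \<in> F" by (intro F_tconv F_tstar f)
  have "reg_norm f \<le> sqrt (reg_norm ?g)"
  proof (rule reg_norm_leI)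
    fix h assume h: "h \<in> F" "l2 h \<le> 1"
    have "of_real ((l2 (tconv \<sigma> f h))\<^sup>2) = ip h (tconv \<sigma> ?g h)"
      unfolding ip_self[symmetric] ip_tconv[OF f h(1) F_tconv[OF f h(1)]]
      by (simp add: tconv_assoc F_tstar f h)
    then have "(l2 (tconv \<sigma> f h))\<^sup>2 = cmod (ip h (tconv \<sigma> ?g h))"
      by (metis abs_power2 norm_of_real)
    also have "\<dots> \<le> l2 h * l2 (tconv \<sigma> ?g h)" by (intro ip_Cauchy_Schwarz h F_tconv g)
    also have "\<dots> \<le> 1 * reg_norm ?g"
      using h by (intro mult_mono reg_norm_ge g) (auto simp: l2_nonneg)
    finally show "l2 (tconv \<sigma> f h) \<le> sqrt (reg_norm ?g)" by (simp add: real_le_rsqrt)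
  qed
  then show ?thesis using reg_norm_nonneg[OF f] reg_norm_nonneg[OF g]
    by (metis power2_eq_square real_sqrt_pow2 power_mono)
qed

lemma reg_norm_tstar_le:
  assumes f: "f \<in> F"
  shows "reg_norm f \<le> reg_norm (tstar \<sigma> f)"
proof (cases "reg_norm f = 0")
  case True
  then show ?thesis using reg_norm_nonneg[OF F_tstar[OF f]] by simp
next
  case False
  have "reg_norm f * reg_norm f \<le> reg_norm (tstar \<sigma> f) * reg_norm f"
    using reg_norm_sq_le[OF f] reg_norm_mult[OF F_tstar[OF f] f] by (simp add: power2_eq_square)
  then show ?thesis using False reg_norm_nonneg[OF f] by simp
qed

lemma reg_norm_scale:
  assumes f: "f \<in> F"
  shows "reg_norm (\<lambda>x. c * f x) = cmod c * reg_norm f"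
proof -
  have le: "reg_norm (\<lambda>x. c * f x) \<le> cmod c * reg_norm f" if f: "f \<in> F" for c f
  proof (rule reg_norm_leI)
    fix h assume h: "h \<in> F" "l2 h \<le> 1"
    show "l2 (tconv \<sigma> (\<lambda>x. c * f x) h) \<le> cmod c * reg_norm f"
      using reg_norm_ge[OF f h] by (simp add: tconv_scale_left f l2_scale F_tconv h mult_left_mono)
  qed
  show ?thesis
  proof (cases "c = 0")
    case True
    then show ?thesis using le[OF f, of 0] reg_norm_nonneg[OF F_zero] by simp
  next
    case False
    have "reg_norm (\<lambda>x. inverse c * (c * f x)) \<le> cmod (inverse c) * reg_norm (\<lambda>x. c * f x)"
      by (rule le[OF F_scale[OF f]])
    moreover have "(\<lambda>x. inverse c * (c * f x)) = f" using False by auto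
    ultimately have "reg_norm f \<le> inverse (cmod c) * reg_norm (\<lambda>x. c * f x)" by (simp add: norm_inverse)
    then have "cmod c * reg_norm f \<le> reg_norm (\<lambda>x. c * f x)" using False by (simp add: field_simps)
    then show ?thesis using le[OF f, of c] by simp
  qed
qed

text \<open>This makes the operator norm a competitor in the definition of the universal norm, which
  therefore dominates it.\<close>

lemma cstar_seminorm_reg_norm: "cstar_seminorm G \<sigma> reg_norm"
  unfolding cstar_seminorm_def
proof (intro ballI conjI allI)
  fix f assume f: "f \<in> F"
  show "0 \<le> reg_norm f" by (rule reg_norm_nonneg[OF f])
  show "reg_norm (\<lambda>g. c * f g) = cmod c * reg_norm f" for c by (rule reg_norm_scale[OF f])
  have "reg_norm (tstar \<sigma> f) = reg_norm f"
    using reg_norm_tstar_le[OF f] reg_norm_tstar_le[OF F_tstar[OF f]] tstar_tstar[OF f] by simp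
  then show "reg_norm (tconv \<sigma> (tstar \<sigma> f) f) = (reg_norm f)\<^sup>2"
    using reg_norm_sq_le[OF f] reg_norm_mult[OF F_tstar[OF f] f] by (simp add: power2_eq_square)
  fix h assume h: "h \<in> F"
  show "reg_norm (tconv \<sigma> f h) \<le> reg_norm f * reg_norm h" by (rule reg_norm_mult[OF f h])
  show "reg_norm (\<lambda>g. f g + h g) \<le> reg_norm f + reg_norm h"
  proof (rule reg_norm_leI)
    fix k assume k: "k \<in> F" "l2 k \<le> 1"
    have "l2 (tconv \<sigma> (\<lambda>g. f g + h g) k) \<le> l2 (tconv \<sigma> f k) + l2 (tconv \<sigma> h k)"
      unfolding tconv_add_left[OF f h] by (intro l2_triangle F_tconv f h k)
    then show "l2 (tconv \<sigma> (\<lambda>g. f g + h g) k) \<le> reg_norm f + reg_norm h"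
      using reg_norm_ge[OF f k] reg_norm_ge[OF h k] by simp
  qed
qed

text \<open>Convolution with the point mass \<open>u\<close> at \<open>0\<close>, a unit vector,
  returns \<open>f\<close>, and no coefficient exceeds the length of \<open>f\<close>.\<close>

lemma coeff_zero_le_reg_norm:
  assumes f: "f \<in> F"
  shows "cmod (f 0) \<le> reg_norm f"
proof -
  define u where "u = (\<lambda>x::'g. if x = 0 then 1 else 0 :: complex)"
  have su: "{x. u x \<noteq> 0} = {0}" by (auto simp: u_def)
  have u: "u \<in> F" by (rule finsupp_subsetI[of _ "{0}"]) (auto simp: su zero_mem)
  have "l2 u = 1" by (simp add: l2_def su) (simp add: u_def)
  have "tconv \<sigma> f u x = f x" for x
  proof -
    have "tconv \<sigma> f u x = (\<Sum>y | f y \<noteq> 0. if y = x then f x else 0)"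
      unfolding tconv_def using F_mem[OF f] by (intro sum.cong) (auto simp: u_def zero_right)
    then show ?thesis using F_finite[OF f] by (simp add: sum.delta)
  qed
  then have "tconv \<sigma> f u = f" by auto
  then show ?thesis using l2_ge[OF f, of 0] reg_norm_ge[OF f u] \<open>l2 u = 1\<close> by simp
qed

end

section \<open>The canonical trace of a twisted group C*-algebra\<close>

text \<open>Both \<open>\<sigma> y (- y)\<close> and \<open>\<sigma> (- y) y\<close> are the
  conjugate of \<open>\<sigma> y y\<close>. This is the trace property before completion.\<close>

lemma (in bicharacter) tconv_commute_at_zero:
  assumes f: "f \<in> F" and h: "h \<in> F"
  shows "tconv \<sigma> f h 0 = tconv \<sigma> h f 0"
proof -
  let ?U = "{y. f y \<noteq> 0} \<union> uminus ` {y. h y \<noteq> 0}"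
  have fin: "finite ?U" using F_finite f h by auto
  have U: "?U \<subseteq> G" using F_mem f h uminus_mem by auto
  have "tconv \<sigma> f h 0 = (\<Sum>y\<in>?U. f y * h (- y) * \<sigma> y (- y))"
    by (subst tconv_superset[OF fin]) auto
  also have "\<dots> = (\<Sum>y\<in>?U. h (- y) * f (- (- y)) * \<sigma> (- y) (- (- y)))"
    using U by (intro sum.cong) (auto simp: uminus_left uminus_right uminus_mem subset_iff)
  also have "\<dots> = (\<Sum>w\<in>uminus ` ?U. h w * f (- w) * \<sigma> w (- w))"
    by (subst sum.reindex) (auto simp: inj_on_def)
  also have "\<dots> = tconv \<sigma> h f 0"
  proof -
    have "{y. h y \<noteq> 0} \<subseteq> uminus ` ?U" by (auto simp: image_Un image_image)
    then show ?thesis using tconv_superset[of "uminus ` ?U" h f 0] fin by simp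
  qed
  finally show ?thesis .
qed

text \<open>Positivity of the trace before completion.\<close>

lemma (in bicharacter) tconv_tstar_self_at_zero:
  assumes f: "f \<in> F"
  shows "tconv \<sigma> (tstar \<sigma> f) f 0 = of_real ((l2 f)\<^sup>2)"
proof -
  have "tconv \<sigma> (tstar \<sigma> f) f 0 = (\<Sum>w\<in>uminus ` {y. f y \<noteq> 0}. tstar \<sigma> f w * f (- w) * \<sigma> w (- w))"
    by (subst tconv_superset) (use F_finite[OF f] finsupp_tstar(1)[OF uminus_mem f] in auto)
  also have "\<dots> = (\<Sum>y | f y \<noteq> 0. cnj (f y * \<sigma> y (- y)) * f y * \<sigma> (- y) y)"
    by (subst sum.reindex) (auto simp: inj_on_def tstar_def)
  also have "\<dots> = (\<Sum>y | f y \<noteq> 0. cnj (f y) * f y)"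
  proof (rule sum.cong[OF refl])
    fix y assume "y \<in> {y. f y \<noteq> 0}"
    then have "y \<in> G" using F_mem[OF f] by simp
    then show "cnj (f y * \<sigma> y (- y)) * f y * \<sigma> (- y) y = cnj (f y) * f y"
      using cnj_mult(2)[of y y] by (simp add: uminus_left uminus_right mult_ac)
  qed
  also have "\<dots> = of_real ((l2 f)\<^sup>2)" unfolding ip_self[symmetric] ip_def ..
  finally show ?thesis .
qed

locale twisted_algebra = bic: bicharacter G \<sigma>
  for G :: "'g::ab_group_add set" and \<sigma> +
  fixes A :: "'a cstar_alg" (structure) and W :: "'g \<Rightarrow> 'a"
  assumes alg: "twisted_group_cstar G \<sigma> A W"
begin

sublocale unitary_representation A G \<sigma> W
  using alg bic.zero_mem bic.add_mem bic.uminus_mem bic.unit_modulus bic.zero_left[OF bic.zero_mem]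
  unfolding twisted_group_cstar_def unitary_representation_def unitary_representation_axioms_def
  by blast

lemma lincomb_diff:
  assumes "f \<in> finsupp G" "h \<in> finsupp G"
  shows "lincomb A W f \<ominus> lincomb A W h = lincomb A W (\<lambda>x. f x - h x)"
proof -
  have "lincomb A W (\<lambda>x. f x + (- 1) * h x) = lincomb A W f \<oplus> (- 1) \<odot> lincomb A W h"
    using lincomb_add[OF assms(1) bic.F_scale[OF assms(2), of "- 1"]] lincomb_scale[OF assms(2), of "- 1"]
    by simp
  then show ?thesis using scale_minus_one[OF lincomb_closed[OF assms(2)]] by (simp add: a_minus_def)
qed

lemma F_diff: "f \<in> finsupp G \<Longrightarrow> h \<in> finsupp G \<Longrightarrow> (\<lambda>x. f x - h x) \<in> finsupp G"
  using bic.F_add[OF _ bic.F_scale, of f h "- 1"] by simp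

lemma coeff_zero_le_norm:
  assumes "f \<in> finsupp G"
  shows "cmod (f 0) \<le> cnorm A (lincomb A W f)"
  using bic.coeff_zero_le_reg_norm[OF assms] alg bic.cstar_seminorm_reg_norm assms
  unfolding twisted_group_cstar_def by (meson order_trans)

lemma lincomb_single:
  assumes "g \<in> G"
  shows "(\<lambda>k. if k = g then c else 0) \<in> finsupp G"
    and "lincomb A W (\<lambda>k. if k = g then c else 0) = c \<odot> W g"
proof -
  show "(\<lambda>k. if k = g then c else 0) \<in> finsupp G"
    by (rule finsupp_subsetI[of _ "{g}"]) (use assms in auto)
  have "{k. (if k = g then c else 0) \<noteq> 0} \<subseteq> {g}" by auto
  then show "lincomb A W (\<lambda>k. if k = g then c else 0) = c \<odot> W g"
    using lincomb_superset[of "{g}" "\<lambda>k. if k = g then c else 0" W] W_closed[OF assms]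
    by (simp add: scale_closed)
qed

section \<open>Extension of the coefficient at zero to the completion\<close>

definition approximates :: "(nat \<Rightarrow> 'g \<Rightarrow> complex) \<Rightarrow> 'a \<Rightarrow> bool" where
  "approximates X x \<longleftrightarrow> (\<forall>n. X n \<in> finsupp G) \<and> norm_lim A (\<lambda>n. lincomb A W (X n)) x"

lemma approximates_ex:
  assumes x: "x \<in> carrier A"
  shows "\<exists>X. approximates X x"
proof -
  have "\<exists>f. f \<in> finsupp G \<and> cnorm A (x \<ominus> lincomb A W f) < inverse (real (Suc n))" for n
  proof -
    have "inverse (real (Suc n)) > 0" by simp
    then show ?thesis using alg x unfolding twisted_group_cstar_def by blast
  qed
  then obtain X where X: "\<And>n. X n \<in> finsupp G" "\<And>n. cnorm A (x \<ominus> lincomb A W (X n)) < inverse (real (Suc n))"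
    by metis
  have "norm_lim A (\<lambda>n. lincomb A W (X n)) x"
  proof (rule norm_limI)
    show "cnorm A (lincomb A W (X n) \<ominus> x) \<le> inverse (real (Suc n))" for n
      using X(2)[of n] norm_minus_commute[OF lincomb_closed[OF X(1)] x] by (simp add: less_imp_le)
    show "(\<lambda>n. inverse (real (Suc n))) \<longlonglongrightarrow> 0" by (rule LIMSEQ_inverse_real_of_nat)
  qed (use X x lincomb_closed in auto)
  then show ?thesis using X unfolding approximates_def by blast
qed

text \<open>Extension by continuity. Quantifying over all approximating sequences avoids a choice,
  at the price of showing that the limit does not depend on the sequence.\<close>

definition canonical_trace :: "'a \<Rightarrow> complex" where
  "canonical_trace x = (THE t. \<forall>X. approximates X x \<longrightarrow> (\<lambda>n. X n 0) \<longlonglongrightarrow> t)"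

lemma approximates_coeff_diff:
  assumes "approximates X x" "approximates Y x"
  shows "cmod (X m 0 - Y n 0) \<le> cnorm A (lincomb A W (X m) \<ominus> x) + cnorm A (lincomb A W (Y n) \<ominus> x)"
proof -
  have X: "X m \<in> finsupp G" and Y: "Y n \<in> finsupp G" and x: "x \<in> carrier A"
    using assms norm_limD(2) unfolding approximates_def by auto
  have "cmod (X m 0 - Y n 0) \<le> cnorm A (lincomb A W (X m) \<ominus> lincomb A W (Y n))"
    using coeff_zero_le_norm[OF F_diff[OF X Y]] by (simp add: lincomb_diff X Y)
  also have "\<dots> \<le> cnorm A (lincomb A W (X m) \<ominus> x) + cnorm A (x \<ominus> lincomb A W (Y n))"
    by (intro norm_triangle_sub lincomb_closed X Y x)
  finally show ?thesis using norm_minus_commute[OF x lincomb_closed[OF Y]] by simp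
qed

lemma canonical_trace_limit:
  assumes X: "approximates X x"
  shows "(\<lambda>n. X n 0) \<longlonglongrightarrow> canonical_trace x"
proof -
  have lim: "(\<lambda>n. cnorm A (lincomb A W (Y n) \<ominus> x)) \<longlonglongrightarrow> 0" if "approximates Y x" for Y
    using that norm_limD(3) unfolding approximates_def by blast
  have "Cauchy (\<lambda>n. X n 0)"
  proof (rule metric_CauchyI)
    fix e :: real assume "e > 0"
    then have "\<forall>\<^sub>F n in sequentially. cnorm A (lincomb A W (X n) \<ominus> x) < e / 2"
      using lim[OF X] by (intro order_tendstoD) auto
    then obtain K where K: "\<And>n. n \<ge> K \<Longrightarrow> cnorm A (lincomb A W (X n) \<ominus> x) < e / 2"
      unfolding eventually_sequentially by blast
    have "dist (X m 0) (X n 0) < e" if "m \<ge> K" "n \<ge> K" for m n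
      using approximates_coeff_diff[OF X X, of m n] K[OF that(1)] K[OF that(2)] by (simp add: dist_norm)
    then show "\<exists>M. \<forall>m\<ge>M. \<forall>n\<ge>M. dist (X m 0) (X n 0) < e" by blast
  qed
  then obtain t where t: "(\<lambda>n. X n 0) \<longlonglongrightarrow> t" using Cauchy_convergent convergent_def by blast
  have t': "(\<lambda>n. Y n 0) \<longlonglongrightarrow> t" if Y: "approximates Y x" for Y
  proof -
    have "(\<lambda>n. cnorm A (lincomb A W (Y n) \<ominus> x) + cnorm A (lincomb A W (X n) \<ominus> x)) \<longlonglongrightarrow> 0"
      using tendsto_add[OF lim[OF Y] lim[OF X]] by simp
    then have "(\<lambda>n. Y n 0 - X n 0) \<longlonglongrightarrow> 0"
      by (rule Lim_null_comparison[OF always_eventually[OF allI[OF approximates_coeff_diff[OF Y X]]]])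
    from tendsto_add[OF this t] show ?thesis by simp
  qed
  have "canonical_trace x = t"
    unfolding canonical_trace_def
  proof (rule the_equality)
    show "\<forall>Y. approximates Y x \<longrightarrow> (\<lambda>n. Y n 0) \<longlonglongrightarrow> t" by (intro allI impI t')
    show "u = t" if "\<forall>Y. approximates Y x \<longrightarrow> (\<lambda>n. Y n 0) \<longlonglongrightarrow> u" for u
      by (rule LIMSEQ_unique[OF mp[OF spec[OF that] X] t])
  qed
  then show ?thesis using t by simp
qed

lemma canonical_trace_lincomb: "f \<in> finsupp G \<Longrightarrow> canonical_trace (lincomb A W f) = f 0"
  using canonical_trace_limit[of "\<lambda>n. f" "lincomb A W f"] norm_lim_const[OF lincomb_closed]
  by (simp add: approximates_def LIMSEQ_const_iff)

lemma canonical_trace_W: "g \<in> G \<Longrightarrow> canonical_trace (W g) = (if g = 0 then 1 else 0)"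
  using canonical_trace_lincomb[OF lincomb_single(1), of g 1] lincomb_single(2)[of g 1] W_closed[of g]
  by (simp add: scale_one)

lemma canonical_trace_eqI: "approximates X x \<Longrightarrow> (\<lambda>n. X n 0) \<longlonglongrightarrow> t \<Longrightarrow> canonical_trace x = t"
  using canonical_trace_limit LIMSEQ_unique by blast

text \<open>Each property holds for finitely supported functions, the operations of the algebra are
  continuous, and so the property passes to limits of approximating sequences.\<close>

lemma tracial_canonical_trace: "tracial_state A canonical_trace"
  unfolding tracial_state_def
proof (intro conjI ballI allI)
  show "canonical_trace \<one> = 1" using canonical_trace_W[OF bic.zero_mem] W_zero by simp
  fix x assume x: "x \<in> carrier A"
  obtain X where X: "approximates X x" using approximates_ex[OF x] by blast
  then have XF: "X n \<in> finsupp G" for n unfolding approximates_def by blast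
  have "approximates (\<lambda>n g. c * X n g) (c \<odot> x)" for c
    using X norm_lim_scale[of "\<lambda>n. lincomb A W (X n)" x c]
    by (simp add: approximates_def bic.F_scale lincomb_scale)
  then show "canonical_trace (c \<odot> x) = c * canonical_trace x" for c
    by (rule canonical_trace_eqI) (intro tendsto_mult tendsto_const canonical_trace_limit X)
  have "norm_lim A (\<lambda>n. adj A (lincomb A W (X n)) \<otimes> lincomb A W (X n)) (adj A x \<otimes> x)"
    by (intro norm_lim_mult norm_lim_adj) (use X in \<open>auto simp: approximates_def\<close>)
  then have "approximates (\<lambda>n. tconv \<sigma> (tstar \<sigma> (X n)) (X n)) (adj A x \<otimes> x)"
    using XF by (simp add: approximates_def bic.F_tconv bic.F_tstar lincomb_tconv lincomb_tstar)
  from canonical_trace_limit[OF this]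
  have lim: "(\<lambda>n. complex_of_real ((bic.l2 (X n))\<^sup>2)) \<longlonglongrightarrow> canonical_trace (adj A x \<otimes> x)"
    using XF by (simp add: bic.tconv_tstar_self_at_zero)
  have "Im (canonical_trace (adj A x \<otimes> x)) = 0"
    using tendsto_Im[OF lim] by (simp add: LIMSEQ_const_iff)
  then show "canonical_trace (adj A x \<otimes> x) \<in> \<real>" by (simp add: complex_is_Real_iff)
  have "(\<lambda>n. (bic.l2 (X n))\<^sup>2) \<longlonglongrightarrow> Re (canonical_trace (adj A x \<otimes> x))"
    using tendsto_Re[OF lim] by simp
  then show "0 \<le> Re (canonical_trace (adj A x \<otimes> x))" by (rule LIMSEQ_le_const) auto
  fix y assume y: "y \<in> carrier A"
  obtain Y where Y: "approximates Y y" using approximates_ex[OF y] by blast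
  then have YF: "Y n \<in> finsupp G" for n unfolding approximates_def by blast
  have "approximates (\<lambda>n g. X n g + Y n g) (x \<oplus> y)"
    using X Y norm_lim_add[of "\<lambda>n. lincomb A W (X n)" x "\<lambda>n. lincomb A W (Y n)" y]
    by (simp add: approximates_def bic.F_add lincomb_add)
  then show "canonical_trace (x \<oplus> y) = canonical_trace x + canonical_trace y"
    by (rule canonical_trace_eqI) (intro tendsto_add canonical_trace_limit X Y)
  have xy: "approximates (\<lambda>n. tconv \<sigma> (X n) (Y n)) (x \<otimes> y)"
    using X Y norm_lim_mult[of "\<lambda>n. lincomb A W (X n)" x "\<lambda>n. lincomb A W (Y n)" y]
    by (simp add: approximates_def bic.F_tconv lincomb_tconv)
  have yx: "approximates (\<lambda>n. tconv \<sigma> (Y n) (X n)) (y \<otimes> x)"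
    using X Y norm_lim_mult[of "\<lambda>n. lincomb A W (Y n)" y "\<lambda>n. lincomb A W (X n)" x]
    by (simp add: approximates_def bic.F_tconv lincomb_tconv)
  show "canonical_trace (x \<otimes> y) = canonical_trace (y \<otimes> x)"
    by (rule canonical_trace_eqI[OF xy])
      (use canonical_trace_limit[OF yx] bic.tconv_commute_at_zero[OF XF YF] in simp)
qed

section \<open>Uniqueness of the tracial state\<close>

text \<open>The trace property for \<open>W (g - h)\<close> and \<open>W h\<close>: the two products
  are multiples of \<open>W g\<close> whose coefficients are \<open>\<sigma> g h\<close> and
  \<open>\<sigma> h g\<close> up to the common factor \<open>cnj (\<sigma> h h)\<close>.\<close>

lemma tracial_state_W_eq_0:
  assumes \<psi>: "tracial_state A \<psi>" and gh: "g \<in> G" "h \<in> G" "\<sigma> g h \<noteq> \<sigma> h g"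
  shows "\<psi> (W g) = 0"
proof -
  interpret psi: traced_algebra A \<psi> by unfold_locales (fact \<psi>)
  have d: "g - h \<in> G" by (rule bic.diff_mem[OF gh(1,2)])
  have "\<sigma> (g - h) h * \<psi> (W g) = \<sigma> h (g - h) * \<psi> (W g)"
    using psi.trace_mult_commute[OF W_closed[OF d] W_closed[OF gh(2)]] W_closed[OF gh(1)]
    by (simp add: W_mult d gh psi.trace_scale)
  moreover have "\<sigma> (g - h) h = \<sigma> g h * cnj (\<sigma> h h)" "\<sigma> h (g - h) = \<sigma> h g * cnj (\<sigma> h h)"
    using bic.add_left[of g "- h" h] bic.add_right[of h g "- h"] gh
    by (simp_all add: bic.uminus_mem bic.uminus_left bic.uminus_right)
  ultimately show ?thesis using gh(3) bic.nonzero[OF gh(2) gh(2)] by simp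
qed

lemma nondegenerate_uniquely_traced:
  assumes "\<And>g. g \<in> G \<Longrightarrow> g \<noteq> 0 \<Longrightarrow> \<exists>h\<in>G. \<sigma> g h \<noteq> \<sigma> h g"
  shows "uniquely_traced_algebra A canonical_trace"
proof (unfold_locales)
  show "tracial_state A canonical_trace" by (rule tracial_canonical_trace)
  fix \<psi> x assume \<psi>: "tracial_state A \<psi>" and x: "x \<in> carrier A"
  show "\<psi> x = canonical_trace x"
  proof (rule tracial_states_eqI[OF alg unitary_representation_axioms \<psi> tracial_canonical_trace _ x])
    fix g assume g: "g \<in> G"
    show "\<psi> (W g) = canonical_trace (W g)"
    proof (cases "g = 0")
      case True
      then show ?thesis using \<psi> tracial_canonical_trace W_zero unfolding tracial_state_def by simp
    next
      case False
      then show ?thesis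
        using assms[OF g] tracial_state_W_eq_0[OF \<psi> g] canonical_trace_W[OF g] by auto
    qed
  qed
qed

end

section \<open>Continuous functions on the circle\<close>

text \<open>The circle is taken as the quotient of the reals by the integers and its functions as
  periodic functions, so that a rotation is the substitution \<open>t + \<beta>\<close>.\<close>

definition circle_alg :: "(real \<Rightarrow> complex) cstar_alg" where
  "circle_alg = \<lparr>carrier = {f. continuous_on UNIV f \<and> (\<forall>t. f (t + 1) = f t)},
     monoid.mult = (\<lambda>f g t. f t * g t), one = (\<lambda>t. 1), zero = (\<lambda>t. 0), add = (\<lambda>f g t. f t + g t),
     module.smult = (\<lambda>c f t. c * f t), adj = (\<lambda>f t. cnj (f t)), cnorm = (\<lambda>f. SUP t. cmod (f t))\<rparr>"

lemma circle_simps [simp]: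
  "x \<otimes>\<^bsub>circle_alg\<^esub> y = (\<lambda>t. x t * y t)" "\<one>\<^bsub>circle_alg\<^esub> = (\<lambda>t. 1)" "\<zero>\<^bsub>circle_alg\<^esub> = (\<lambda>t. 0)"
  "x \<oplus>\<^bsub>circle_alg\<^esub> y = (\<lambda>t. x t + y t)" "c \<odot>\<^bsub>circle_alg\<^esub> x = (\<lambda>t. c * x t)"
  "adj circle_alg x = (\<lambda>t. cnj (x t))"
  by (simp_all add: circle_alg_def)

lemma circle_carrier: "f \<in> carrier circle_alg \<longleftrightarrow> continuous_on UNIV f \<and> (\<forall>t. f (t + 1) = f t)"
  by (simp add: circle_alg_def)

lemma circle_norm: "cnorm circle_alg f = (SUP t. cmod (f t))"
  by (simp add: circle_alg_def)

lemma periodic_int: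
  fixes f :: "real \<Rightarrow> 'b"
  assumes "\<And>t. f (t + 1) = f t"
  shows "f (t + of_int k) = f t"
proof (induction k rule: int_induct[where k = 0])
  case base then show ?case by simp
next
  case (step1 i) then show ?case using assms[of "t + of_int i"] by (simp add: algebra_simps)
next
  case (step2 i) then show ?case using assms[of "t + of_int (i - 1)"] by (simp add: algebra_simps)
qed

lemma periodic_frac: "(\<And>t. f (t + 1) = f t) \<Longrightarrow> f t = f (frac t)"
  for f :: "real \<Rightarrow> 'b"
  using periodic_int[of f "frac t" "\<lfloor>t\<rfloor>"] by (simp add: frac_def)

lemma circle_bdd:
  assumes "f \<in> carrier circle_alg"
  shows "bdd_above (range (\<lambda>t. cmod (f t)))"
proof -
  have "compact (f ` {0..1})"
    using assms by (intro compact_continuous_image) (auto simp: circle_carrier intro: continuous_on_subset)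
  then obtain c where c: "\<And>t. t \<in> {0..1} \<Longrightarrow> cmod (f t) \<le> c"
    using compact_imp_bounded bounded_iff by (metis imageI)
  have "cmod (f t) \<le> c" for t
    using periodic_frac[of f t] c[of "frac t"] assms frac_lt_1[of t] by (auto simp: circle_carrier)
  then show ?thesis by (intro bdd_aboveI[of _ c]) auto
qed

lemma circle_norm_ge: "f \<in> carrier circle_alg \<Longrightarrow> cmod (f t) \<le> cnorm circle_alg f"
  unfolding circle_norm by (rule cSUP_upper[OF UNIV_I circle_bdd])

lemma circle_norm_le: "(\<And>t. cmod (f t) \<le> c) \<Longrightarrow> cnorm circle_alg f \<le> c"
  unfolding circle_norm by (rule cSUP_least) auto

lemma circle_norm_nonneg: "f \<in> carrier circle_alg \<Longrightarrow> 0 \<le> cnorm circle_alg f"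
  using circle_norm_ge[of f 0] norm_ge_zero order_trans by blast

lemma ring_circle: "ring circle_alg"
proof (rule ringI)
  show "abelian_group circle_alg"
  proof (rule abelian_groupI)
    fix f assume "f \<in> carrier circle_alg"
    then show "\<exists>g\<in>carrier circle_alg. g \<oplus>\<^bsub>circle_alg\<^esub> f = \<zero>\<^bsub>circle_alg\<^esub>"
      by (intro bexI[of _ "\<lambda>t. - f t"]) (auto simp: circle_carrier intro!: continuous_intros)
  qed (auto simp: circle_carrier fun_eq_iff intro!: continuous_intros)
  show "monoid circle_alg"
    by (rule monoidI) (auto simp: circle_carrier fun_eq_iff intro!: continuous_intros)
qed (auto simp: fun_eq_iff algebra_simps)

lemma circle_minus:
  assumes "g \<in> carrier circle_alg"
  shows "f \<ominus>\<^bsub>circle_alg\<^esub> g = (\<lambda>t. f t - g t)"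
proof -
  interpret ring circle_alg by (rule ring_circle)
  have "\<ominus>\<^bsub>circle_alg\<^esub> g = (\<lambda>t. - g t)"
    using assms by (intro minus_equality) (auto simp: circle_carrier intro!: continuous_intros)
  then show ?thesis by (simp add: a_minus_def)
qed

lemma circle_complete:
  assumes X: "\<And>n. X n \<in> carrier circle_alg"
    and C: "\<forall>\<epsilon>>0. \<exists>K. \<forall>m\<ge>K. \<forall>n\<ge>K. cnorm circle_alg (X m \<ominus>\<^bsub>circle_alg\<^esub> X n) < \<epsilon>"
  shows "\<exists>x\<in>carrier circle_alg. (\<lambda>n. cnorm circle_alg (X n \<ominus>\<^bsub>circle_alg\<^esub> x)) \<longlonglongrightarrow> 0"
proof -
  interpret ring circle_alg by (rule ring_circle)
  have "\<exists>K. \<forall>t\<in>UNIV. \<forall>m\<ge>K. \<forall>n\<ge>K. dist (X m t) (X n t) < e" if e: "e > 0" for e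
  proof -
    obtain K where K: "\<And>m n. m \<ge> K \<Longrightarrow> n \<ge> K \<Longrightarrow> cnorm circle_alg (X m \<ominus>\<^bsub>circle_alg\<^esub> X n) < e"
      using C e by blast
    have "dist (X m t) (X n t) < e" if "m \<ge> K" "n \<ge> K" for m n t
      using circle_norm_ge[OF minus_closed[OF X X], of m n t] K[OF that]
      by (simp add: circle_minus[OF X] dist_norm)
    then show ?thesis by blast
  qed
  then obtain x where x: "uniform_limit UNIV X x sequentially"
    using uniformly_convergent_eq_Cauchy[of UNIV X] unfolding uniformly_Cauchy_on_def uniformly_convergent_on_def
    by (metis Cauchy_uniformly_convergent uniformly_Cauchy_on_def uniformly_convergent_on_def)
  have "continuous_on UNIV x"
    by (rule uniform_limit_theorem[OF _ x]) (use X in \<open>auto simp: circle_carrier\<close>)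
  moreover have "x (t + 1) = x t" for t
  proof -
    have "(\<lambda>n. X n (t + 1)) \<longlonglongrightarrow> x (t + 1)" "(\<lambda>n. X n t) \<longlonglongrightarrow> x t"
      using tendsto_uniform_limitI[OF x] by auto
    then show ?thesis using X LIMSEQ_unique by (auto simp: circle_carrier)
  qed
  ultimately have xc: "x \<in> carrier circle_alg" by (simp add: circle_carrier)
  have "(\<lambda>n. cnorm circle_alg (X n \<ominus>\<^bsub>circle_alg\<^esub> x)) \<longlonglongrightarrow> 0"
  proof (rule tendstoI)
    fix e :: real assume e: "e > 0"
    have "\<forall>\<^sub>F n in sequentially. \<forall>t\<in>UNIV. dist (X n t) (x t) < e / 2"
      using x e by (intro uniform_limitD) auto
    then show "\<forall>\<^sub>F n in sequentially. dist (cnorm circle_alg (X n \<ominus>\<^bsub>circle_alg\<^esub> x)) 0 < e"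
    proof eventually_elim
      case (elim n)
      have "cnorm circle_alg (X n \<ominus>\<^bsub>circle_alg\<^esub> x) \<le> e / 2"
        using elim by (intro circle_norm_le) (auto simp: circle_minus[OF xc] dist_norm intro: less_imp_le)
      then show ?case using circle_norm_nonneg[OF minus_closed[OF X xc]] e by simp
    qed
  qed
  then show ?thesis using xc by blast
qed

lemma cstar_circle: "cstar_algebra circle_alg"
proof (intro cstar_algebra.intro cstar_algebra_axioms.intro ring_circle circle_complete circle_norm_nonneg)
  fix f :: "real \<Rightarrow> complex" assume f: "f \<in> carrier circle_alg"
  show "cnorm circle_alg f = 0 \<longleftrightarrow> f = \<zero>\<^bsub>circle_alg\<^esub>"
  proof
    assume "cnorm circle_alg f = 0"
    then show "f = \<zero>\<^bsub>circle_alg\<^esub>" using circle_norm_ge[OF f] by (auto simp: fun_eq_iff)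
  qed (simp add: circle_norm)
  have bs: "bdd_above (range (\<lambda>t. cmod (f t)))" by (rule circle_bdd[OF f])
  show "cnorm circle_alg (c \<odot>\<^bsub>circle_alg\<^esub> f) = cmod c * cnorm circle_alg f" for c
  proof (cases "c = 0")
    case True
    then show ?thesis by (simp add: circle_norm)
  next
    case False
    show ?thesis
    proof (rule antisym)
      show "cnorm circle_alg (c \<odot>\<^bsub>circle_alg\<^esub> f) \<le> cmod c * cnorm circle_alg f"
        by (rule circle_norm_le) (auto simp: norm_mult intro: mult_left_mono circle_norm_ge[OF f])
      have cf: "c \<odot>\<^bsub>circle_alg\<^esub> f \<in> carrier circle_alg"
        using f by (auto simp: circle_carrier intro!: continuous_intros)
      have "cnorm circle_alg f \<le> cnorm circle_alg (c \<odot>\<^bsub>circle_alg\<^esub> f) / cmod c"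
        using circle_norm_ge[OF cf] False by (intro circle_norm_le) (simp add: norm_mult field_simps)
      then show "cmod c * cnorm circle_alg f \<le> cnorm circle_alg (c \<odot>\<^bsub>circle_alg\<^esub> f)"
        using False by (simp add: field_simps)
    qed
  qed
  show "cnorm circle_alg (adj circle_alg f \<otimes>\<^bsub>circle_alg\<^esub> f) = (cnorm circle_alg f)\<^sup>2"
  proof (rule antisym)
    show "cnorm circle_alg (adj circle_alg f \<otimes>\<^bsub>circle_alg\<^esub> f) \<le> (cnorm circle_alg f)\<^sup>2"
      by (rule circle_norm_le)
        (auto simp: norm_mult power2_eq_square intro!: mult_mono circle_norm_ge[OF f] circle_norm_nonneg[OF f])
    have ff: "(\<lambda>t. cnj (f t) * f t) \<in> carrier circle_alg"
      using f by (auto simp: circle_carrier intro!: continuous_intros)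
    have "cnorm circle_alg f \<le> sqrt (cnorm circle_alg (\<lambda>t. cnj (f t) * f t))"
      using circle_norm_ge[OF ff]
      by (intro circle_norm_le real_le_rsqrt) (simp add: norm_mult power2_eq_square)
    then show "(cnorm circle_alg f)\<^sup>2 \<le> cnorm circle_alg (adj circle_alg f \<otimes>\<^bsub>circle_alg\<^esub> f)"
      using power_mono[OF _ circle_norm_nonneg[OF f], of _ 2] circle_norm_nonneg[OF ff] by fastforce
  qed
  fix g :: "real \<Rightarrow> complex" assume g: "g \<in> carrier circle_alg"
  show "cnorm circle_alg (f \<oplus>\<^bsub>circle_alg\<^esub> g) \<le> cnorm circle_alg f + cnorm circle_alg g"
    using circle_norm_ge[OF f] circle_norm_ge[OF g]
    by (intro circle_norm_le) (auto intro: order_trans[OF norm_triangle_ineq] add_mono)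
  show "cnorm circle_alg (f \<otimes>\<^bsub>circle_alg\<^esub> g) \<le> cnorm circle_alg f * cnorm circle_alg g"
    by (rule circle_norm_le)
      (auto simp: norm_mult intro!: mult_mono circle_norm_ge[OF f] circle_norm_ge[OF g] circle_norm_nonneg[OF f])
qed (auto simp: circle_carrier fun_eq_iff algebra_simps intro!: continuous_intros)

section \<open>Trigonometric polynomials and Fourier coefficients\<close>

definition circle_exp :: "int \<Rightarrow> real \<Rightarrow> complex" where
  "circle_exp n = (\<lambda>t. cis (2 * pi * of_int n * t))"

lemma circle_exp_add: "circle_exp m t * circle_exp n t = circle_exp (m + n) t"
  by (simp add: circle_exp_def cis_mult ring_distribs)

lemma circle_exp_closed: "circle_exp n \<in> carrier circle_alg"
proof -
  have "cis (2 * pi * of_int n * (t + 1)) = cis (2 * pi * of_int n * t)" for t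
    using cis_multiple_2pi[of "of_int n"] by (simp add: ring_distribs cis_mult[symmetric] mult_ac)
  then show ?thesis by (auto simp: circle_carrier circle_exp_def intro!: continuous_intros)
qed

interpretation int_bic: bicharacter "UNIV :: int set" "\<lambda>_ _. 1"
  by unfold_locales auto

interpretation circle_rep: unitary_representation circle_alg "UNIV :: int set" "\<lambda>_ _. 1" circle_exp
proof -
  interpret cstar_algebra circle_alg by (rule cstar_circle)
  have "cnj (circle_exp n t) = circle_exp (- n) t" for n t by (simp add: circle_exp_def cis_cnj)
  moreover have "circle_exp 0 t = 1" for t by (simp add: circle_exp_def)
  ultimately have "unitary_family UNIV (\<lambda>_ _. 1) circle_alg circle_exp"
    unfolding unitary_family_def unitary_elt_def
    by (simp add: circle_exp_closed circle_exp_add)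
  then show "unitary_representation circle_alg (UNIV :: int set) (\<lambda>_ _. 1) circle_exp"
    by unfold_locales auto
qed

lemma circle_finsum:
  assumes "finite S" "\<And>j. j \<in> S \<Longrightarrow> H j \<in> carrier circle_alg"
  shows "finsum circle_alg H S = (\<lambda>t. \<Sum>j\<in>S. H j t)"
  using assms by induction (auto simp: Pi_def)

lemma laurent_eq:
  assumes "f \<in> finsupp UNIV"
  shows "lincomb circle_alg circle_exp f = (\<lambda>t. \<Sum>n | f n \<noteq> 0. f n * circle_exp n t)"
  unfolding lincomb_def
  by (subst circle_finsum) (use circle_rep.finsuppD(1)[OF assms] circle_rep.scale_closed[OF circle_exp_closed] in auto)

definition circle_mean :: "(real \<Rightarrow> complex) \<Rightarrow> complex" where
  "circle_mean f = integral {0..1} f"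

lemma circle_integrable: "f \<in> carrier circle_alg \<Longrightarrow> f integrable_on {0..1}"
  by (intro integrable_continuous_real) (auto simp: circle_carrier intro: continuous_on_subset)

lemma circle_mean_diff:
  "f \<in> carrier circle_alg \<Longrightarrow> g \<in> carrier circle_alg \<Longrightarrow> circle_mean (\<lambda>t. f t - g t) = circle_mean f - circle_mean g"
  unfolding circle_mean_def by (intro Henstock_Kurzweil_Integration.integral_diff circle_integrable)

lemma circle_mean_bound:
  assumes "f \<in> carrier circle_alg"
  shows "cmod (circle_mean f) \<le> cnorm circle_alg f"
proof -
  have "norm (integral {0..1} f) \<le> integral {0..1::real} (\<lambda>t. cnorm circle_alg f)"
    by (rule integral_norm_bound_integral[OF circle_integrable[OF assms]]) (auto intro: circle_norm_ge[OF assms])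
  then show ?thesis by (simp add: circle_mean_def)
qed

lemma circle_mean_exp: "circle_mean (circle_exp n) = (if n = 0 then 1 else 0)"
proof (cases "n = 0")
  case True
  then show ?thesis by (simp add: circle_mean_def circle_exp_def)
next
  case False
  define c where "c = 2 * pi * of_int n"
  have c: "c \<noteq> 0" using False by (simp add: c_def)
  have "((\<lambda>t. cis (c * t) / (\<i> * c)) has_vector_derivative cis (c * t)) (at t within {0..1})" for t
  proof -
    have "((\<lambda>t. cis (c * t) / (\<i> * c)) has_vector_derivative ((c *\<^sub>R (\<i> * cis (c * t))) / (\<i> * c))) (at t within {0..1})"
      unfolding has_vector_derivative_def
      by (rule derivative_eq_intros refl)+ (use c in \<open>auto simp: fun_eq_iff scaleR_conv_of_real algebra_simps\<close>)
    then show ?thesis using c by (simp add: scaleR_conv_of_real)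
  qed
  then have "((\<lambda>t. cis (c * t)) has_integral (cis (c * 1) / (\<i> * c) - cis (c * 0) / (\<i> * c))) {0..1}"
    by (intro fundamental_theorem_of_calculus) auto
  moreover have "cis (c * 1) = 1" using cis_multiple_2pi[of "of_int n"] by (simp add: c_def)
  ultimately have "((\<lambda>t. cis (c * t)) has_integral 0) {0..1}" by simp
  then show ?thesis using False by (simp add: circle_mean_def circle_exp_def c_def integral_unique)
qed

text \<open>Orthogonality of the exponentials: the \<open>k\<close>-th Fourier coefficient of a
  Laurent polynomial is its \<open>k\<close>-th coefficient.\<close>

lemma circle_mean_laurent:
  assumes f: "f \<in> finsupp UNIV"
  shows "circle_mean (\<lambda>t. lincomb circle_alg circle_exp f t * circle_exp (- k) t) = f k"
proof -
  let ?S = "{n. f n \<noteq> 0}"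
  have S: "finite ?S" using circle_rep.finsuppD(1)[OF f] .
  have "circle_mean (\<lambda>t. lincomb circle_alg circle_exp f t * circle_exp (- k) t)
      = circle_mean (\<lambda>t. \<Sum>n\<in>?S. f n * circle_exp (n - k) t)"
    by (simp add: laurent_eq[OF f] sum_distrib_right mult.assoc circle_exp_add)
  also have "\<dots> = (\<Sum>n\<in>?S. f n * circle_mean (circle_exp (n - k)))"
    unfolding circle_mean_def using S circle_integrable[OF circle_exp_closed]
    by (subst integral_sum) (auto intro!: integrable_on_mult_right)
  also have "\<dots> = (\<Sum>n\<in>?S. if n = k then f k else 0)"
    by (intro sum.cong) (auto simp: circle_mean_exp)
  also have "\<dots> = f k" using S by (simp add: sum.delta)
  finally show ?thesis .
qed

lemma laurent_coeff_le:
  assumes "f \<in> finsupp UNIV"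
  shows "cmod (f k) \<le> cnorm circle_alg (lincomb circle_alg circle_exp f)"
proof -
  let ?P = "lincomb circle_alg circle_exp f"
  have P: "?P \<in> carrier circle_alg" by (rule circle_rep.lincomb_closed[OF assms])
  have "?P \<otimes>\<^bsub>circle_alg\<^esub> circle_exp (- k) \<in> carrier circle_alg"
    by (intro circle_rep.m_closed P circle_exp_closed)
  then have "cmod (f k) \<le> cnorm circle_alg (?P \<otimes>\<^bsub>circle_alg\<^esub> circle_exp (- k))"
    using circle_mean_bound[of "?P \<otimes>\<^bsub>circle_alg\<^esub> circle_exp (- k)"] circle_mean_laurent[OF assms, of k] by simp
  also have "\<dots> \<le> cnorm circle_alg ?P"
    using circle_norm_ge[OF P] by (intro circle_norm_le) (simp add: norm_mult circle_exp_def)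
  finally show ?thesis .
qed

section \<open>Density of Laurent polynomials\<close>

lemma periodic_cis_eq:
  fixes f :: "real \<Rightarrow> 'b"
  assumes "\<And>t. f (t + 1) = f t" and "cis (2 * pi * s) = cis (2 * pi * t)"
  shows "f s = f t"
proof -
  have "sin (2 * pi * s) = sin (2 * pi * t) \<and> cos (2 * pi * s) = cos (2 * pi * t)"
    using assms(2) by (simp add: complex_eq_iff)
  then obtain n :: int where "2 * pi * s = 2 * pi * t + 2 * pi * n" using sin_cos_eq_iff by metis
  then have "s = t + of_int n" by (simp add: ring_distribs[symmetric])
  then show ?thesis using periodic_int[of f t n] assms(1) by simp
qed

text \<open>Stone-Weierstrass is to be applied on the compact unit circle, so periodic functions are
  moved there. No branch of the argument is continuous on the whole circle; two branches with
  different cuts are used, and they give the same function because \<open>f\<close> is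
  periodic.\<close>

lemma circle_lift:
  assumes f: "f \<in> carrier circle_alg"
  shows "\<exists>H. continuous_on (sphere 0 1) H \<and> (\<forall>t. H (cis (2 * pi * t)) = f t)"
proof -
  have per: "f (t + 1) = f t" and cont: "isCont f t" for t
    using f by (auto simp: circle_carrier continuous_on_eq_continuous_at)
  define H where "H = (\<lambda>z. f (Arg z / (2 * pi)))"
  define H' where "H' = (\<lambda>z. f (Arg2pi z / (2 * pi)))"
  have Arg: "cis (Arg z) = z" if "cmod z = 1" for z
    using that cis_Arg[of z] by (cases "z = 0") (auto simp: sgn_div_norm)
  have eq: "H z = H' z" if "z \<noteq> 0" for z
  proof -
    have "cis (Arg z) = sgn z" using that by (rule cis_Arg)
    moreover have "cis (Arg2pi z) = sgn z"
      using Arg2pi[of z] that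
      by (metis is_Arg_def cis_conv_exp mult.commute nonzero_mult_div_cancel_left norm_eq_zero of_real_eq_0_iff sgn_eq)
    ultimately show ?thesis unfolding H_def H'_def by (intro periodic_cis_eq[where f = f, OF per]) simp
  qed
  have "isCont H z" if z: "cmod z = 1" for z
  \<comment> \<open>\<open>Arg\<close> is continuous off the nonpositive real axis,
    \<open>Arg2pi\<close> off the nonnegative one.\<close>
  proof (cases "z \<in> \<real>\<^sub>\<le>\<^sub>0")
    case False
    have "isCont (\<lambda>z. Arg z / (2 * pi)) z"
      using continuous_at_Arg[OF False] by (rule isCont_divide) auto
    then show ?thesis unfolding H_def by (rule isCont_o2[OF _ cont])
  next
    case True
    moreover have "z \<noteq> 0" using z by auto
    ultimately have "z \<notin> \<real>\<^sub>\<ge>\<^sub>0" by (auto simp: complex_nonpos_Reals_iff complex_nonneg_Reals_iff complex_eq_iff)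
    then have "isCont (\<lambda>z. Arg2pi z / (2 * pi)) z"
      by (rule isCont_divide[OF continuous_at_Arg2pi]) auto
    then have "isCont H' z" unfolding H'_def by (rule isCont_o2[OF _ cont])
    moreover have "\<forall>\<^sub>F w in nhds z. H w = H' w"
    proof -
      have "open (- {0::complex})" "z \<in> - {0}" using z by auto
      then have "\<forall>\<^sub>F w in nhds z. w \<in> - {0}" by (rule eventually_nhds_in_open)
      then show ?thesis by eventually_elim (use eq in auto)
    qed
    ultimately show ?thesis using isCont_cong by blast
  qed
  then have "continuous_on (sphere 0 1) H" by (auto intro: continuous_at_imp_continuous_on)
  moreover have "H (cis (2 * pi * t)) = f t" for t
  proof -
    have "cis (2 * pi * (Arg (cis (2 * pi * t)) / (2 * pi))) = cis (2 * pi * t)" using Arg[of "cis (2 * pi * t)"] by simp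
    then show ?thesis unfolding H_def by (rule periodic_cis_eq[where f = f, OF per])
  qed
  ultimately show ?thesis by blast
qed

definition laurent :: "(real \<Rightarrow> complex) set" where
  "laurent = lincomb circle_alg circle_exp ` finsupp UNIV"

lemma laurent_closed:
  assumes "f \<in> laurent" "g \<in> laurent"
  shows "(\<lambda>t. f t + g t) \<in> laurent" "(\<lambda>t. f t * g t) \<in> laurent" "(\<lambda>t. c * f t) \<in> laurent"
proof -
  obtain a b where ab: "a \<in> finsupp UNIV" "b \<in> finsupp UNIV"
      "f = lincomb circle_alg circle_exp a" "g = lincomb circle_alg circle_exp b"
    using assms unfolding laurent_def by auto
  show "(\<lambda>t. f t + g t) \<in> laurent"
    unfolding laurent_def ab(3,4)
    by (rule image_eqI[of _ _ "\<lambda>x. a x + b x"])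
      (use circle_rep.lincomb_add[OF ab(1,2)] int_bic.F_add[OF ab(1,2)] in simp_all)
  show "(\<lambda>t. f t * g t) \<in> laurent"
    unfolding laurent_def ab(3,4)
    by (rule image_eqI[of _ _ "tconv (\<lambda>_ _. 1) a b"])
      (use circle_rep.lincomb_tconv[OF ab(1,2)] int_bic.F_tconv[OF ab(1,2)] in simp_all)
  show "(\<lambda>t. c * f t) \<in> laurent"
    unfolding laurent_def ab(3)
    by (rule image_eqI[of _ _ "\<lambda>x. c * a x"])
      (use circle_rep.lincomb_scale[OF ab(1)] int_bic.F_scale[OF ab(1)] in simp_all)
qed

lemma laurent_exp: "circle_exp n \<in> laurent"
proof -
  let ?f = "\<lambda>k. if k = n then 1 else 0 :: complex"
  have f: "?f \<in> finsupp UNIV" by (rule finsupp_subsetI[of _ "{n}"]) auto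
  have "{k. ?f k \<noteq> 0} = {n}" by auto
  then have "lincomb circle_alg circle_exp ?f = circle_exp n" by (simp add: laurent_eq[OF f])
  then show ?thesis unfolding laurent_def using f by (intro image_eqI[of _ _ ?f]) simp_all
qed

text \<open>The real functions whose complexification is Laurent form an algebra. It separates
  points because \<open>Re\<close> and \<open>Im\<close> are combinations of the exponentials of
  degree \<open>1\<close> and \<open>-1\<close>.\<close>

lemma laurent_dense_real:
  assumes g: "continuous_on (sphere 0 1) (g :: complex \<Rightarrow> real)" and e: "e > 0"
  shows "\<exists>h\<in>laurent. \<forall>t. cmod (of_real (g (cis (2 * pi * t))) - h t) < e"
proof -
  define P where "P = (\<lambda>g. continuous_on (sphere 0 1) g \<and> (\<lambda>t. complex_of_real (g (cis (2 * pi * t)))) \<in> laurent)"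
  have "\<exists>h. P h \<and> (\<forall>x\<in>sphere 0 1. \<bar>g x - h x\<bar> < e)"
  proof (rule Stone_Weierstrass_HOL[where S = "sphere 0 1" and P = P])
    show "P (\<lambda>x. c)" for c
      using laurent_closed(3)[OF laurent_exp laurent_exp, of c 0] by (simp add: P_def circle_exp_def)
    show "P f \<and> P g \<Longrightarrow> P (\<lambda>x. f x + g x)" for f g
      using laurent_closed(1) by (auto simp: P_def intro!: continuous_intros)
    show "P f \<and> P g \<Longrightarrow> P (\<lambda>x. f x * g x)" for f g
      using laurent_closed(2) by (auto simp: P_def intro!: continuous_intros)
    have c1: "(\<lambda>t. 1 / 2 * circle_exp 1 t + 1 / 2 * circle_exp (-1) t) \<in> laurent"
      and c2: "(\<lambda>t. - \<i> / 2 * circle_exp 1 t + \<i> / 2 * circle_exp (-1) t) \<in> laurent"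
      by (rule laurent_closed(1)[OF laurent_closed(3)[OF laurent_exp laurent_exp] laurent_closed(3)[OF laurent_exp laurent_exp]])+
    have "(\<lambda>t. complex_of_real (Re (cis (2 * pi * t)))) = (\<lambda>t. 1 / 2 * circle_exp 1 t + 1 / 2 * circle_exp (-1) t)"
      by (auto simp: circle_exp_def complex_eq_iff)
    then have "P Re" using c1 by (auto simp: P_def intro!: continuous_intros)
    have "(\<lambda>t. complex_of_real (Im (cis (2 * pi * t)))) = (\<lambda>t. - \<i> / 2 * circle_exp 1 t + \<i> / 2 * circle_exp (-1) t)"
      by (auto simp: circle_exp_def complex_eq_iff)
    then have "P Im" using c2 by (auto simp: P_def intro!: continuous_intros)
    show "\<exists>f. P f \<and> f x \<noteq> f y" if "x \<in> sphere 0 1 \<and> y \<in> sphere 0 1 \<and> x \<noteq> y" for x y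
      using that \<open>P Re\<close> \<open>P Im\<close> complex_eq_iff by blast
  qed (use g e in \<open>auto simp: P_def\<close>)
  then obtain h where h: "P h" "\<And>x. x \<in> sphere 0 1 \<Longrightarrow> \<bar>g x - h x\<bar> < e" by blast
  have "cmod (of_real (g (cis (2 * pi * t))) - of_real (h (cis (2 * pi * t)))) < e" for t
    using h(2)[of "cis (2 * pi * t)"] by (simp flip: of_real_diff)
  then show ?thesis using h(1) unfolding P_def
    by (intro bexI[of _ "\<lambda>t. of_real (h (cis (2 * pi * t)))"]) auto
qed

lemma laurent_dense:
  assumes x: "x \<in> carrier circle_alg" and e: "e > 0"
  shows "\<exists>h\<in>laurent. cnorm circle_alg (x \<ominus>\<^bsub>circle_alg\<^esub> h) < e"
proof -
  obtain H where H: "continuous_on (sphere 0 1) H" "\<And>t. H (cis (2 * pi * t)) = x t"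
    using circle_lift[OF x] by blast
  \<comment> \<open>Two errors below \<open>e / 3\<close> leave room for the supremum, which turns
    strict inequalities into weak ones.\<close>
  have e3: "e / 3 > 0" using e by simp
  obtain u where u: "u \<in> laurent" "\<And>t. cmod (of_real (Re (x t)) - u t) < e / 3"
    using laurent_dense_real[OF continuous_on_Re[OF H(1)] e3] H(2) by auto
  obtain v where v: "v \<in> laurent" "\<And>t. cmod (of_real (Im (x t)) - v t) < e / 3"
    using laurent_dense_real[OF continuous_on_Im[OF H(1)] e3] H(2) by auto
  define h where "h = (\<lambda>t. u t + \<i> * v t)"
  have h: "h \<in> laurent" unfolding h_def by (rule laurent_closed(1)[OF u(1) laurent_closed(3)[OF v(1) v(1)]])
  have hc: "h \<in> carrier circle_alg" using h circle_rep.lincomb_closed unfolding laurent_def by blast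
  have "cmod (x t - h t) \<le> 2 * e / 3" for t
  proof -
    have "x t - h t = (of_real (Re (x t)) - u t) + \<i> * (of_real (Im (x t)) - v t)"
      using complex_eq[of "x t"] by (simp add: h_def algebra_simps)
    then have "cmod (x t - h t) \<le> cmod (of_real (Re (x t)) - u t) + cmod (\<i> * (of_real (Im (x t)) - v t))"
      by (metis norm_triangle_ineq)
    then show ?thesis using u(2)[of t] v(2)[of t] by (simp add: norm_mult)
  qed
  then have "cnorm circle_alg (x \<ominus>\<^bsub>circle_alg\<^esub> h) \<le> 2 * e / 3"
    unfolding circle_minus[OF hc] by (rule circle_norm_le)
  then show ?thesis using h e by (intro bexI[of _ h]) auto
qed

section \<open>The circle algebra as the universal algebra of the integers\<close>

text \<open>Each point mass \<open>d n\<close> satisfies the relation of a unitary, so the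
  C*-identity gives \<open>\<nu> (d 0) = (\<nu> (d n))\<^sup>2\<close>. For \<open>n = 0\<close>
  this forces \<open>\<nu> (d 0) \<le> 1\<close>.\<close>

lemma seminorm_le_l1:
  assumes \<nu>: "cstar_seminorm (UNIV :: int set) (\<lambda>_ _. 1) \<nu>" and f: "f \<in> finsupp UNIV"
  shows "\<nu> f \<le> (\<Sum>n | f n \<noteq> 0. cmod (f n))"
proof -
  define d where "d = (\<lambda>n k :: int. if k = n then 1 else 0 :: complex)"
  have supp: "{k. d n k \<noteq> 0} = {n}" for n by (auto simp: d_def)
  have dF: "d n \<in> finsupp UNIV" for n by (simp add: finsupp_def supp)
  have star: "tconv (\<lambda>_ _. 1) (tstar (\<lambda>_ _. 1) (d n)) (d n) = d 0" for n
  proof -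
    have "tstar (\<lambda>_ _. 1) (d n) = d (- n)" by (auto simp: tstar_def d_def)
    then show ?thesis by (auto simp: tconv_def supp) (auto simp: d_def)
  qed
  have sn: "0 \<le> \<nu> h" "\<nu> (\<lambda>g. c * h g) = cmod c * \<nu> h"
      "\<nu> (tconv (\<lambda>_ _. 1) (tstar (\<lambda>_ _. 1) h) h) = (\<nu> h)\<^sup>2" if "h \<in> finsupp UNIV" for h c
    using \<nu> that unfolding cstar_seminorm_def by auto
  have add: "\<nu> (\<lambda>g. h g + k g) \<le> \<nu> h + \<nu> k" if "h \<in> finsupp UNIV" "k \<in> finsupp UNIV" for h k
    using \<nu> that unfolding cstar_seminorm_def by auto
  have sq: "\<nu> (d 0) = (\<nu> (d n))\<^sup>2" for n using sn(3)[OF dF, of n] star by simp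
  have "\<nu> (d 0) \<le> 1" using sq[of 0] sn(1)[OF dF, of 0] by (auto simp: power2_eq_square)
  then have d1: "\<nu> (d n) \<le> 1" for n using sq[of n] by (simp add: power_le_one_iff power2_le_iff_abs_le abs_le_square_iff sn(1)[OF dF])
  have "(\<lambda>k. \<Sum>n\<in>S. f n * d n k) \<in> finsupp UNIV \<and> \<nu> (\<lambda>k. \<Sum>n\<in>S. f n * d n k) \<le> (\<Sum>n\<in>S. cmod (f n))" if "finite S" for S
    using that
  proof induction
    case empty
    then show ?case using sn(2)[OF dF, of 0 0] by (simp add: int_bic.F_zero)
  next
    case (insert n S)
    have "\<nu> (\<lambda>k. f n * d n k + (\<Sum>n\<in>S. f n * d n k)) \<le> \<nu> (\<lambda>k. f n * d n k) + \<nu> (\<lambda>k. \<Sum>n\<in>S. f n * d n k)"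
      using insert.IH by (intro add int_bic.F_scale dF) auto
    also have "\<dots> \<le> cmod (f n) * 1 + (\<Sum>n\<in>S. cmod (f n))"
      using insert.IH sn(2)[OF dF] d1 by (intro add_mono) (auto intro: mult_left_le)
    finally show ?case using insert int_bic.F_add[OF int_bic.F_scale[OF dF]] by simp
  qed
  moreover have "(\<lambda>k. \<Sum>n | f n \<noteq> 0. f n * d n k) = f"
  proof
    fix k
    have "(\<Sum>n | f n \<noteq> 0. f n * d n k) = (\<Sum>n | f n \<noteq> 0. if n = k then f k else 0)"
      by (intro sum.cong) (auto simp: d_def)
    then show "(\<Sum>n | f n \<noteq> 0. f n * d n k) = f k"
      using int_bic.F_finite[OF f] by (simp add: sum.delta)
  qed
  ultimately show ?thesis using int_bic.F_finite[OF f] by metis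
qed

text \<open>If \<open>x\<close> exceeded \<open>N\<close>, the powers of \<open>N / x\<close> would
  decay exponentially and beat the factor that is linear in the exponent.\<close>

lemma le_of_power_bound:
  fixes x N d :: real
  assumes x: "0 \<le> x" "0 \<le> N" and bound: "\<And>k. x ^ 2 ^ Suc k \<le> (2 * 2 ^ Suc k * d + 1) * N ^ 2 ^ Suc k"
  shows "x \<le> N"
proof (rule ccontr)
  assume "\<not> x \<le> N"
  then have "x > 0" "N < x" using x by auto
  define q where "q = N / x"
  have q: "0 \<le> q" "q < 1" using \<open>x > 0\<close> \<open>N < x\<close> x by (simp_all add: q_def)
  have ge: "1 \<le> (2 * 2 ^ Suc k * d + 1) * q ^ 2 ^ Suc k" for k
    using bound[of k] \<open>x > 0\<close> by (simp add: q_def power_divide field_simps)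
  have "(\<lambda>M. 2 * d * (of_nat M * q ^ M) + q ^ M) \<longlonglongrightarrow> 2 * d * 0 + 0"
    using q by (intro tendsto_intros powser_times_n_limit_0 LIMSEQ_power_zero) auto
  moreover have "strict_mono (\<lambda>k. 2 ^ Suc k :: nat)" by (intro strict_monoI power_strict_increasing) auto
  ultimately have "((\<lambda>M. 2 * d * (of_nat M * q ^ M) + q ^ M) \<circ> (\<lambda>k. 2 ^ Suc k)) \<longlonglongrightarrow> 2 * d * 0 + 0"
    by (rule LIMSEQ_subseq_LIMSEQ)
  then have "(\<lambda>k. (2 * 2 ^ Suc k * d + 1) * q ^ 2 ^ Suc k) \<longlonglongrightarrow> 0"
    by (simp add: comp_def algebra_simps)
  then have "1 \<le> (0::real)" using ge by (intro LIMSEQ_le_const[of _ 0 1]) auto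
  then show False by simp
qed

lemma laurent_inj:
  assumes "f \<in> finsupp UNIV" "g \<in> finsupp UNIV"
    "lincomb circle_alg circle_exp f = lincomb circle_alg circle_exp g"
  shows "f = g"
  using circle_mean_laurent[OF assms(1)] circle_mean_laurent[OF assms(2)] assms(3) by (auto simp: fun_eq_iff)

text \<open>The C*-identity gives \<open>\<nu> f\<^sup>M = \<nu> ((f\<^sup>* f)\<^sup>M\<^sup>/\<^sup>2)\<close> for \<open>M\<close> a power of \<open>2\<close>, and the coefficients of this
  Laurent polynomial, of which there are \<open>O(M)\<close>, are bounded by the \<open>M\<close>-th power of the sup norm of \<open>f\<close>.\<close>

lemma seminorm_le_sup_norm:
  assumes \<nu>: "cstar_seminorm (UNIV :: int set) (\<lambda>_ _. 1) \<nu>" and f: "f \<in> finsupp UNIV"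
  shows "\<nu> f \<le> cnorm circle_alg (lincomb circle_alg circle_exp f)"
proof -
  let ?P = "lincomb circle_alg circle_exp"
  define N where "N = cnorm circle_alg (?P f)"
  \<comment> \<open>The \<open>2 ^ k\<close>-th convolution power of the product of
    \<open>tstar f\<close> and \<open>f\<close>.\<close>
  define g where "g = rec_nat (tconv (\<lambda>_ _. 1) (tstar (\<lambda>_ _. 1) f) f) (\<lambda>_ h. tconv (\<lambda>_ _. 1) h h)"
  have g0: "g 0 = tconv (\<lambda>_ _. 1) (tstar (\<lambda>_ _. 1) f) f" and gS: "g (Suc k) = tconv (\<lambda>_ _. 1) (g k) (g k)" for k
    by (simp_all add: g_def)
  have gF: "g k \<in> finsupp UNIV" for k
    by (induction k) (auto simp: g0 gS intro!: int_bic.F_tconv int_bic.F_tstar f)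
  have Pg: "?P (g k) t = of_real (cmod (?P f t) ^ 2 ^ Suc k)" for k t
  proof (induction k)
    case 0
    have "?P (g 0) t = cnj (?P f t) * ?P f t"
      by (simp add: g0 circle_rep.lincomb_tconv circle_rep.lincomb_tstar int_bic.F_tstar f)
    then show ?case by (metis complex_norm_square mult.commute power_one_right power_Suc0_right One_nat_def)
  next
    case (Suc k)
    have "?P (g (Suc k)) t = ?P (g k) t * ?P (g k) t" by (simp add: gS circle_rep.lincomb_tconv gF)
    then show ?case using Suc by (simp add: power_add[symmetric] mult_2 flip: of_real_mult)
  qed
  \<comment> \<open>A Laurent polynomial is determined by its function, and that of
    \<open>g k\<close> is real valued.\<close>
  have self: "tstar (\<lambda>_ _. 1) (g k) = g k" for k
    by (rule laurent_inj) (auto simp: int_bic.F_tstar gF circle_rep.lincomb_tstar Pg fun_eq_iff)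
  have \<nu>sq: "\<nu> (tconv (\<lambda>_ _. 1) (tstar (\<lambda>_ _. 1) h) h) = (\<nu> h)\<^sup>2" and \<nu>0: "0 \<le> \<nu> h" if "h \<in> finsupp UNIV" for h
    using \<nu> that unfolding cstar_seminorm_def by auto
  have \<nu>g: "\<nu> (g k) = \<nu> f ^ 2 ^ Suc k" for k
  proof (induction k)
    case 0
    then show ?case using \<nu>sq[OF f] by (simp add: g0)
  next
    case (Suc k)
    have "\<nu> (g (Suc k)) = (\<nu> (g k))\<^sup>2" using \<nu>sq[OF gF[of k]] by (simp add: self gS)
    then show ?case using Suc by (simp add: power_mult[symmetric] mult.commute)
  qed
  obtain b where b: "\<And>n. f n \<noteq> 0 \<Longrightarrow> \<bar>n\<bar> \<le> int b"
  proof -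
    have fin: "finite ((\<lambda>n. nat \<bar>n\<bar>) ` {n. f n \<noteq> 0})" using int_bic.F_finite[OF f] by simp
    have "\<bar>n\<bar> \<le> int (Max ((\<lambda>n. nat \<bar>n\<bar>) ` {n. f n \<noteq> 0}))" if "f n \<noteq> 0" for n
      using Max_ge[OF fin, of "nat \<bar>n\<bar>"] that by fastforce
    then show thesis using that by blast
  qed
  \<comment> \<open>Squaring doubles the degree, hence the linear growth of the number of
    coefficients in the exponent.\<close>
  have supp: "\<bar>n\<bar> \<le> 2 ^ Suc k * int b" if "g k n \<noteq> 0" for k n
    using that
  proof (induction k arbitrary: n)
    case 0
    have "n \<in> (\<lambda>(y, z). y + z) ` ({x. tstar (\<lambda>_ _. 1) f x \<noteq> 0} \<times> {x. f x \<noteq> 0})"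
      using 0 finsupp_tconv(1)[OF int_bic.add_mem int_bic.F_tstar[OF f] f] unfolding g0 by blast
    then obtain y z where "n = y + z" "tstar (\<lambda>_ _. 1) f y \<noteq> 0" "f z \<noteq> 0" by auto
    then show ?case using b[of "- y"] b[of z] by (auto simp: tstar_def)
  next
    case (Suc k)
    have "n \<in> (\<lambda>(y, z). y + z) ` ({x. g k x \<noteq> 0} \<times> {x. g k x \<noteq> 0})"
      using Suc.prems finsupp_tconv(1)[OF int_bic.add_mem gF gF] unfolding gS by blast
    then obtain y z where "n = y + z" "g k y \<noteq> 0" "g k z \<noteq> 0" by auto
    then show ?case using Suc.IH[of y] Suc.IH[of z] by auto
  qed
  have Nge: "cmod (?P f t) \<le> N" for t unfolding N_def by (rule circle_norm_ge[OF circle_rep.lincomb_closed[OF f]])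
  have N0: "0 \<le> N" using Nge[of 0] norm_ge_zero order_trans by blast
  have "\<nu> f ^ 2 ^ Suc k \<le> (2 * 2 ^ Suc k * real b + 1) * N ^ 2 ^ Suc k" for k
  proof -
    let ?S = "{n. g k n \<noteq> 0}" and ?L = "2 ^ Suc k * int b"
    have "?S \<subseteq> {- ?L..?L}"
    proof
      fix n assume "n \<in> ?S"
      then have "\<bar>n\<bar> \<le> ?L" by (intro supp) simp
      then show "n \<in> {- ?L..?L}" unfolding abs_le_iff atLeastAtMost_iff by linarith
    qed
    then have "card ?S \<le> card {- ?L..?L}" by (intro card_mono) auto
    also have "\<dots> = nat (2 * ?L + 1)" by (simp add: mult_ac)
    finally have "card ?S \<le> nat (2 * ?L + 1)" .
    then have "real (card ?S) \<le> real (nat (2 * ?L + 1))" by (rule of_nat_mono)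
    also have "\<dots> = of_int (2 * ?L + 1)" by (intro of_nat_nat) simp
    also have "\<dots> = 2 * 2 ^ Suc k * real b + 1" by simp
    finally have card: "real (card ?S) \<le> 2 * 2 ^ Suc k * real b + 1" .
    have norm: "cnorm circle_alg (?P (g k)) \<le> N ^ 2 ^ Suc k"
      by (rule circle_norm_le) (simp only: Pg norm_of_real abs_of_nonneg[OF zero_le_power[OF norm_ge_zero]] power_mono[OF Nge norm_ge_zero])
    have "\<nu> f ^ 2 ^ Suc k \<le> (\<Sum>n\<in>?S. cmod (g k n))"
      unfolding \<nu>g[symmetric] by (rule seminorm_le_l1[OF \<nu> gF])
    also have "\<dots> \<le> (\<Sum>n\<in>?S. N ^ 2 ^ Suc k)"
      by (intro sum_mono order_trans[OF laurent_coeff_le[OF gF] norm])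
    also have "\<dots> = real (card ?S) * N ^ 2 ^ Suc k" by simp
    also have "\<dots> \<le> (2 * 2 ^ Suc k * real b + 1) * N ^ 2 ^ Suc k"
      using N0 by (intro mult_right_mono card) auto
    finally show ?thesis .
  qed
  then have "\<nu> f \<le> N" by (rule le_of_power_bound[OF \<nu>0[OF f] N0])
  then show ?thesis by (simp add: N_def)
qed

text \<open>With this, \<open>twisted_group_cstar_universal\<close> turns every unitary
  representation of the integers in a C*-algebra into a contractive homomorphism defined on
  continuous functions.\<close>

lemma twisted_group_cstar_circle: "twisted_group_cstar (UNIV :: int set) (\<lambda>_ _. 1) circle_alg circle_exp"
  unfolding twisted_group_cstar_def
proof (intro conjI allI impI ballI)
  show "cstar_algebra circle_alg" by (rule cstar_circle)
  show "unitary_family UNIV (\<lambda>_ _. 1) circle_alg circle_exp" by (rule circle_rep.family)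
  show "\<exists>f\<in>finsupp UNIV. cnorm circle_alg (x \<ominus>\<^bsub>circle_alg\<^esub> lincomb circle_alg circle_exp f) < e"
    if "x \<in> carrier circle_alg" "e > 0" for x e
    using laurent_dense[OF that] unfolding laurent_def by blast
qed (rule seminorm_le_sup_norm)

section \<open>Rieffel idempotents\<close>

text \<open>Identities that are linear and continuous in a function need to be checked on
  exponentials only.\<close>

lemma circle_dense_induct:
  assumes f: "f \<in> carrier circle_alg"
    and exp: "\<And>n. E (circle_exp n)"
    and add: "\<And>f g. f \<in> carrier circle_alg \<Longrightarrow> g \<in> carrier circle_alg \<Longrightarrow> E f \<Longrightarrow> E g \<Longrightarrow> E (\<lambda>t. f t + g t)"
    and scale: "\<And>f c. f \<in> carrier circle_alg \<Longrightarrow> E f \<Longrightarrow> E (\<lambda>t. c * f t)"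
    and closed: "\<And>f. f \<in> carrier circle_alg \<Longrightarrow>
      (\<And>\<epsilon>. \<epsilon> > 0 \<Longrightarrow> \<exists>g\<in>carrier circle_alg. E g \<and> cnorm circle_alg (f \<ominus>\<^bsub>circle_alg\<^esub> g) < \<epsilon>) \<Longrightarrow> E f"
  shows "E f"
proof (rule closed[OF f])
  fix \<epsilon> :: real assume "\<epsilon> > 0"
  then obtain a where a: "a \<in> finsupp UNIV"
      "cnorm circle_alg (f \<ominus>\<^bsub>circle_alg\<^esub> lincomb circle_alg circle_exp a) < \<epsilon>"
    using laurent_dense[OF f] unfolding laurent_def by blast
  have scaled: "(\<lambda>t. c * circle_exp n t) \<in> carrier circle_alg" for c n
    using circle_rep.scale_closed[OF circle_exp_closed, of c n] by simp
  have "(\<lambda>t. \<Sum>n\<in>S. a n * circle_exp n t) \<in> carrier circle_alg \<and> E (\<lambda>t. \<Sum>n\<in>S. a n * circle_exp n t)" if "finite S" for S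
    using that
  proof induction
    case empty
    then show ?case using scale[OF circle_exp_closed exp, of 0 0] circle_rep.zero_closed by simp
  next
    case (insert n S)
    then show ?case
      using add[OF scaled _ scale[OF circle_exp_closed exp], of "\<lambda>t. \<Sum>n\<in>S. a n * circle_exp n t"]
        circle_rep.add.m_closed[OF scaled, of "\<lambda>t. \<Sum>n\<in>S. a n * circle_exp n t"] by simp
  qed
  from this[of "{n. a n \<noteq> 0}"]
  show "\<exists>g\<in>carrier circle_alg. E g \<and> cnorm circle_alg (f \<ominus>\<^bsub>circle_alg\<^esub> g) < \<epsilon>"
    using a circle_rep.finsuppD(1)[OF a(1)] unfolding laurent_eq[OF a(1)] by blast
qed

text \<open>The powers \<open>V n\<close> of one unitary together with a second unitary
  \<open>v\<close> that rotates them by the angle \<open>\<beta>\<close>. The trace conditions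
  concern just the degrees \<open>-1\<close>, \<open>0\<close>, \<open>1\<close> in
  \<open>v\<close>, which are those occurring in the Rieffel element.\<close>

locale rotation_pair = traced_algebra A \<phi> for A :: "'a cstar_alg" (structure) and \<phi> +
  fixes V :: "int \<Rightarrow> 'a" and v :: 'a and \<beta> :: real
  assumes V: "unitary_family UNIV (\<lambda>_ _. 1) A V"
    and v: "unitary_elt A v"
    and commutation: "\<And>n. v \<otimes> V n = cis (2 * pi * of_int n * \<beta>) \<odot> (V n \<otimes> v)"
    and trace_V: "\<And>n. \<phi> (V n) = (if n = 0 then 1 else 0)"
    and trace_V_v: "\<And>n. \<phi> (V n \<otimes> v) = 0" "\<And>n. \<phi> (V n \<otimes> adj A v) = 0"
begin

lemma V_closed: "V n \<in> carrier A"
  using V unfolding unitary_family_def unitary_elt_def by blast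

lemma v_closed: "v \<in> carrier A" "adj A v \<in> carrier A"
  and v_unitary: "adj A v \<otimes> v = \<one>" "v \<otimes> adj A v = \<one>"
  using v adj_closed unfolding unitary_elt_def by auto

definition calc :: "(real \<Rightarrow> complex) \<Rightarrow> 'a" where
  "calc = (SOME h. star_hom circle_alg A h \<and> (\<forall>g\<in>UNIV. h (circle_exp g) = V g) \<and>
    (\<forall>x\<in>carrier circle_alg. cnorm A (h x) \<le> cnorm circle_alg x))"

lemma calc: "star_hom circle_alg A calc" "calc (circle_exp n) = V n"
  "f \<in> carrier circle_alg \<Longrightarrow> cnorm A (calc f) \<le> cnorm circle_alg f"
proof -
  have "unitary_representation A UNIV (\<lambda>_ _. 1) V" using V by unfold_locales auto
  from someI_ex[OF twisted_group_cstar_universal[OF twisted_group_cstar_circle this]]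
  show "star_hom circle_alg A calc" "calc (circle_exp n) = V n"
    "f \<in> carrier circle_alg \<Longrightarrow> cnorm A (calc f) \<le> cnorm circle_alg f"
    unfolding calc_def by blast+
qed

lemma calc_hom:
  assumes "f \<in> carrier circle_alg"
  shows "calc f \<in> carrier A" and "calc (\<lambda>t. c * f t) = c \<odot> calc f"
    and "g \<in> carrier circle_alg \<Longrightarrow> calc (\<lambda>t. f t + g t) = calc f \<oplus> calc g"
    and "g \<in> carrier circle_alg \<Longrightarrow> calc (\<lambda>t. f t * g t) = calc f \<otimes> calc g"
proof -
  have hom: "calc \<in> ring_hom circle_alg A" using calc(1) unfolding star_hom_def by blast
  show "calc f \<in> carrier A" by (rule ring_hom_closed[OF hom assms])
  have "calc (c \<odot>\<^bsub>circle_alg\<^esub> f) = c \<odot> calc f" using calc(1) assms unfolding star_hom_def by blast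
  then show "calc (\<lambda>t. c * f t) = c \<odot> calc f" by simp
  show "calc (\<lambda>t. f t + g t) = calc f \<oplus> calc g" if "g \<in> carrier circle_alg"
    using ring_hom_add[OF hom assms that] by simp
  show "calc (\<lambda>t. f t * g t) = calc f \<otimes> calc g" if "g \<in> carrier circle_alg"
    using ring_hom_mult[OF hom assms that] by simp
qed

lemma calc_zero: "calc (\<lambda>t. 0) = \<zero>"
  using calc_hom(2)[OF circle_exp_closed, of 0 0] calc_hom(1)[OF circle_exp_closed] by (simp add: scale_zero_left)

lemma calc_diff:
  assumes f: "f \<in> carrier circle_alg" and g: "g \<in> carrier circle_alg"
  shows "calc f \<ominus> calc g = calc (f \<ominus>\<^bsub>circle_alg\<^esub> g)"
proof -
  have "(\<lambda>t. (- 1) * g t) \<in> carrier circle_alg"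
    using circle_rep.scale_closed[OF g, of "- 1"] by (simp only: circle_simps)
  then have "calc (\<lambda>t. f t + (- 1) * g t) = calc f \<oplus> (- 1) \<odot> calc g"
    unfolding calc_hom(2)[OF g, symmetric] by (rule calc_hom(3)[OF f])
  then show ?thesis
    unfolding circle_minus[OF g] unfolding a_minus_def scale_minus_one[OF calc_hom(1)[OF g]] by simp
qed

text \<open>Used with \<open>x\<close> the unit and \<open>c = 1\<close>, and with \<open>x\<close>
  equal to \<open>v\<close> or its adjoint and \<open>c = 0\<close>.\<close>

lemma trace_calc_mult:
  assumes x: "x \<in> carrier A" and c: "\<And>n. \<phi> (V n \<otimes> x) = (if n = 0 then c else 0)"
    and f: "f \<in> carrier circle_alg"
  shows "\<phi> (calc f \<otimes> x) = c * circle_mean f"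
  using f
proof (rule circle_dense_induct[where E = "\<lambda>f. \<phi> (calc f \<otimes> x) = c * circle_mean f"])
  show "\<phi> (calc (circle_exp n) \<otimes> x) = c * circle_mean (circle_exp n)" for n
    by (simp add: calc(2) c circle_mean_exp)
  fix f assume f: "f \<in> carrier circle_alg"
  show "\<phi> (calc (\<lambda>t. d * f t) \<otimes> x) = c * circle_mean (\<lambda>t. d * f t)"
    if "\<phi> (calc f \<otimes> x) = c * circle_mean f" for d
    using that f x by (simp add: calc_hom scale_mult_left trace_scale circle_mean_def)
  show "\<phi> (calc (\<lambda>t. f t + g t) \<otimes> x) = c * circle_mean (\<lambda>t. f t + g t)"
    if "g \<in> carrier circle_alg" "\<phi> (calc f \<otimes> x) = c * circle_mean f" "\<phi> (calc g \<otimes> x) = c * circle_mean g" for g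
    using that f x
    by (simp add: calc_hom l_distr trace_add circle_mean_def circle_integrable ring_distribs
      Henstock_Kurzweil_Integration.integral_add)
  assume approx: "\<And>\<epsilon>. \<epsilon> > 0 \<Longrightarrow> \<exists>g\<in>carrier circle_alg. \<phi> (calc g \<otimes> x) = c * circle_mean g \<and>
    cnorm circle_alg (f \<ominus>\<^bsub>circle_alg\<^esub> g) < \<epsilon>"
  \<comment> \<open>The sum of the Lipschitz constants of the two sides, as given by
    \<open>trace_bound\<close> and \<open>circle_mean_bound\<close>; the \<open>1\<close> keeps it
    positive.\<close>
  define K where "K = 8 / 3 * cnorm A x + cmod c + 1"
  have K: "K > 0" unfolding K_def using norm_nonneg[OF x] norm_ge_zero[of c] by linarith
  have "cmod (\<phi> (calc f \<otimes> x) - c * circle_mean f) \<le> 0 + \<epsilon>" if \<epsilon>: "\<epsilon> > 0" for \<epsilon>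
  proof -
    have "\<epsilon> / K > 0" using \<epsilon> K by simp
    then obtain g where g: "g \<in> carrier circle_alg" "\<phi> (calc g \<otimes> x) = c * circle_mean g"
      "cnorm circle_alg (f \<ominus>\<^bsub>circle_alg\<^esub> g) < \<epsilon> / K" using approx by blast
    let ?d = "f \<ominus>\<^bsub>circle_alg\<^esub> g"
    have d: "?d \<in> carrier circle_alg" using f g by simp
    note cl = calc_hom(1)[OF f] calc_hom(1)[OF g(1)] calc_hom(1)[OF d]
    have "\<phi> (calc ?d \<otimes> x) = \<phi> (calc f \<otimes> x) - \<phi> (calc g \<otimes> x)"
      unfolding calc_diff[OF f g(1), symmetric] using cl x
      by (simp add: a_minus_def l_distr l_minus trace_diff[unfolded a_minus_def])
    moreover have mean: "circle_mean ?d = circle_mean f - circle_mean g"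
      using circle_mean_diff[OF f g(1)] by (simp add: circle_minus[OF g(1)])
    ultimately have "\<phi> (calc f \<otimes> x) - c * circle_mean f = \<phi> (calc ?d \<otimes> x) - c * circle_mean ?d"
      unfolding mean right_diff_distrib by (simp add: g(2))
    also have "cmod \<dots> \<le> cmod (\<phi> (calc ?d \<otimes> x)) + cmod (c * circle_mean ?d)" by (rule norm_triangle_ineq4)
    also have "\<dots> \<le> 8 / 3 * (cnorm A (calc ?d) * cnorm A x) + cmod c * cnorm circle_alg ?d"
      unfolding Real_Vector_Spaces.norm_mult
      using cl x by (intro add_mono mult_left_mono order_trans[OF trace_bound] norm_mult circle_mean_bound d) auto
    also have "\<dots> \<le> 8 / 3 * (cnorm circle_alg ?d * cnorm A x) + cmod c * cnorm circle_alg ?d"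
      by (intro add_mono mult_left_mono mult_right_mono calc(3) d norm_nonneg x) auto
    also have "\<dots> \<le> cnorm circle_alg ?d * K"
      using circle_norm_nonneg[OF d] by (simp add: K_def algebra_simps)
    also have "\<dots> \<le> \<epsilon>" using g(3) K by (simp add: field_simps)
    finally show ?thesis by simp
  qed
  then have "cmod (\<phi> (calc f \<otimes> x) - c * circle_mean f) \<le> 0" by (rule field_le_epsilon)
  then show "\<phi> (calc f \<otimes> x) = c * circle_mean f" by simp
qed

lemma shift_closed: "f \<in> carrier circle_alg \<Longrightarrow> (\<lambda>t. f (t + s)) \<in> carrier circle_alg"
  by (auto simp: circle_carrier add.assoc add.commute[of _ 1] intro!: continuous_on_compose2[of UNIV f] continuous_intros)

text \<open>Conjugation by \<open>v\<close> acts on functions as rotation. For exponentials this is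
  \<open>commutation\<close>, and both sides are continuous in \<open>f\<close>.\<close>

lemma calc_shift:
  assumes f: "f \<in> carrier circle_alg"
  shows "v \<otimes> calc f = calc (\<lambda>t. f (t + \<beta>)) \<otimes> v"
  using f
proof (rule circle_dense_induct[where E = "\<lambda>f. v \<otimes> calc f = calc (\<lambda>t. f (t + \<beta>)) \<otimes> v"])
  show "v \<otimes> calc (circle_exp n) = calc (\<lambda>t. circle_exp n (t + \<beta>)) \<otimes> v" for n
  proof -
    have "(\<lambda>t. circle_exp n (t + \<beta>)) = (\<lambda>t. cis (2 * pi * of_int n * \<beta>) * circle_exp n t)"
      by (auto simp: circle_exp_def cis_mult algebra_simps)
    then show ?thesis
      by (simp add: calc_hom[OF circle_exp_closed] calc(2) commutation scale_mult_left V_closed v_closed)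
  qed
  fix f assume f: "f \<in> carrier circle_alg"
  note fs = shift_closed[OF f, of \<beta>]
  show "v \<otimes> calc (\<lambda>t. d * f t) = calc (\<lambda>t. d * f (t + \<beta>)) \<otimes> v"
    if "v \<otimes> calc f = calc (\<lambda>t. f (t + \<beta>)) \<otimes> v" for d
    using that f fs v_closed by (simp add: calc_hom[OF f] calc_hom[OF fs] scale_mult_left scale_mult_right)
  show "v \<otimes> calc (\<lambda>t. f t + g t) = calc (\<lambda>t. f (t + \<beta>) + g (t + \<beta>)) \<otimes> v"
    if "g \<in> carrier circle_alg" "v \<otimes> calc f = calc (\<lambda>t. f (t + \<beta>)) \<otimes> v" "v \<otimes> calc g = calc (\<lambda>t. g (t + \<beta>)) \<otimes> v" for g
    using that shift_closed[OF that(1), of \<beta>] f fs v_closed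
    by (simp add: calc_hom l_distr r_distr)
  assume approx: "\<And>\<epsilon>. \<epsilon> > 0 \<Longrightarrow> \<exists>g\<in>carrier circle_alg. v \<otimes> calc g = calc (\<lambda>t. g (t + \<beta>)) \<otimes> v \<and>
    cnorm circle_alg (f \<ominus>\<^bsub>circle_alg\<^esub> g) < \<epsilon>"
  define K where "K = 2 * cnorm A v + 1"
  have K: "K > 0" unfolding K_def using norm_nonneg[OF v_closed(1)] by linarith
  have fv: "v \<otimes> calc f \<in> carrier A" "calc (\<lambda>t. f (t + \<beta>)) \<otimes> v \<in> carrier A"
    using calc_hom(1)[OF f] calc_hom(1)[OF fs] v_closed by auto
  have "cnorm A (v \<otimes> calc f \<ominus> calc (\<lambda>t. f (t + \<beta>)) \<otimes> v) \<le> 0 + \<epsilon>" if \<epsilon>: "\<epsilon> > 0" for \<epsilon>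
  proof -
    have "\<epsilon> / K > 0" using \<epsilon> K by simp
    then obtain g where g: "g \<in> carrier circle_alg" "v \<otimes> calc g = calc (\<lambda>t. g (t + \<beta>)) \<otimes> v"
      "cnorm circle_alg (f \<ominus>\<^bsub>circle_alg\<^esub> g) < \<epsilon> / K" using approx by blast
    let ?d = "f \<ominus>\<^bsub>circle_alg\<^esub> g"
    note gs = shift_closed[OF g(1), of \<beta>]
    let ?e = "(\<lambda>t. g (t + \<beta>)) \<ominus>\<^bsub>circle_alg\<^esub> (\<lambda>t. f (t + \<beta>))"
    have d: "?d \<in> carrier circle_alg" "?e \<in> carrier circle_alg" using f g fs gs by simp_all
    note cl = calc_hom(1)[OF f] calc_hom(1)[OF g(1)] calc_hom(1)[OF d(1)] calc_hom(1)[OF d(2)]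
      calc_hom(1)[OF fs] calc_hom(1)[OF gs]
    have e1: "v \<otimes> calc f \<ominus> v \<otimes> calc g = v \<otimes> calc ?d"
      unfolding calc_diff[OF f g(1), symmetric] using cl v_closed by (simp add: a_minus_def r_distr r_minus)
    have e2: "v \<otimes> calc g \<ominus> calc (\<lambda>t. f (t + \<beta>)) \<otimes> v = calc ?e \<otimes> v"
      unfolding calc_diff[OF gs fs, symmetric] g(2) using cl v_closed by (simp add: a_minus_def l_distr l_minus)
    have "cnorm circle_alg ?e \<le> cnorm circle_alg ?d"
    proof (rule circle_norm_le)
      show "cmod (?e t) \<le> cnorm circle_alg ?d" for t
        using circle_norm_ge[OF d(1), of "t + \<beta>"] by (simp add: circle_minus[OF g(1)] circle_minus[OF fs] Real_Vector_Spaces.norm_minus_commute)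
    qed
    then have e: "cnorm A (calc ?e) \<le> cnorm circle_alg ?d" using calc(3)[OF d(2)] by simp
    have "cnorm A (v \<otimes> calc f \<ominus> calc (\<lambda>t. f (t + \<beta>)) \<otimes> v) \<le> cnorm A (v \<otimes> calc ?d) + cnorm A (calc ?e \<otimes> v)"
      unfolding e1[symmetric] e2[symmetric] using cl v_closed by (intro norm_triangle_sub) auto
    also have "\<dots> \<le> cnorm A v * cnorm A (calc ?d) + cnorm A (calc ?e) * cnorm A v"
      using cl v_closed by (intro add_mono norm_mult) auto
    also have "\<dots> \<le> cnorm A v * cnorm circle_alg ?d + cnorm circle_alg ?d * cnorm A v"
      using v_closed by (intro add_mono mult_left_mono mult_right_mono calc(3) d e norm_nonneg) auto
    also have "\<dots> \<le> cnorm circle_alg ?d * K"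
      using circle_norm_nonneg[OF d(1)] by (simp add: K_def algebra_simps)
    also have "\<dots> \<le> \<epsilon>" using g(3) K by (simp add: field_simps)
    finally show ?thesis by simp
  qed
  then have "cnorm A (v \<otimes> calc f \<ominus> calc (\<lambda>t. f (t + \<beta>)) \<otimes> v) \<le> 0" by (rule field_le_epsilon)
  then show "v \<otimes> calc f = calc (\<lambda>t. f (t + \<beta>)) \<otimes> v"
    using norm_nonneg[OF minus_closed[OF fv]] by (intro eq_of_norm_diff_0 fv) simp
qed

lemma calc_adj_shift:
  assumes f: "f \<in> carrier circle_alg"
  shows "calc f \<otimes> adj A v = adj A v \<otimes> calc (\<lambda>t. f (t + \<beta>))"
proof -
  note c = calc_hom(1)[OF f] calc_hom(1)[OF shift_closed[OF f, of \<beta>]] v_closed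
  have "adj A v \<otimes> (v \<otimes> calc f) \<otimes> adj A v = adj A v \<otimes> (calc (\<lambda>t. f (t + \<beta>)) \<otimes> v) \<otimes> adj A v"
    by (simp add: calc_shift[OF f])
  moreover have "adj A v \<otimes> (v \<otimes> calc f) = calc f"
    using c by (simp add: m_assoc[symmetric] v_unitary)
  moreover have "adj A v \<otimes> (calc (\<lambda>t. f (t + \<beta>)) \<otimes> v) \<otimes> adj A v = adj A v \<otimes> calc (\<lambda>t. f (t + \<beta>))"
    using c by (simp add: m_assoc v_unitary)
  ultimately show ?thesis by simp
qed

text \<open>The element is \<open>e = g v + f + v' g\<close> with \<open>v'\<close> the adjoint of
  \<open>v\<close>. When functions are moved past \<open>v\<close>, its square has terms of degree
  \<open>-2\<close> to \<open>2\<close> in \<open>v\<close>: \<open>disjoint\<close> kills degrees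
  \<open>2\<close> and \<open>-2\<close>, \<open>partition\<close> reproduces degrees
  \<open>1\<close> and \<open>-1\<close>, and \<open>square\<close> reproduces degree
  \<open>0\<close>. The trace sees only the term \<open>f\<close>.\<close>

lemma idempotentI:
  assumes f: "f \<in> carrier circle_alg" and g: "g \<in> carrier circle_alg"
    and disjoint: "\<And>t. g t * g (t + \<beta>) = 0"
    and partition: "\<And>t. g t * f (t + \<beta>) + f t * g t = g t"
    and square: "\<And>t. g t * g t + f t * f t + g (t - \<beta>) * g (t - \<beta>) = f t"
  shows "\<exists>e\<in>carrier A. e \<otimes> e = e \<and> \<phi> e = circle_mean f"
proof -
  define a where "a = calc g \<otimes> v"
  define b where "b = calc f"
  define c where "c = adj A v \<otimes> calc g"
  note gs = shift_closed[OF g, of \<beta>] and fs = shift_closed[OF f, of \<beta>]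
  note cl = calc_hom(1)[OF f] calc_hom(1)[OF g] calc_hom(1)[OF fs] calc_hom(1)[OF gs] v_closed
  have closed: "a \<in> carrier A" "b \<in> carrier A" "c \<in> carrier A"
    unfolding a_def b_def c_def using cl by auto
  note prod = calc_hom(4)[OF g g, symmetric] calc_hom(4)[OF f f, symmetric] calc_hom(4)[OF f g, symmetric]
    calc_hom(4)[OF g gs, symmetric] calc_hom(4)[OF gs g, symmetric] calc_hom(4)[OF g f, symmetric]
    calc_hom(4)[OF g fs, symmetric] calc_hom(4)[OF fs g, symmetric]
  have mc: "(\<lambda>t. x t * y t) \<in> carrier circle_alg" if "x \<in> carrier circle_alg" "y \<in> carrier circle_alg" for x y
    using circle_rep.m_closed[OF that] by simp
  have aa: "a \<otimes> a = \<zero>"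
  proof -
    have "a \<otimes> a = calc g \<otimes> (v \<otimes> calc g) \<otimes> v" using cl by (simp add: a_def m_assoc)
    also have "\<dots> = (calc g \<otimes> calc (\<lambda>t. g (t + \<beta>))) \<otimes> v \<otimes> v" using cl by (simp add: calc_shift[OF g] m_assoc)
    finally show ?thesis using cl by (simp add: prod disjoint calc_zero)
  qed
  have cc: "c \<otimes> c = \<zero>"
  proof -
    have "c \<otimes> c = adj A v \<otimes> (calc g \<otimes> adj A v) \<otimes> calc g" using cl by (simp add: c_def m_assoc)
    also have "\<dots> = adj A v \<otimes> (adj A v \<otimes> (calc (\<lambda>t. g (t + \<beta>)) \<otimes> calc g))"
      using cl by (simp add: calc_adj_shift[OF g] m_assoc)
    finally show ?thesis using cl by (simp add: prod disjoint calc_zero mult.commute)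
  qed
  have ab: "a \<otimes> b \<oplus> b \<otimes> a = a"
  proof -
    have "a \<otimes> b = calc g \<otimes> (v \<otimes> calc f)" using cl by (simp add: a_def b_def m_assoc)
    also have "\<dots> = calc (\<lambda>t. g t * f (t + \<beta>)) \<otimes> v"
      using cl by (simp add: calc_shift[OF f] m_assoc[symmetric] prod)
    finally have "a \<otimes> b = calc (\<lambda>t. g t * f (t + \<beta>)) \<otimes> v" .
    moreover have "b \<otimes> a = calc (\<lambda>t. f t * g t) \<otimes> v"
      using cl by (simp add: a_def b_def m_assoc[symmetric] prod)
    ultimately have "a \<otimes> b \<oplus> b \<otimes> a = calc (\<lambda>t. g t * f (t + \<beta>) + f t * g t) \<otimes> v"
      using calc_hom(1)[OF mc[OF g fs]] calc_hom(1)[OF mc[OF f g]] cl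
      by (simp add: calc_hom(3)[OF mc[OF g fs] mc[OF f g]] l_distr)
    then show ?thesis by (simp add: partition a_def)
  qed
  have bc: "b \<otimes> c \<oplus> c \<otimes> b = c"
  proof -
    have "b \<otimes> c = (calc f \<otimes> adj A v) \<otimes> calc g" using cl by (simp add: c_def b_def m_assoc)
    also have "\<dots> = adj A v \<otimes> calc (\<lambda>t. f (t + \<beta>) * g t)"
      using cl by (simp add: calc_adj_shift[OF f] m_assoc prod)
    finally have "b \<otimes> c = adj A v \<otimes> calc (\<lambda>t. f (t + \<beta>) * g t)" .
    moreover have "c \<otimes> b = adj A v \<otimes> calc (\<lambda>t. g t * f t)"
      using cl by (simp add: c_def b_def m_assoc prod)
    ultimately have "b \<otimes> c \<oplus> c \<otimes> b = adj A v \<otimes> calc (\<lambda>t. f (t + \<beta>) * g t + g t * f t)"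
      using calc_hom(1)[OF mc[OF fs g]] calc_hom(1)[OF mc[OF g f]] cl
      by (simp add: calc_hom(3)[OF mc[OF fs g] mc[OF g f]] r_distr)
    moreover have "(\<lambda>t. f (t + \<beta>) * g t + g t * f t) = g" using partition by (simp add: mult.commute fun_eq_iff)
    ultimately show ?thesis by (simp add: c_def)
  qed
  have acb: "a \<otimes> c \<oplus> b \<otimes> b \<oplus> c \<otimes> a = b"
  proof -
    have "a \<otimes> c = calc g \<otimes> ((v \<otimes> adj A v) \<otimes> calc g)" using cl by (simp add: a_def c_def m_assoc)
    then have ac: "a \<otimes> c = calc (\<lambda>t. g t * g t)" using cl by (simp add: v_unitary prod)
    have bb: "b \<otimes> b = calc (\<lambda>t. f t * f t)" by (simp add: b_def prod)
    let ?k = "\<lambda>t. g (t - \<beta>) * g (t - \<beta>)"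
    have k: "?k \<in> carrier circle_alg" using mc shift_closed[OF g, of "- \<beta>"] by simp
    have "c \<otimes> a = adj A v \<otimes> calc (\<lambda>t. g t * g t) \<otimes> v" using cl by (simp add: a_def c_def m_assoc prod[symmetric])
    also have "adj A v \<otimes> calc (\<lambda>t. g t * g t) = calc ?k \<otimes> adj A v"
      using calc_adj_shift[OF k] by simp
    also have "calc ?k \<otimes> adj A v \<otimes> v = calc ?k" using calc_hom(1)[OF k] cl by (simp add: m_assoc v_unitary)
    finally have ca: "c \<otimes> a = calc ?k" .
    have "a \<otimes> c \<oplus> b \<otimes> b \<oplus> c \<otimes> a = calc (\<lambda>t. g t * g t + f t * f t + ?k t)"
      unfolding ac bb ca
      using circle_rep.add.m_closed[OF mc[OF g g] mc[OF f f]] k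
      by (simp add: calc_hom(3)[OF mc[OF g g] mc[OF f f], symmetric] calc_hom(3)[of _ ?k, symmetric])
    then show ?thesis by (simp add: square b_def)
  qed
  define e where "e = a \<oplus> b \<oplus> c"
  \<comment> \<open>The nine products are grouped by their degree in \<open>v\<close>.\<close>
  have "e \<otimes> e = (a \<otimes> a \<oplus> c \<otimes> c) \<oplus> (a \<otimes> b \<oplus> b \<otimes> a) \<oplus> (a \<otimes> c \<oplus> b \<otimes> b \<oplus> c \<otimes> a) \<oplus> (b \<otimes> c \<oplus> c \<otimes> b)"
    unfolding e_def using closed by (simp add: l_distr r_distr a_ac)
  then have "e \<otimes> e = e" unfolding aa cc ab bc acb using closed by (simp add: e_def)
  moreover have "\<phi> e = circle_mean f"
  proof -
    have "\<phi> a = 0" unfolding a_def using trace_calc_mult[OF v_closed(1) _ g, of 0] trace_V_v by simp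
    moreover have "\<phi> c = 0"
      unfolding c_def trace_mult_commute[OF v_closed(2) calc_hom(1)[OF g]]
      using trace_calc_mult[OF v_closed(2) _ g, of 0] trace_V_v by simp
    moreover have "\<phi> b = circle_mean f"
      unfolding b_def using trace_calc_mult[OF one_closed _ f, of 1] trace_V calc_hom(1)[OF f] V_closed by simp
    ultimately show ?thesis unfolding e_def using closed by (simp add: trace_add)
  qed
  moreover have "e \<in> carrier A" unfolding e_def using closed by simp
  ultimately show ?thesis by blast
qed

end

section \<open>Bump functions for the Rieffel element\<close>

text \<open>The distance to the nearest integer. Functions built from it are automatically
  periodic.\<close>

definition int_dist :: "real \<Rightarrow> real" where
  "int_dist t = \<bar>t - of_int (round t)\<bar>"

lemma int_dist_le: "int_dist t \<le> \<bar>t - of_int m\<bar>"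
  unfolding int_dist_def by (rule round_diff_minimal)

lemma int_dist_ex: "\<exists>m. int_dist t = \<bar>t - of_int m\<bar>"
  unfolding int_dist_def by blast

lemma int_dist_le_half: "int_dist t \<le> 1 / 2"
  unfolding int_dist_def using of_int_round_abs_le[of t] by (simp add: abs_minus_commute)

lemma int_dist_diff_le: "int_dist (s - t) \<le> int_dist s + int_dist t"
proof -
  obtain m n where "int_dist s = \<bar>s - of_int m\<bar>" "int_dist t = \<bar>t - of_int n\<bar>" using int_dist_ex by metis
  then show ?thesis using int_dist_le[of "s - t" "m - n"] by simp
qed

lemma int_dist_minus: "int_dist (- t) = int_dist t"
proof -
  have "int_dist (- t) \<le> int_dist t" for t
  proof -
    obtain m where "int_dist t = \<bar>t - of_int m\<bar>" using int_dist_ex by metis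
    then show ?thesis using int_dist_le[of "- t" "- m"] by simp
  qed
  from this[of t] this[of "- t"] show ?thesis by simp
qed

lemma int_dist_add_int: "int_dist (t + of_int k) = int_dist t"
proof -
  have "int_dist (t + of_int k) \<le> int_dist t" for t k
  proof -
    obtain m where "int_dist t = \<bar>t - of_int m\<bar>" using int_dist_ex by metis
    then show ?thesis using int_dist_le[of "t + of_int k" "m + k"] by simp
  qed
  from this[of t k] this[of "t + of_int k" "- k"] show ?thesis by simp
qed

lemma int_dist_eq: "\<bar>u\<bar> \<le> 1 / 2 \<Longrightarrow> int_dist u = \<bar>u\<bar>"
proof -
  assume u: "\<bar>u\<bar> \<le> 1 / 2"
  obtain m where m: "int_dist u = \<bar>u - of_int m\<bar>" using int_dist_ex by metis
  have "\<bar>u\<bar> \<le> \<bar>u - of_int m\<bar>"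
  proof (cases "m = 0")
    case False
    then have "1 \<le> \<bar>real_of_int m\<bar>" by linarith
    then show ?thesis using u by linarith
  qed simp
  then show ?thesis using int_dist_le[of u 0] m by simp
qed

lemma int_dist_reduce: "\<exists>u m. t = u + of_int m \<and> \<bar>u\<bar> \<le> 1 / 2 \<and> int_dist t = \<bar>u\<bar>"
  using int_dist_le_half[of t] unfolding int_dist_def
  by (intro exI[of _ "t - of_int (round t)"] exI[of _ "round t"]) simp

lemma continuous_on_int_dist: "continuous_on S int_dist"
proof (rule continuous_on_subset[OF _ subset_UNIV])
  have "\<bar>int_dist s - int_dist t\<bar> \<le> \<bar>s - t\<bar>" for s t
    using int_dist_diff_le[of s "s - t"] int_dist_diff_le[of t "t - s"] int_dist_le[of "s - t" 0] int_dist_le[of "t - s" 0]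
    by (simp add: abs_le_iff)
  then have "1-lipschitz_on UNIV int_dist" by (intro lipschitz_onI) (auto simp: dist_real_def)
  then show "continuous_on UNIV int_dist" by (rule lipschitz_on_continuous_on)
qed

locale bump =
  fixes \<beta> :: real
  assumes \<beta>: "0 < \<beta>" "\<beta> < 1"
begin

text \<open>Half the distance from \<open>\<beta>\<close> to the integers. The ramps of
  \<open>plateau\<close>, where \<open>int_dist t\<close> differs from \<open>\<beta> / 2\<close> by
  at most this amount, then stay within the range from \<open>0\<close> to \<open>1 / 2\<close> of
  \<open>int_dist\<close>, and rotation by \<open>\<beta>\<close> moves an arc of this radius off
  itself.\<close>

definition \<epsilon> :: real where "\<epsilon> = min \<beta> (1 - \<beta>) / 2"

lemma \<epsilon>: "0 < \<epsilon>" "\<epsilon> \<le> \<beta> / 2" "\<epsilon> \<le> (1 - \<beta>) / 2" "int_dist \<beta> \<ge> 2 * \<epsilon>"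
proof -
  show "0 < \<epsilon>" "\<epsilon> \<le> \<beta> / 2" "\<epsilon> \<le> (1 - \<beta>) / 2" using \<beta> by (auto simp: \<epsilon>_def)
  show "int_dist \<beta> \<ge> 2 * \<epsilon>"
  proof (cases "\<beta> \<le> 1 / 2")
    case True
    then show ?thesis using \<beta> int_dist_eq[of \<beta>] by (simp add: \<epsilon>_def)
  next
    case False
    then show ?thesis using \<beta> int_dist_eq[of "\<beta> - 1"] int_dist_add_int[of "\<beta> - 1" 1] by (simp add: \<epsilon>_def)
  qed
qed

text \<open>\<open>plateau\<close> is \<open>1\<close> on an arc of length \<open>\<beta> - 2 \<epsilon>\<close> centred at \<open>0\<close>, and descends linearly to \<open>0\<close> on two arcs
  of length \<open>2 \<epsilon>\<close>; \<open>peak\<close> is supported on one of these.\<close>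

definition plateau :: "real \<Rightarrow> real" where
  "plateau t = max 0 (min 1 (1 / 2 + (\<beta> / 2 - int_dist t) / (2 * \<epsilon>)))"

definition peak :: "real \<Rightarrow> real" where
  "peak t = sqrt (max 0 (1 / 4 - (int_dist (t + \<beta> / 2) / (2 * \<epsilon>))\<^sup>2))"

lemma peak_eq_0: "int_dist (t + \<beta> / 2) \<ge> \<epsilon> \<Longrightarrow> peak t = 0"
proof -
  assume "int_dist (t + \<beta> / 2) \<ge> \<epsilon>"
  then have "int_dist (t + \<beta> / 2) / (2 * \<epsilon>) \<ge> 1 / 2" using \<epsilon>(1) by (simp add: field_simps)
  then have "(int_dist (t + \<beta> / 2) / (2 * \<epsilon>))\<^sup>2 \<ge> (1 / 2)\<^sup>2" by (intro power_mono) auto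
  then show "peak t = 0" by (simp add: peak_def power2_eq_square)
qed

lemma peak_sq: "peak t * peak t = max 0 (1 / 4 - (int_dist (t + \<beta> / 2) / (2 * \<epsilon>))\<^sup>2)"
  by (simp add: peak_def)

text \<open>The support of \<open>peak\<close> has radius \<open>\<epsilon>\<close> about its
  centre, and rotation by \<open>\<beta>\<close> moves it by at least
  \<open>2 * \<epsilon>\<close>.\<close>

lemma peak_disjoint: "peak t * peak (t + \<beta>) = 0"
proof (rule ccontr)
  assume "peak t * peak (t + \<beta>) \<noteq> 0"
  then have "int_dist (t + \<beta> / 2) < \<epsilon>" "int_dist (t + \<beta> + \<beta> / 2) < \<epsilon>"
    using peak_eq_0[of t] peak_eq_0[of "t + \<beta>"] by fastforce+
  then show False using int_dist_diff_le[of "t + \<beta> + \<beta> / 2" "t + \<beta> / 2"] \<epsilon>(4) by simp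
qed

text \<open>Where \<open>peak t\<close> is nonzero, \<open>t\<close> lies on the rising ramp and
  \<open>t + \<beta>\<close> at the corresponding place of the falling ramp, so the two values of
  \<open>plateau\<close> add up to \<open>1\<close>.\<close>

lemma peak_partition: "peak t * plateau (t + \<beta>) + plateau t * peak t = peak t"
proof (cases "int_dist (t + \<beta> / 2) < \<epsilon>")
  case False
  then show ?thesis by (simp add: peak_eq_0)
next
  case True
  obtain s m where s: "t + \<beta> / 2 = s + of_int m" "int_dist (t + \<beta> / 2) = \<bar>s\<bar>" using int_dist_reduce by blast
  then have se: "\<bar>s\<bar> < \<epsilon>" using True by simp
  have t: "t = s - \<beta> / 2 + of_int m" "t + \<beta> = s + \<beta> / 2 + of_int m" using s(1) by simp_all
  have "\<bar>s - \<beta> / 2\<bar> \<le> 1 / 2" "\<bar>s + \<beta> / 2\<bar> \<le> 1 / 2"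
    using se \<epsilon>(1-3) unfolding abs_le_iff abs_less_iff by (auto simp: field_simps)
  then have "int_dist t = \<bar>s - \<beta> / 2\<bar>" "int_dist (t + \<beta>) = \<bar>s + \<beta> / 2\<bar>"
    using t int_dist_eq int_dist_add_int by metis+
  then have "int_dist t = \<beta> / 2 - s" "int_dist (t + \<beta>) = \<beta> / 2 + s"
    using se \<epsilon>(1,2) unfolding abs_if by (auto simp: field_simps)
  moreover have "\<bar>s / (2 * \<epsilon>)\<bar> \<le> 1 / 2" using se \<epsilon>(1) by (simp add: abs_mult field_simps)
  ultimately have "plateau t = 1 / 2 + s / (2 * \<epsilon>)" "plateau (t + \<beta>) = 1 / 2 - s / (2 * \<epsilon>)"
    unfolding plateau_def abs_le_iff by auto
  then have "plateau (t + \<beta>) + plateau t = 1" by simp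
  then have "peak t * (plateau (t + \<beta>) + plateau t) = peak t" by simp
  then show ?thesis by (simp add: ring_distribs mult.commute)
qed

text \<open>On a ramp, with \<open>y\<close> between \<open>-1/2\<close> and \<open>1/2\<close>, the
  value \<open>c = 1 / 2 + y\<close> has \<open>c - c\<^sup>2 = 1 / 4 - y\<^sup>2\<close>, which is
  why \<open>peak\<close> is a square root of this expression. Off the ramps the clamped value is
  \<open>0\<close> or \<open>1\<close> and the correction vanishes.\<close>

lemma clamp_square: "max 0 (min 1 (1 / 2 + y)) * max 0 (min 1 (1 / 2 + y)) + max 0 (1 / 4 - y\<^sup>2) = max 0 (min 1 (1 / 2 + y))"
  for y :: real
proof (cases "\<bar>y\<bar> \<le> 1 / 2")
  case True
  then have "y\<^sup>2 \<le> (1 / 2)\<^sup>2" by (simp add: power2_le_iff_abs_le)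
  then show ?thesis using True by (simp add: power2_eq_square algebra_simps abs_le_iff)
next
  case False
  then have "y\<^sup>2 \<ge> (1 / 2)\<^sup>2" by (simp add: abs_le_square_iff[symmetric])
  then show ?thesis using False by (auto simp: power2_eq_square abs_if split: if_splits)
qed

text \<open>\<open>peak t\<close> corrects the failure of \<open>plateau\<close> to be idempotent on
  the ramp at \<open>- \<beta> / 2\<close>, and \<open>peak (t - \<beta>)\<close> does so on the
  ramp at \<open>\<beta> / 2\<close>.\<close>

lemma peak_square:
  "peak t * peak t + plateau t * plateau t + peak (t - \<beta>) * peak (t - \<beta>) = plateau t"
proof -
  define P where "P = (\<lambda>s. max 0 (1 / 4 - (int_dist s / (2 * \<epsilon>))\<^sup>2))"
  have P0: "P s = 0" if "int_dist s \<ge> \<epsilon>" for s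
    using peak_eq_0[of "s - \<beta> / 2"] peak_sq[of "s - \<beta> / 2"] that by (simp add: P_def)
  obtain u m where u: "t = u + of_int m" "\<bar>u\<bar> \<le> 1 / 2" "int_dist t = \<bar>u\<bar>" using int_dist_reduce by blast
  \<comment> \<open>Everything is symmetric under reflection, so a representative
    \<open>u \<le> 0\<close> may be assumed, where only the ramp at \<open>- \<beta> / 2\<close> can
    contribute.\<close>
  have main: "P (u + \<beta> / 2) + plateau t * plateau t = plateau t \<and> P (u - \<beta> / 2) = 0"
    if u: "u \<le> 0" "- 1 / 2 \<le> u" "int_dist t = - u" for u
  proof
    have d: "int_dist (u + \<beta> / 2) = \<bar>u + \<beta> / 2\<bar>" using u \<beta> by (intro int_dist_eq) linarith
    have "P (u + \<beta> / 2) = max 0 (1 / 4 - ((\<beta> / 2 + u) / (2 * \<epsilon>))\<^sup>2)"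
      unfolding P_def d by (simp add: power_divide add.commute)
    then show "P (u + \<beta> / 2) + plateau t * plateau t = plateau t"
      using clamp_square[of "(\<beta> / 2 + u) / (2 * \<epsilon>)"] by (simp add: plateau_def u(3))
    obtain k where "int_dist (u - \<beta> / 2) = \<bar>u - \<beta> / 2 - of_int k\<bar>" using int_dist_ex by blast
    moreover have "\<bar>u - \<beta> / 2 - of_int k\<bar> \<ge> \<epsilon>"
    \<comment> \<open>Integers \<open>k \<ge> 0\<close> are kept away by
      \<open>\<epsilon> \<le> \<beta> / 2\<close>, negative ones by
      \<open>\<epsilon> \<le> (1 - \<beta>) / 2\<close>.\<close>
    proof (cases "k \<ge> 0")
      case True
      then show ?thesis using u \<epsilon> by linarith
    next
      case False
      then have "real_of_int k \<le> - 1" by linarith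
      then have "\<epsilon> \<le> u - \<beta> / 2 - of_int k" using u(2) \<epsilon>(3) by (simp add: field_simps)
      then show ?thesis by linarith
    qed
    ultimately show "P (u - \<beta> / 2) = 0" by (intro P0) simp
  qed
  have P1: "peak t * peak t = P (u + \<beta> / 2)" and P2: "peak (t - \<beta>) * peak (t - \<beta>) = P (u - \<beta> / 2)"
    using int_dist_add_int[of "u + \<beta> / 2" m] int_dist_add_int[of "u - \<beta> / 2" m]
    unfolding peak_sq P_def u(1) by (simp_all add: algebra_simps)
  have Pm: "P (- s) = P s" for s unfolding P_def int_dist_minus ..
  show ?thesis
  proof (cases "u \<le> 0")
    case True
    then show ?thesis unfolding P1 P2 using main[of u] u by simp
  next
    case False
    then show ?thesis unfolding P1 P2 using main[of "- u"] u Pm[of "u - \<beta> / 2"] Pm[of "u + \<beta> / 2"] by simp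
  qed
qed

lemma plateau_closed: "(\<lambda>t. of_real (plateau t)) \<in> carrier circle_alg"
  and peak_closed: "(\<lambda>t. of_real (peak t)) \<in> carrier circle_alg"
proof -
  have per: "int_dist (t + 1) = int_dist t" "int_dist (t + 1 + s) = int_dist (t + s)" for t s
    using int_dist_add_int[of t 1] int_dist_add_int[of "t + s" 1] by (simp_all add: algebra_simps)
  have shift: "continuous_on UNIV (\<lambda>t. int_dist (t + \<beta> / 2))"
    by (intro continuous_on_compose2[OF continuous_on_int_dist[of UNIV]] continuous_intros) auto
  show "(\<lambda>t. of_real (plateau t)) \<in> carrier circle_alg"
    unfolding circle_carrier plateau_def per using \<epsilon>(1)
    by (auto intro!: continuous_intros continuous_on_int_dist)
  show "(\<lambda>t. of_real (peak t)) \<in> carrier circle_alg"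
    unfolding circle_carrier peak_def per using \<epsilon>(1)
    by (auto intro!: continuous_intros shift)
qed

text \<open>The area of a trapezoid: height \<open>1\<close> up to \<open>a\<close>, then a linear
  descent to \<open>0\<close> at \<open>b\<close>.\<close>

lemma has_integral_clamp:
  fixes a b :: real
  assumes "a < b" "0 \<le> a" "b \<le> 1 / 2"
  shows "((\<lambda>t. max 0 (min 1 ((b - t) / (b - a)))) has_integral (a + b) / 2) {0..1 / 2}"
proof -
  have "((\<lambda>t. 1) has_integral a) {0..a}" using has_integral_const_real[of "1::real" 0 a] assms by simp
  then have 1: "((\<lambda>t. max 0 (min 1 ((b - t) / (b - a)))) has_integral a) {0..a}"
    by (rule has_integral_eq[rotated]) (use assms in \<open>auto simp: min_def max_def field_simps\<close>)
  have prim: "((\<lambda>t. (b - t) / (b - a)) has_integral (- ((b - b)\<^sup>2 / (2 * (b - a))) - - ((b - a)\<^sup>2 / (2 * (b - a))))) {a..b}"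
  proof (rule fundamental_theorem_of_calculus)
    show "((\<lambda>t. - ((b - t)\<^sup>2 / (2 * (b - a)))) has_vector_derivative (b - t) / (b - a)) (at t within {a..b})" for t
      unfolding has_real_derivative_iff_has_vector_derivative[symmetric]
    proof -
      define c where "c = b - a"
      have "c > 0" using assms by (simp add: c_def)
      then show "((\<lambda>t. - ((b - t)\<^sup>2 / (2 * (b - a)))) has_real_derivative (b - t) / (b - a)) (at t within {a..b})"
        unfolding c_def[symmetric] by (auto intro!: derivative_eq_intros simp: field_simps)
    qed
  qed (use assms in simp)
  have eval: "- ((b - b)\<^sup>2 / (2 * (b - a))) - - ((b - a)\<^sup>2 / (2 * (b - a))) = (b - a) / 2"
  proof -
    have "c\<^sup>2 / (2 * c) = c / 2" if "c > 0" for c :: real using that by (simp add: power2_eq_square)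
    from this[of "b - a"] show ?thesis using assms by simp
  qed
  have "((\<lambda>t. (b - t) / (b - a)) has_integral (b - a) / 2) {a..b}" using prim unfolding eval .
  then have 2: "((\<lambda>t. max 0 (min 1 ((b - t) / (b - a)))) has_integral (b - a) / 2) {a..b}"
    by (rule has_integral_eq[rotated]) (use assms in \<open>auto simp: min_def max_def field_simps\<close>)
  have "((\<lambda>t. 0) has_integral (0::real)) {b..1 / 2}" by simp
  then have 3: "((\<lambda>t. max 0 (min 1 ((b - t) / (b - a)))) has_integral 0) {b..1 / 2}"
    by (rule has_integral_eq[rotated]) (use assms in \<open>auto simp: min_def max_def field_simps\<close>)
  have total: "a + (b - a) / 2 + 0 = (a + b) / 2" by (simp add: field_simps)
  have "((\<lambda>t. max 0 (min 1 ((b - t) / (b - a)))) has_integral a + (b - a) / 2 + 0) {0..1 / 2}"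
    by (rule has_integral_combine[OF _ _ has_integral_combine[OF _ _ 1 2] 3]) (use assms in auto)
  then show ?thesis unfolding total .
qed

text \<open>On the first half period \<open>int_dist\<close> is the identity, and the trapezoid with
  corners \<open>\<beta> / 2 - \<epsilon>\<close> and \<open>\<beta> / 2 + \<epsilon>\<close> has
  area \<open>\<beta> / 2\<close>. The second half is its mirror image.\<close>

lemma circle_mean_plateau: "circle_mean (\<lambda>t. of_real (plateau t)) = of_real \<beta>"
proof -
  let ?F = "\<lambda>t. max 0 (min 1 ((\<beta> / 2 + \<epsilon> - t) / (\<beta> / 2 + \<epsilon> - (\<beta> / 2 - \<epsilon>))))"
  have F: "(?F has_integral \<beta> / 2) {0..1 / 2}"
    using has_integral_clamp[of "\<beta> / 2 - \<epsilon>" "\<beta> / 2 + \<epsilon>"] \<epsilon> by simp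
  have pF: "plateau t = ?F (int_dist t)" for t
  proof -
    have "1 / 2 + (\<beta> / 2 - int_dist t) / (2 * \<epsilon>) = (\<beta> / 2 + \<epsilon> - int_dist t) / (\<beta> / 2 + \<epsilon> - (\<beta> / 2 - \<epsilon>))"
      using \<epsilon>(1) by (simp add: field_simps)
    then show ?thesis unfolding plateau_def by simp
  qed
  have left: "(plateau has_integral \<beta> / 2) {0..1 / 2}"
    by (rule has_integral_eq[OF _ F]) (simp add: pF int_dist_eq)
  \<comment> \<open>The reflection \<open>t \<mapsto> 1 - t\<close>, under which
    \<open>plateau\<close> is invariant.\<close>
  have "((\<lambda>t. plateau ((- 1) *\<^sub>R t + 1)) has_integral \<beta> / 2)
      ((\<lambda>t. (1 / - 1) *\<^sub>R t + - ((1 / - 1) *\<^sub>R 1)) ` cbox 0 (1 / 2))"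
    using has_integral_affinity[of plateau "\<beta> / 2" 0 "1 / 2" "- 1" 1] left by simp
  moreover have "(\<lambda>t::real. 1 - t) ` {0..1 / 2} = {1 / 2..1}"
    by (auto simp: image_iff intro!: bexI[of _ "1 - _"])
  moreover have "plateau (1 - t) = plateau t" for t
    using int_dist_add_int[of "- t" 1] by (simp add: plateau_def int_dist_minus)
  ultimately have right: "(plateau has_integral \<beta> / 2) {1 / 2..1}" by simp
  have "(plateau has_integral \<beta> / 2 + \<beta> / 2) {0..1}"
    by (rule has_integral_combine[OF _ _ left right]) auto
  then have "((of_real \<circ> plateau) has_integral complex_of_real \<beta>) {0..1}"
    using has_integral_linear[OF _ bounded_linear_of_real, of plateau "\<beta> / 2 + \<beta> / 2" "{0..1}"] by simp
  then show ?thesis unfolding circle_mean_def comp_def by (rule integral_unique)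
qed

end

lemma (in rotation_pair) rieffel_idempotent:
  assumes "0 < \<beta>" "\<beta> < 1"
  shows "\<exists>e\<in>carrier A. e \<otimes> e = e \<and> \<phi> e = of_real \<beta>"
proof -
  interpret bump \<beta> by unfold_locales fact+
  have "\<exists>e\<in>carrier A. e \<otimes> e = e \<and> \<phi> e = circle_mean (\<lambda>t. of_real (plateau t))"
  proof (rule idempotentI[OF plateau_closed peak_closed])
    show "complex_of_real (peak t) * of_real (peak (t + \<beta>)) = 0" for t
      unfolding of_real_mult[symmetric] peak_disjoint by simp
    show "complex_of_real (peak t) * of_real (plateau (t + \<beta>)) + of_real (plateau t) * of_real (peak t) = of_real (peak t)" for t
      unfolding of_real_mult[symmetric] of_real_add[symmetric] peak_partition ..
    show "complex_of_real (peak t) * of_real (peak t) + of_real (plateau t) * of_real (plateau t)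
        + of_real (peak (t - \<beta>)) * of_real (peak (t - \<beta>)) = of_real (plateau t)" for t
      unfolding of_real_mult[symmetric] of_real_add[symmetric] peak_square ..
  qed
  then show ?thesis unfolding circle_mean_plateau .
qed

section \<open>Noncommutative solenoids\<close>

locale solenoid_parameter =
  fixes p :: nat and \<alpha> :: "nat \<Rightarrow> real"
  assumes p_gt_1: "1 < p" and \<alpha>: "\<alpha> \<in> Xi p" and irrational: "\<alpha> 0 \<notin> \<rat>"
begin

lemma p: "p > 0"
  using p_gt_1 by simp

lemma Zinv_fraction: "of_int z / of_nat p ^ k \<in> Zinv p"
  unfolding Zinv_def by blast

lemma Zinv_int: "of_int z \<in> Zinv p"
  using Zinv_fraction[of z 0] by simp

lemma Zinv_0: "0 \<in> Zinv p"
  using Zinv_int[of 0] by simp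

lemma Zinv_common:
  assumes "r \<in> Zinv p" "s \<in> Zinv p"
  shows "\<exists>a b k. r = of_int a / of_nat p ^ k \<and> s = of_int b / of_nat p ^ k"
proof -
  obtain z k w l where rs: "r = of_int z / of_nat p ^ k" "s = of_int w / of_nat p ^ l"
    using assms unfolding Zinv_def by blast
  have "r = of_int (z * int p ^ l) / of_nat p ^ (k + l)" "s = of_int (w * int p ^ k) / of_nat p ^ (k + l)"
    using p by (simp_all add: rs power_add)
  then show ?thesis by blast
qed

lemma Zinv_add: "r \<in> Zinv p \<Longrightarrow> s \<in> Zinv p \<Longrightarrow> r + s \<in> Zinv p"
  using Zinv_common[of r s] Zinv_fraction by (metis add_divide_distrib of_int_add)

lemma Zinv_uminus: "r \<in> Zinv p \<Longrightarrow> - r \<in> Zinv p"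
  unfolding Zinv_def by clarify (metis minus_divide_left of_int_minus)

lemma irrational_alpha: "\<alpha> k \<notin> \<rat>"
proof
  assume "\<alpha> k \<in> \<rat>"
  moreover obtain j :: int where "real p ^ k * \<alpha> k = \<alpha> 0 + of_int j"
    using Xi_power[OF \<alpha>, of k 0] by auto
  ultimately have "\<alpha> 0 = real p ^ k * \<alpha> k - of_int j" "real p ^ k * \<alpha> k - of_int j \<in> \<rat>"
    by (simp, intro Rats_diff Rats_mult Rats_power) auto
  then show False using irrational by simp
qed

lemma irrational_multiple: "a \<noteq> 0 \<Longrightarrow> \<alpha> k * of_int a \<notin> \<rat>"
proof
  assume a: "a \<noteq> 0" and r: "\<alpha> k * of_int a \<in> \<rat>"
  have "\<alpha> k * of_int a / of_int a \<in> \<rat>" using r by (intro Rats_divide) auto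
  then show False using a irrational_alpha[of k] by simp
qed

lemma cis_irrational: "x \<notin> \<rat> \<Longrightarrow> cis (2 * pi * x) \<noteq> 1"
proof
  assume x: "x \<notin> \<rat>" and "cis (2 * pi * x) = 1"
  then have "cos (2 * pi * x) = 1" by (simp add: complex_eq_iff)
  then obtain n :: int where "2 * pi * x = of_int n * 2 * pi" using cos_one_2pi_int by blast
  then have "x = of_int n" by simp
  then show False using x by simp
qed

lemma Psi_value:
  assumes "fst g = of_int a / of_nat p ^ k" "snd h = of_int b / of_nat p ^ l"
  shows "Psi p \<alpha> g h = cis (2 * pi * \<alpha> (k + l) * of_int a * of_int b)"
proof -
  \<comment> \<open>\<open>Psi\<close> sees only the first coordinate of \<open>g\<close> and the
    second of \<open>h\<close>; the others are set to zero to obtain fractions in all four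
    places.\<close>
  have "Psi p \<alpha> g h = Psi p \<alpha> (of_int a / of_nat p ^ k, of_int 0 / of_nat p ^ 0) (of_int 0 / of_nat p ^ 0, of_int b / of_nat p ^ l)"
    by (simp only: Psi_def assms fst_conv snd_conv)
  also have "\<dots> = exp (2 * \<i> * of_real pi * of_real (\<alpha> (k + l)) * of_int a * of_int b)"
    by (rule Psi_fractions[OF p \<alpha>])
  finally show ?thesis by (simp add: cis_conv_exp mult_ac)
qed

lemma Psi_zero_left: "fst g = 0 \<Longrightarrow> snd h \<in> Zinv p \<Longrightarrow> Psi p \<alpha> g h = 1"
  using Psi_value[of g 0 0 h] unfolding Zinv_def by fastforce

lemma Psi_zero_right: "fst g \<in> Zinv p \<Longrightarrow> snd h = 0 \<Longrightarrow> Psi p \<alpha> g h = 1"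
  using Psi_value[of g _ _ h 0 0] unfolding Zinv_def by fastforce

text \<open>\<open>Psi_value\<close> allows fractions that are not reduced, so both summands can be
  given a common denominator and additivity becomes additivity of numerators.\<close>

lemma bicharacter_Psi: "bicharacter (Zinv p \<times> Zinv p) (Psi p \<alpha>)"
proof
  show "0 \<in> Zinv p \<times> Zinv p" by (simp add: zero_prod_def Zinv_0)
  fix g g' h :: "rat \<times> rat"
  assume g: "g \<in> Zinv p \<times> Zinv p" and g': "g' \<in> Zinv p \<times> Zinv p"
  show "g + g' \<in> Zinv p \<times> Zinv p" using g g' by (auto intro: Zinv_add)
  show "- g \<in> Zinv p \<times> Zinv p" using g by (auto intro: Zinv_uminus)
  show "cmod (Psi p \<alpha> g g') = 1"
  proof -
    obtain a k b l where "fst g = of_int a / of_nat p ^ k" "snd g' = of_int b / of_nat p ^ l"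
      using g g' unfolding Zinv_def by fastforce
    then show ?thesis by (simp add: Psi_value)
  qed
  assume h: "h \<in> Zinv p \<times> Zinv p"
  show "Psi p \<alpha> (g + g') h = Psi p \<alpha> g h * Psi p \<alpha> g' h"
  proof -
    obtain a b k where ab: "fst g = of_int a / of_nat p ^ k" "fst g' = of_int b / of_nat p ^ k"
      using Zinv_common[of "fst g" "fst g'"] g g' unfolding mem_Times_iff by blast
    obtain c l where c: "snd h = of_int c / of_nat p ^ l" using h unfolding Zinv_def by fastforce
    have "fst (g + g') = of_int (a + b) / of_nat p ^ k" using ab by (simp add: add_divide_distrib)
    from Psi_value[OF this c] show ?thesis
      by (simp add: Psi_value[OF ab(1) c] Psi_value[OF ab(2) c] cis_mult ring_distribs)
  qed
  show "Psi p \<alpha> g (g' + h) = Psi p \<alpha> g g' * Psi p \<alpha> g h"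
  proof -
    obtain a b k where ab: "snd g' = of_int a / of_nat p ^ k" "snd h = of_int b / of_nat p ^ k"
      using Zinv_common[of "snd g'" "snd h"] g' h unfolding mem_Times_iff by blast
    obtain c l where c: "fst g = of_int c / of_nat p ^ l" using g unfolding Zinv_def by fastforce
    have "snd (g' + h) = of_int (a + b) / of_nat p ^ k" using ab by (simp add: add_divide_distrib)
    from Psi_value[OF c this] show ?thesis
      by (simp add: Psi_value[OF c ab(1)] Psi_value[OF c ab(2)] cis_mult ring_distribs)
  qed
qed

text \<open>\<open>(0, 1)\<close> or \<open>(1, 0)\<close> detects a nonzero coordinate of
  \<open>g\<close>: in one order the value of \<open>Psi\<close> is \<open>1\<close>, in the other
  it is \<open>cis\<close> at \<open>2 * pi\<close> times an irrational number.\<close>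

lemma Psi_nondegenerate:
  assumes g: "g \<in> Zinv p \<times> Zinv p" "g \<noteq> 0"
  shows "\<exists>h\<in>Zinv p \<times> Zinv p. Psi p \<alpha> g h \<noteq> Psi p \<alpha> h g"
proof (cases "fst g = 0")
  case False
  obtain a k where a: "fst g = of_int a / of_nat p ^ k" using g unfolding Zinv_def by fastforce
  then have "a \<noteq> 0" using False by auto
  have "Psi p \<alpha> g (0, 1) = cis (2 * pi * (\<alpha> k * of_int a))"
    using Psi_value[OF a, of "(0, 1)" 1 0] by (simp add: mult_ac)
  then have "Psi p \<alpha> g (0, 1) \<noteq> 1" using cis_irrational irrational_multiple \<open>a \<noteq> 0\<close> by auto
  moreover have "Psi p \<alpha> (0, 1) g = 1" using g by (intro Psi_zero_left) auto
  ultimately show ?thesis using Zinv_0 Zinv_int[of 1] by (intro bexI[of _ "(0, 1)"]) auto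
next
  case True
  obtain a k where a: "snd g = of_int a / of_nat p ^ k" using g unfolding Zinv_def by fastforce
  then have "a \<noteq> 0" using True g(2) by (auto simp: prod_eq_iff)
  have "Psi p \<alpha> (1, 0) g = cis (2 * pi * (\<alpha> k * of_int a))"
    using Psi_value[OF _ a, of "(1, 0)" 1 0] by (simp add: mult_ac)
  then have "Psi p \<alpha> (1, 0) g \<noteq> 1" using cis_irrational irrational_multiple \<open>a \<noteq> 0\<close> by auto
  moreover have "Psi p \<alpha> g (1, 0) = 1" using g by (intro Psi_zero_right) auto
  ultimately show ?thesis using Zinv_0 Zinv_int[of 1] by (intro bexI[of _ "(1, 0)"]) auto
qed

section \<open>The trace on the group \<open>QJ\<close>\<close>

text \<open>The homomorphism \<open>QJ \<rightarrow> \<real>\<close> taking the value \<open>1\<close> at \<open>(1, 0)\<close> and \<open>\<alpha> k\<close> at \<open>(0, 1 / p\<^sup>k)\<close>.\<close>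

definition QJ_trace :: "int \<times> rat \<Rightarrow> real" where
  "QJ_trace = (\<lambda>(z, r). of_int z + of_rat r * (\<alpha> 0 + of_int (J p \<alpha> (pexp p r))))"

text \<open>For a reduced fraction \<open>J_eq\<close> gives
  \<open>\<alpha> 0 + J p \<alpha> k = p ^ k * \<alpha> k\<close>, and the denominator
  cancels.\<close>

lemma QJ_trace_fraction:
  assumes "pexp p (of_int q / of_nat p ^ k) = k"
  shows "QJ_trace (z, of_int q / of_nat p ^ k) = of_int z + of_int q * \<alpha> k"
  using assms p by (simp add: QJ_trace_def J_eq[OF \<alpha>] of_rat_divide of_rat_power)

lemma Zinv_mult_power_iff:
  assumes "r \<in> Zinv p"
  shows "r * of_nat p ^ n \<in> \<int> \<longleftrightarrow> pexp p r \<le> n"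
proof
  assume "r * of_nat p ^ n \<in> \<int>"
  then show "pexp p r \<le> n" unfolding pexp_def by (rule Least_le)
next
  assume "pexp p r \<le> n"
  then obtain c where "n = pexp p r + c" using le_Suc_ex by blast
  then have "r * of_nat p ^ n = (r * of_nat p ^ pexp p r) * of_nat p ^ c" by (simp add: power_add)
  then show "r * of_nat p ^ n \<in> \<int>" using pexp_Ints[OF p assms] by (metis Ints_mult Ints_of_nat of_nat_power)
qed

text \<open>The ultrametric property of denominators: if the exponents differ, the larger one
  survives in the sum.\<close>

lemma pexp_add:
  assumes "r \<in> Zinv p" "s \<in> Zinv p" "pexp p r < pexp p s"
  shows "pexp p (r + s) = pexp p s"
proof (rule antisym)
  have rs: "r + s \<in> Zinv p" by (intro Zinv_add assms)
  have "(r + s) * of_nat p ^ pexp p s \<in> \<int>"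
    unfolding distrib_right using assms Zinv_mult_power_iff by (intro Ints_add) auto
  then show "pexp p (r + s) \<le> pexp p s" using Zinv_mult_power_iff[OF rs] by simp
  show "pexp p s \<le> pexp p (r + s)"
  proof (rule ccontr)
    assume "\<not> pexp p s \<le> pexp p (r + s)"
    define n where "n = max (pexp p (r + s)) (pexp p r)"
    have "(r + s) * of_nat p ^ n \<in> \<int>" "r * of_nat p ^ n \<in> \<int>"
      using Zinv_mult_power_iff[OF rs] Zinv_mult_power_iff[OF assms(1)] by (auto simp: n_def)
    then have "(r + s) * of_nat p ^ n - r * of_nat p ^ n \<in> \<int>" by (rule Ints_diff)
    then have "s * of_nat p ^ n \<in> \<int>" by (simp add: algebra_simps)
    then have "pexp p s \<le> n" using Zinv_mult_power_iff[OF assms(2)] by simp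
    then show False using \<open>\<not> pexp p s \<le> pexp p (r + s)\<close> assms(3) by (simp add: n_def)
  qed
qed

lemma QJ_mult: "(z, r) \<otimes>\<^bsub>QJ p \<alpha>\<^esub> (w, s) = (z + w + xi p \<alpha> r s, r + s)"
  by (simp add: QJ_def)

lemma QJ_carrier: "(z, r) \<in> carrier (QJ p \<alpha>) \<longleftrightarrow> r \<in> Zinv p"
  by (simp add: QJ_def)

text \<open>The cocycle \<open>xi\<close> is by construction the defect of additivity of the second
  summand in \<open>QJ_trace\<close>. The three cases of \<open>xi_rat\<close> record which exponent
  the sum \<open>r + s\<close> has.\<close>

lemma QJ_trace_mult:
  assumes r: "r \<in> Zinv p" and s: "s \<in> Zinv p"
  shows "QJ_trace ((z, r) \<otimes>\<^bsub>QJ p \<alpha>\<^esub> (w, s)) = QJ_trace (z, r) + QJ_trace (w, s)"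
proof -
  have xi: "real_of_int (xi p \<alpha> r s) = of_rat (xi_rat p \<alpha> r s)"
    using arg_cong[OF xi_eq[OF p \<alpha> r s], of of_rat] by simp
  consider "pexp p r < pexp p s" | "pexp p s < pexp p r" | "pexp p r = pexp p s" by linarith
  then show ?thesis
  proof cases
    case 1
    then have "real_of_int (xi p \<alpha> r s) = - of_rat r * of_int (J p \<alpha> (pexp p s) - J p \<alpha> (pexp p r))"
      unfolding xi by (simp add: xi_rat_def of_rat_mult of_rat_minus of_rat_diff)
    then show ?thesis using pexp_add[OF r s 1] by (simp add: QJ_mult QJ_trace_def of_rat_add algebra_simps)
  next
    case 2
    then have "real_of_int (xi p \<alpha> r s) = - of_rat s * of_int (J p \<alpha> (pexp p r) - J p \<alpha> (pexp p s))"
      unfolding xi by (simp add: xi_rat_def of_rat_mult of_rat_minus of_rat_diff)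
    then show ?thesis using pexp_add[OF s r 2] by (simp add: QJ_mult QJ_trace_def of_rat_add algebra_simps)
  next
    case 3
    then have "real_of_int (xi p \<alpha> r s) = (of_rat r + of_rat s) * of_int (J p \<alpha> (pexp p r) - J p \<alpha> (pexp p (r + s)))"
      unfolding xi by (simp add: xi_rat_def of_rat_mult of_rat_add of_rat_diff)
    then show ?thesis using 3 by (simp add: QJ_mult QJ_trace_def of_rat_add algebra_simps)
  qed
qed

text \<open>The numbers \<open>1\<close> and \<open>\<alpha> 0\<close> are linearly independent over
  the rationals, and the coefficient of \<open>\<alpha> 0\<close> is the second component.\<close>

lemma QJ_trace_inj:
  assumes "QJ_trace (z, r) = QJ_trace (w, s)"
  shows "(z, r) = (w, s)"
proof -
  have "r = s"
  proof (rule ccontr)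
    assume "r \<noteq> s"
    define d :: real where "d = of_rat r - of_rat s"
    have d: "d \<noteq> 0" "d \<in> \<rat>" using \<open>r \<noteq> s\<close> unfolding d_def by (auto simp: of_rat_eq_iff)
    have "\<alpha> 0 * d = of_int w + of_rat s * of_int (J p \<alpha> (pexp p s)) - of_int z - of_rat r * of_int (J p \<alpha> (pexp p r))"
      using assms unfolding QJ_trace_def d_def by (simp add: algebra_simps)
    then have "\<alpha> 0 * d \<in> \<rat>" by (auto intro!: Rats_diff Rats_add Rats_mult)
    then have "\<alpha> 0 * d / d \<in> \<rat>" using d by (intro Rats_divide)
    then show False using d irrational by simp
  qed
  then show ?thesis using assms by (simp add: QJ_trace_def)
qed

lemma xi_zero_left: "xi p \<alpha> 0 r = 0"
proof -
  have "pexp p 0 = 0" unfolding pexp_def by (rule Least_eq_0) simp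
  then have "xi_rat p \<alpha> 0 r = 0" by (auto simp: xi_rat_def Let_def)
  then show ?thesis by (simp add: xi_def)
qed

text \<open>Closure under cancellation stands in for closure under inverses, so inverses in
  \<open>QJ p \<alpha>\<close> never have to be computed.\<close>

lemma QJ_generators:
  assumes mult: "\<And>a b. a \<in> S \<Longrightarrow> b \<in> S \<Longrightarrow> a \<otimes>\<^bsub>QJ p \<alpha>\<^esub> b \<in> S"
    and cancel: "\<And>a b. a \<in> carrier (QJ p \<alpha>) \<Longrightarrow> b \<in> S \<Longrightarrow> a \<otimes>\<^bsub>QJ p \<alpha>\<^esub> b \<in> S \<Longrightarrow> a \<in> S"
    and one: "(1, 0) \<in> S" and frac: "\<And>k. (0, 1 / of_nat p ^ k) \<in> S"
  shows "carrier (QJ p \<alpha>) \<subseteq> S"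
proof -
  have c0: "(z, 0) \<in> carrier (QJ p \<alpha>)" for z by (simp add: QJ_carrier Zinv_0)
  have ints: "(z, 0) \<in> S" for z
  proof (induction z rule: int_induct[where k = 1])
    case base then show ?case by (rule one)
  next
    case (step1 i) then show ?case using mult[OF step1(2) one] by (simp add: QJ_mult xi_zero_left)
  next
    case (step2 i) then show ?case using cancel[OF c0 one, of "i - 1"] by (simp add: QJ_mult xi_zero_left)
  qed
  \<comment> \<open>Adding \<open>1 / p ^ k\<close> repeatedly lets \<open>xi\<close> produce
    integers in the first component, so only some \<open>w\<close> is claimed. It is corrected at
    the end by an element \<open>(z - w, 0)\<close>, for which \<open>xi\<close> vanishes.\<close>
  have nats: "\<exists>w. (w, of_nat n / of_nat p ^ k) \<in> S" for n k
  proof (induction n)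
    case 0 then show ?case using ints by auto
  next
    case (Suc n)
    then obtain w where "(w, of_nat n / of_nat p ^ k) \<in> S" by blast
    from mult[OF this frac[of k]] show ?case by (auto simp: QJ_mult add_divide_distrib add.commute)
  qed
  show ?thesis
  proof
    fix x assume "x \<in> carrier (QJ p \<alpha>)"
    then obtain z a k where x: "x = (z, of_int a / of_nat p ^ k)" by (cases x) (auto simp: QJ_carrier Zinv_def)
    have "\<exists>w. (w, of_int a / of_nat p ^ k) \<in> S"
    proof (cases "a \<ge> 0")
      case True
      then show ?thesis using nats[of "nat a" k] by simp
    next
      case False
      obtain w where w: "(w, of_nat (nat (- a)) / of_nat p ^ k) \<in> S" using nats by blast
      \<comment> \<open>A product with an element of \<open>S\<close> over
        \<open>- a / p ^ k\<close> has second component \<open>0\<close> and lies in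
        \<open>S\<close> by \<open>ints\<close>; cancellation does the rest.\<close>
      have "(0, of_int a / of_nat p ^ k) \<in> S"
      proof (rule cancel[OF _ w])
        show "(0, of_int a / of_nat p ^ k) \<in> carrier (QJ p \<alpha>)" by (simp add: QJ_carrier Zinv_fraction)
        show "(0, of_int a / of_nat p ^ k) \<otimes>\<^bsub>QJ p \<alpha>\<^esub> (w, of_nat (nat (- a)) / of_nat p ^ k) \<in> S"
          using False ints by (simp add: QJ_mult)
      qed
      then show ?thesis by blast
    qed
    then obtain w where w: "(w, of_int a / of_nat p ^ k) \<in> S" by blast
    show "x \<in> S" using mult[OF ints[of "z - w"] w] by (simp add: x QJ_mult xi_zero_left)
  qed
qed

end

section \<open>The trace on \<open>K0\<close> of the solenoid algebra\<close>

locale solenoid = solenoid_parameter p \<alpha> for p \<alpha> +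
  fixes A :: "'a cstar_alg" (structure) and W :: "rat \<times> rat \<Rightarrow> 'a"
  assumes algebra: "solenoid_algebra p \<alpha> A W"
begin

sublocale twisted_algebra "Zinv p \<times> Zinv p" "Psi p \<alpha>" A W
  using bicharacter_Psi algebra
  unfolding twisted_algebra_def twisted_algebra_axioms_def solenoid_algebra_def by blast

sublocale uniquely_traced_algebra A canonical_trace
  by (rule nondegenerate_uniquely_traced[OF Psi_nondegenerate])

text \<open>An identification prescribes the trace only on the generators of
  \<open>QJ p \<alpha>\<close>. Two additive maps that agree there agree everywhere.\<close>

lemma K0_trace_identification:
  assumes \<Phi>: "K0_identification p \<alpha> A \<Phi>" and X: "X \<in> carrier (K0 A)"
  shows "K0_trace A X = QJ_trace (\<Phi> X)"
proof -
  have hom: "\<Phi> Y \<in> carrier (QJ p \<alpha>)" if "Y \<in> carrier (K0 A)" for Y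
    using \<Phi> that unfolding K0_identification_def iso_def hom_def by auto
  have mult: "\<Phi> (Y \<otimes>\<^bsub>K0 A\<^esub> Z) = \<Phi> Y \<otimes>\<^bsub>QJ p \<alpha>\<^esub> \<Phi> Z" if "Y \<in> carrier (K0 A)" "Z \<in> carrier (K0 A)" for Y Z
    using \<Phi> that unfolding K0_identification_def iso_def hom_def by auto
  have inj: "inj_on \<Phi> (carrier (K0 A))" and surj: "\<Phi> ` carrier (K0 A) = carrier (QJ p \<alpha>)"
    using \<Phi> unfolding K0_identification_def iso_def bij_betw_def by auto
  have tr: "K0_trace A (Y \<otimes>\<^bsub>K0 A\<^esub> Z) - QJ_trace (\<Phi> (Y \<otimes>\<^bsub>K0 A\<^esub> Z))
      = (K0_trace A Y - QJ_trace (\<Phi> Y)) + (K0_trace A Z - QJ_trace (\<Phi> Z))"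
    if YZ: "Y \<in> carrier (K0 A)" "Z \<in> carrier (K0 A)" for Y Z
  proof -
    obtain a r b s where e: "\<Phi> Y = (a, r)" "\<Phi> Z = (b, s)" by (cases "\<Phi> Y", cases "\<Phi> Z")
    then have "r \<in> Zinv p" "s \<in> Zinv p" using hom YZ by (auto simp: QJ_carrier dest: hom)
    then show ?thesis using YZ e by (simp add: mult K0_trace_mult QJ_trace_mult)
  qed
  \<comment> \<open>The part of \<open>QJ p \<alpha>\<close> on which the two maps agree. Additivity
    of their difference, \<open>tr\<close>, yields both closure properties that
    \<open>QJ_generators\<close> asks for.\<close>
  define S where "S = \<Phi> ` {Y \<in> carrier (K0 A). K0_trace A Y = QJ_trace (\<Phi> Y)}"
  have S: "\<Phi> Y \<in> S \<longleftrightarrow> K0_trace A Y = QJ_trace (\<Phi> Y)" if "Y \<in> carrier (K0 A)" for Y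
    unfolding S_def using that inj by (auto simp: inj_on_def image_iff)
  have ex: "\<exists>Y\<in>carrier (K0 A). \<Phi> Y = a" if "a \<in> carrier (QJ p \<alpha>)" for a using surj that by force
  have Sc: "S \<subseteq> carrier (QJ p \<alpha>)" unfolding S_def using hom by auto
  have "carrier (QJ p \<alpha>) \<subseteq> S"
  proof (rule QJ_generators)
    fix a b assume "a \<in> S" "b \<in> S"
    moreover then obtain Y Z where "Y \<in> carrier (K0 A)" "Z \<in> carrier (K0 A)" "\<Phi> Y = a" "\<Phi> Z = b" using ex Sc by blast
    ultimately show "a \<otimes>\<^bsub>QJ p \<alpha>\<^esub> b \<in> S"
      using tr[of Y Z] S[of Y] S[of Z] S[of "Y \<otimes>\<^bsub>K0 A\<^esub> Z"] K0_mult_diff(1)[of Y Z] mult[of Y Z] by auto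
  next
    fix a b assume "a \<in> carrier (QJ p \<alpha>)" "b \<in> S" "a \<otimes>\<^bsub>QJ p \<alpha>\<^esub> b \<in> S"
    moreover then obtain Y Z where "Y \<in> carrier (K0 A)" "Z \<in> carrier (K0 A)" "\<Phi> Y = a" "\<Phi> Z = b" using ex Sc by blast
    ultimately show "a \<in> S"
      using tr[of Y Z] S[of Y] S[of Z] S[of "Y \<otimes>\<^bsub>K0 A\<^esub> Z"] K0_mult_diff(1)[of Y Z] mult[of Y Z] by auto
  next
    obtain Y where Y: "Y \<in> carrier (K0 A)" "\<Phi> Y = (1, 0)" using ex[of "(1, 0)"] by (auto simp: QJ_carrier Zinv_0)
    then have "K0_trace A Y = 1" using \<Phi> unfolding K0_identification_def by blast
    then show "(1, 0) \<in> S" using S[OF Y(1)] Y(2) by (simp add: QJ_trace_def)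
  next
    fix k
    have r: "1 / of_nat p ^ k \<in> Zinv p" using Zinv_fraction[of 1 k] by simp
    obtain Y where Y: "Y \<in> carrier (K0 A)" "\<Phi> Y = (0, 1 / of_nat p ^ k)"
      using ex[of "(0, 1 / of_nat p ^ k)"] r by (auto simp: QJ_carrier)
    obtain c where c: "k = pexp p (1 / of_nat p ^ k) + c" "1 = pnum p (1 / of_nat p ^ k) * int p ^ c"
      using fraction_reduced[OF p, of "1 / of_nat p ^ k" 1 k] by auto
    \<comment> \<open>The fraction \<open>1 / p ^ k\<close> is already reduced: the cancelled power
      of \<open>p\<close> divides \<open>1\<close>.\<close>
    have "int p ^ c dvd 1" using c(2) by (metis dvd_triv_right)
    then have "\<not> 1 < int p ^ c" by simp
    then have "c = 0" using p_gt_1 one_less_power[of "int p" c] by auto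
    then have "pexp p (of_int 1 / of_nat p ^ k) = k" using c(1) by simp
    from QJ_trace_fraction[OF this, of 0] have "QJ_trace (0, 1 / of_nat p ^ k) = \<alpha> k" by simp
    moreover have "K0_trace A Y = \<alpha> k" using \<Phi> Y unfolding K0_identification_def by blast
    ultimately show "(0, 1 / of_nat p ^ k) \<in> S" using S[OF Y(1)] Y(2) by simp
  qed
  then show ?thesis using S[OF X] hom[OF X] by blast
qed

text \<open>The commutation relation depends on \<open>q * \<alpha> N\<close> only modulo the
  integers, so the angle can be chosen as the fractional part. Irrationality puts it strictly
  between \<open>0\<close> and \<open>1\<close>.\<close>

lemma ex_projection_trace:
  assumes q: "q \<noteq> 0"
  shows "\<exists>e\<in>carrier A. e \<otimes> e = e \<and> canonical_trace e = of_real (frac (of_int q * \<alpha> N))"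
proof -
  define r :: rat where "r = of_int q / of_nat p ^ N"
  define V where "V = (\<lambda>n. W (of_int n * r, 0))"
  \<comment> \<open>The sign makes \<open>v\<close> rotate by \<open>+ \<beta>\<close>; with
    \<open>(0, 1)\<close> the angle would be \<open>- \<beta>\<close>.\<close>
  define v where "v = W (0, - 1)"
  define \<beta> where "\<beta> = frac (of_int q * \<alpha> N)"
  have nr: "of_int n * r = of_int (n * q) / of_nat p ^ N" for n by (simp add: r_def)
  have nrZ: "of_int n * r \<in> Zinv p" for n unfolding nr by (rule Zinv_fraction)
  have r0: "r \<noteq> 0" using q p by (simp add: r_def)
  have m1: "- 1 \<in> Zinv p" "1 \<in> Zinv p" using Zinv_int[of "- 1"] Zinv_int[of 1] by simp_all
  have G: "(of_int n * r, s) \<in> Zinv p \<times> Zinv p" if "s \<in> {0, 1, - 1}" for n s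
    using that nrZ m1 Zinv_0 by auto
  have G0: "(0, s) \<in> Zinv p \<times> Zinv p" if "s \<in> {0, 1, - 1}" for s
    using that m1 Zinv_0 by auto
  have Vv: "V n \<otimes> v = cis (- (2 * pi * of_int n * (of_int q * \<alpha> N))) \<odot> W (of_int n * r, - 1)" for n
  proof -
    have "Psi p \<alpha> (of_int n * r, 0) (0, - 1) = cis (- (2 * pi * of_int n * (of_int q * \<alpha> N)))"
      using Psi_value[of "(of_int n * r, 0)" "n * q" N "(0, - 1)" "- 1" 0] nr[of n] by (simp add: mult_ac)
    then show ?thesis unfolding V_def v_def by (simp add: W_mult[OF G G0])
  qed
  have vV: "v \<otimes> V n = W (of_int n * r, - 1)" for n
    using Psi_zero_left[of "(0, - 1)" "(of_int n * r, 0)"]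
    by (simp add: V_def v_def W_mult[OF G0 G] Zinv_0 scale_one[OF W_closed[OF G]])
  have adj_v: "adj A v = cnj (Psi p \<alpha> (0, - 1) (0, 1)) \<odot> W (0, 1)"
    using W_adj[OF G0[of "- 1"]] by (simp add: v_def)
  interpret rotation_pair A canonical_trace V v \<beta>
  proof
    show "unitary_family UNIV (\<lambda>_ _. 1) A V"
      unfolding unitary_family_def
    proof (intro conjI ballI)
      show "unitary_elt A (V n)" for n
        using family G[of 0 n] unfolding unitary_family_def V_def by blast
      show "V n \<otimes> V m = 1 \<odot> V (n + m)" for n m
        using Psi_zero_right[of "(of_int n * r, 0)" "(of_int m * r, 0)"] nrZ
        by (simp add: V_def W_mult[OF G G] ring_distribs)
    qed
    show "unitary_elt A v" using family G0[of "- 1"] unfolding unitary_family_def v_def by blast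
    show "v \<otimes> V n = cis (2 * pi * of_int n * \<beta>) \<odot> (V n \<otimes> v)" for n
    proof -
      have "cis (2 * pi * of_int n * \<beta>) * cis (- (2 * pi * of_int n * (of_int q * \<alpha> N)))
          = cis (2 * pi * of_int (- n * \<lfloor>of_int q * \<alpha> N\<rfloor>))"
        by (simp add: cis_mult \<beta>_def frac_def algebra_simps)
      also have "\<dots> = 1" by (rule cis_multiple_2pi) simp
      finally show ?thesis using W_closed[OF G, of "- 1" n] by (simp add: vV Vv scale_scale[symmetric] scale_one)
    qed
    show "canonical_trace (V n) = (if n = 0 then 1 else 0)" for n
      using canonical_trace_W[OF G[of 0 n]] r0 by (simp add: V_def zero_prod_def)
    show "canonical_trace (V n \<otimes> v) = 0" for n
      using canonical_trace_W[OF G[of "- 1" n]] by (simp add: Vv trace_scale[OF W_closed[OF G]] zero_prod_def)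
    show "canonical_trace (V n \<otimes> adj A v) = 0" for n
      using canonical_trace_W[OF G[of 1 n]]
      by (simp add: adj_v V_def scale_mult_right[OF W_closed[OF G] W_closed[OF G0]] W_mult[OF G G0]
        trace_scale[OF scale_closed[OF W_closed[OF G]]] trace_scale[OF W_closed[OF G]] zero_prod_def)
  qed
  have "of_int q * \<alpha> N \<notin> \<int>" using irrational_multiple[OF q, of N] Ints_subset_Rats by (auto simp: mult.commute)
  then have "0 < \<beta>" unfolding \<beta>_def by (simp add: frac_gt_0_iff)
  moreover have "\<beta> < 1" unfolding \<beta>_def by (rule frac_lt_1)
  ultimately show ?thesis using rieffel_idempotent unfolding \<beta>_def by blast
qed

lemma ex_module_trace:
  assumes \<gamma>: "\<gamma> = of_int z + of_int q * \<alpha> N" "\<gamma> > 0"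
  shows "\<exists>M :: ('a, nat \<Rightarrow> 'a) module. fg_projective A M \<and> module_trace A canonical_trace M = \<gamma>"
proof (cases "q = 0")
  \<comment> \<open>Here \<open>\<gamma> = z\<close> is a positive integer, realised by a free
    module.\<close>
  case True
  then show ?thesis
    using \<gamma> fg_projective_free[OF ring_axioms] module_trace_free[of "nat z"] by auto
next
  case False
  obtain e where e: "e \<in> carrier A" "e \<otimes> e = e" "canonical_trace e = of_real (frac (of_int q * \<alpha> N))"
    using ex_projection_trace[OF False] by blast
  define m where "m = z + \<lfloor>of_int q * \<alpha> N\<rfloor>"
  have m: "\<gamma> = of_int m + frac (of_int q * \<alpha> N)" unfolding \<gamma>(1) m_def frac_def by simp
  \<comment> \<open>The fractional part is less than \<open>1\<close>, so positivity of
    \<open>\<gamma>\<close> leaves no negative value for the integer \<open>m\<close>, and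
    \<open>nat m\<close> loses nothing.\<close>
  then have "real_of_int m > - 1" using \<gamma>(2) frac_lt_1[of "of_int q * \<alpha> N"] by linarith
  then have "m \<ge> 0" by linarith
  define M where "M = lmod_sum (free_lmod A (nat m)) (corner_module A e)"
  note fg = fg_projective_free[OF ring_axioms, of "nat m"] fg_projective_corner[OF e(1,2)]
  have M: "fg_projective A M" unfolding M_def by (rule fg_projective_sum[OF fg])
  have "module_trace A canonical_trace M = \<gamma>"
    unfolding M_def module_trace_sum[OF fg] module_trace_free module_trace_corner[OF e(1,2)] e(3)
    using m \<open>m \<ge> 0\<close> by simp
  \<comment> \<open>\<open>M\<close> consists of pairs; a row copy has elements of the required type
    and the same trace.\<close>
  moreover obtain P :: "('a, nat \<Rightarrow> 'a) module" where P: "fg_projective A P" "lmod_iso A M P"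
    using row_copy[OF M] by blast
  ultimately show ?thesis using module_trace_iso[OF M P] P(1) by auto
qed

end

theorem proposition4p1:
  fixes p :: nat and \<alpha> :: "nat \<Rightarrow> real"
    and A :: "'a cstar_alg" and W :: "rat \<times> rat \<Rightarrow> 'a"
    and \<gamma> :: real and z q :: int and N :: nat
  assumes "prime p" and "\<alpha> \<in> Xi p" and "\<alpha> 0 \<notin> \<rat>"
    and "solenoid_algebra p \<alpha> A W"
    and "\<gamma> = of_int z + of_int q * \<alpha> N" and "\<gamma> > 0"
  shows "(\<exists>M :: ('a, nat \<Rightarrow> 'a) module. fg_projective A M \<and> K0_trace A (K0_class A M) = \<gamma> \<and>
           (\<forall>\<Phi>. K0_identification p \<alpha> A \<Phi> \<and> pexp p (of_int q / of_nat p ^ N) = N \<longrightarrow>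
              \<Phi> (K0_class A M) = (z, of_int q / of_nat p ^ N))) \<and>
         (\<forall>(M :: ('a, nat \<Rightarrow> 'a) module) \<Phi>. fg_projective A M \<and> K0_identification p \<alpha> A \<Phi> \<and>
            pexp p (of_int q / of_nat p ^ N) = N \<longrightarrow>
            (K0_trace A (K0_class A M) = \<gamma> \<longleftrightarrow>
               \<Phi> (K0_class A M) = (z, of_int q / of_nat p ^ N)))"
proof -
  interpret solenoid p \<alpha> A W
    using assms(1-4) prime_gt_1_nat by unfold_locales auto
  have iff: "K0_trace A (K0_class A M) = \<gamma> \<longleftrightarrow> \<Phi> (K0_class A M) = (z, of_int q / of_nat p ^ N)"
    if M: "fg_projective A M" and \<Phi>: "K0_identification p \<alpha> A \<Phi>" and N: "pexp p (of_int q / of_nat p ^ N) = N"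
    for M :: "('a, nat \<Rightarrow> 'a) module" and \<Phi>
  proof -
    have "K0_trace A (K0_class A M) = QJ_trace (\<Phi> (K0_class A M))"
      by (rule K0_trace_identification[OF \<Phi> K0_class_carrier[OF M]])
    moreover have "\<gamma> = QJ_trace (z, of_int q / of_nat p ^ N)" using QJ_trace_fraction[OF N] assms(5) by simp
    ultimately show ?thesis using QJ_trace_inj by (metis surj_pair)
  qed
  obtain M :: "('a, nat \<Rightarrow> 'a) module" where M: "fg_projective A M" "module_trace A canonical_trace M = \<gamma>"
    using ex_module_trace[OF assms(5,6)] by blast
  then have "K0_trace A (K0_class A M) = \<gamma>" by (simp add: K0_trace_class)
  then show ?thesis using M(1) iff by blast
qed

end
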